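(* There exist polynomials $H_0,H_1,H_2\in\mathcal S=\mathbb C[t_1,t_2,t_3,d_1,d_2,d_3]$, homogeneous of weighted degree $14$, such that the polynomial $H=H_2\Lambda^2+H_1\Lambda+H_0$ is irreducible in $\mathcal R=\mathbb C[t_1,\dots,t_4,d_1,\dots,d_4,\Lambda]$ and satisfies the following three assertions: (1) the extended spectra $(t_1,\dots,t_4;d_1,\dots,d_4;\lambda_1,\lambda_2,\lambda_3)$ of any quadratic vector field in $\mathcal V_2$ satisfies $H(t;d;\Lambda)=0$ with $\Lambda=\lambda_1\lambda_2\lambda_3$; (2) the equality $H(t;d;\lambda_1\lambda_2\lambda_3)=0$ is independent from the relations (EJ1), (EJ2), (BB), (CS); (3) if $F\in\mathbb C[t_1,\dots,t_4,d_1,\dots,d_4,\lambda_1,\lambda_2,\lambda_3]$ is another polynomial vanishing on the extended spectra of every vector field in $\mathcal V_2$, then $F=0$ follows from $H(t;d;\lambda_1\lambda_2\lambda_3)=0$ together with the equalities (EJ1), (EJ2), (BB), (CS) and the inequalities $d_k\ne0$ ($k=1,\dots,4$) and $\lambda_j\neq 0$ ($j=1,2,3$). The polynomial $H$ with these properties is uniquely defined up to rescaling by a non-zero complex number.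
   Context: Grading: in $\mathcal R$ (and hence in the subring $\mathcal S$ of polynomials not depending on $t_4,d_4,\Lambda$) each $t_k$ has degree $1$, each $d_k$ has degree $2$, and $\Lambda$ has degree $0$; "weighted degree" refers to this grading. A quadratic vector field on $\mathbb C^2$ is $v=P\,\partial_x+Q\,\partial_y$ with $P,Q\in\mathbb C[x,y]$ of degree at most $2$; let $P_2,Q_2$ be the homogeneous parts of degree $2$. $\mathcal V_2$ is the space of all quadratic vector fields $v$ having exactly $4$ isolated singularities $p_1,\dots,p_4\in\mathbb C^2$ and such that the extension $\mathcal F_v$ of the foliation to $\mathbb P^2$ has an invariant line at infinity $\mathcal L=\mathbb P^2\setminus\mathbb C^2$ carrying exactly $3$ singular points (i.e. $yP_2-xQ_2$ is a nonzero cubic form with three distinct zeros in $\mathbb P^1$). Both the finite and the infinite singularities are assumed to be enumerated. Extended spectra: $t_k=\operatorname{tr}Dv(p_k)$, $d_k=\det Dv(p_k)$ for $k=1,\dots,4$, where $Dv$ is the Jacobian matrix of $(P,Q)$, together with the characteristic numbers at infinity $\lambda_1,\lambda_2,\lambda_3$. The latter are the Camacho-Sad indices of $\mathcal F_v$ along $\mathcal L$: in the coordinates $z=1/x$, $w=y/x$ the foliation is given by $\frac{dz}{dw}=z\sum_{j=1}^3\frac{\lambda_j}{w-w_j}+O(z^2)$, where $w_j$ are the singular points on $\mathcal L=\{z=0\}$; if a singular point at infinity lies in the direction $x=0$, one first applies a linear change of coordinates, on which the $\lambda_j$ do not depend. For $v\in\mathcal V_2$ all $d_k$ and $\lambda_j$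 are nonzero. The four classical relations are (EJ1) $\sum_{k=1}^4 \frac1{d_k}=0$; (EJ2) $\sum_{k=1}^4\frac{t_k}{d_k}=0$; (BB) $\sum_{k=1}^4\frac{t_k^2}{d_k}+\sum_{j=1}^3\frac{(\lambda_j+1)^2}{\lambda_j}=16$; (CS) $\lambda_1+\lambda_2+\lambda_3=1$. "Independent" means that the equality is not a consequence of the four relations: there is a tuple $(t;d;\lambda)\in\mathbb C^{11}$ with all $d_k,\lambda_j\ne0$ satisfying (EJ1), (EJ2), (BB), (CS) at which it fails. "$F=0$ follows from" a list of conditions means that $F$ vanishes at every point $(t;d;\lambda)\in\mathbb C^{11}$ satisfying all of them. *)

theory Defs
  imports
    "HOL-Analysis.Analysis"
    "HOL-Library.Poly_Mapping"
    "HOL-Library.Landau_Symbols"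
    "HOL-Computational_Algebra.Factorial_Ring"
begin

section \<open>Polynomials over the complex numbers\<close>

text \<open>
  \<open>'x mpoly\<close> is the ring of polynomials whose indeterminates are the elements of \<open>'x\<close>: a monomial
  is a finitely supported exponent function, and a polynomial is a finitely supported function
  from monomials to coefficients. The ring structure is the convolution product of
  \<^theory>\<open>HOL-Library.Poly_Mapping\<close>.
\<close>

type_synonym 'x mpoly = "('x \<Rightarrow>\<^sub>0 nat) \<Rightarrow>\<^sub>0 complex"

definition Const :: "complex \<Rightarrow> 'x mpoly" where
  "Const c = Poly_Mapping.single 0 c"

definition Var :: "'x \<Rightarrow> 'x mpoly" where
  "Var i = Poly_Mapping.single (Poly_Mapping.single i 1) 1"

definition peval :: "'x mpoly \<Rightarrow> ('x \<Rightarrow> complex) \<Rightarrow> complex" where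
  "peval F a = (\<Sum>m\<in>Poly_Mapping.keys F.
     Poly_Mapping.lookup F m * (\<Prod>i\<in>Poly_Mapping.keys m. a i ^ Poly_Mapping.lookup m i))"

definition mdegree :: "('x \<Rightarrow> nat) \<Rightarrow> ('x \<Rightarrow>\<^sub>0 nat) \<Rightarrow> nat" where
  "mdegree wt m = (\<Sum>i\<in>Poly_Mapping.keys m. wt i * Poly_Mapping.lookup m i)"

text \<open>As usual, the zero polynomial counts as homogeneous of every degree.\<close>

definition homogeneous :: "('x \<Rightarrow> nat) \<Rightarrow> nat \<Rightarrow> 'x mpoly \<Rightarrow> bool" where
  "homogeneous wt n F \<longleftrightarrow> (\<forall>m\<in>Poly_Mapping.keys F. mdegree wt m = n)"

definition total_degree_le :: "nat \<Rightarrow> 'x mpoly \<Rightarrow> bool" where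
  "total_degree_le n F \<longleftrightarrow> (\<forall>m\<in>Poly_Mapping.keys F. mdegree (\<lambda>_. 1) m \<le> n)"

definition hom_part :: "nat \<Rightarrow> 'x mpoly \<Rightarrow> 'x mpoly" where
  "hom_part n F = (\<Sum>m\<in>{m\<in>Poly_Mapping.keys F. mdegree (\<lambda>_. 1) m = n}.
     Poly_Mapping.single m (Poly_Mapping.lookup F m))"


section \<open>Quadratic vector fields\<close>

text \<open>
  A polynomial vector field \<open>v = P \<partial>\<^sub>x + Q \<partial>\<^sub>y\<close> is the pair \<open>P = v $ 1\<close>, \<open>Q = v $ 2\<close>. The indeterminates
  \<open>x\<close>, \<open>y\<close> and the coordinates on the plane are indexed by \<open>1\<close>, \<open>2\<close> of the two-element type.
\<close>

type_synonym vfield = "2 mpoly ^ 2"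

definition quadratic :: "vfield \<Rightarrow> bool" where
  "quadratic v \<longleftrightarrow> (\<forall>i. total_degree_le 2 (v $ i))"

definition vf_at :: "vfield \<Rightarrow> complex ^ 2 \<Rightarrow> complex ^ 2" where
  "vf_at v z = (\<chi> i. peval (v $ i) (($) z))"

definition singularities :: "vfield \<Rightarrow> (complex ^ 2) set" where
  "singularities v = {z. vf_at v z = 0}"

definition jacobian :: "vfield \<Rightarrow> complex ^ 2 \<Rightarrow> complex ^ 2 ^ 2" where
  "jacobian v z =
     (\<chi> i j. deriv (\<lambda>s. peval (v $ i) (\<lambda>k. if k = j then s else z $ k)) (z $ j))"

text \<open>The cubic form \<open>y P\<^sub>2 - x Q\<^sub>2\<close>.\<close>

definition infinity_form :: "vfield \<Rightarrow> complex ^ 2 \<Rightarrow> complex" where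
  "infinity_form v u =
     u $ 2 * peval (hom_part 2 (v $ 1)) (($) u) - u $ 1 * peval (hom_part 2 (v $ 2)) (($) u)"

text \<open>The singular points at infinity, as lines through the origin, i.e. points of \<open>P\<^sup>1\<close>.\<close>

definition infinite_singularities :: "vfield \<Rightarrow> (complex ^ 2) set set" where
  "infinite_singularities v = (\<lambda>u. vec.span {u}) ` {u. u \<noteq> 0 \<and> infinity_form v u = 0}"

text \<open>
  All singularities of a field with exactly four singularities are isolated. (Conversely, if
  \<open>P\<close> and \<open>Q\<close> have a common factor, at most one singularity is isolated, so a quadratic field with
  exactly four isolated singularities has no others.) Having exactly three
  zeros in \<open>P\<^sup>1\<close> forces the cubic form to be nonzero, so that the line at infinity is invariant.
\<close>

definition V2 :: "vfield set" where
  "V2 = {v. quadratic v \<and> card (singularities v) = 4 \<and> card (infinite_singularities v) = 3}"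


section \<open>Extended spectra\<close>

text \<open>\<open>v'\<close> is \<open>v\<close> written in the coordinates \<open>A z\<close>.\<close>

definition linear_change :: "complex ^ 2 ^ 2 \<Rightarrow> vfield \<Rightarrow> vfield \<Rightarrow> bool" where
  "linear_change A v v' \<longleftrightarrow>
     invertible A \<and> quadratic v' \<and> (\<forall>z. vf_at v' (A *v z) = A *v vf_at v z)"

text \<open>
  The foliation in the chart \<open>z = 1/x\<close>, \<open>w = y/x\<close>: since \<open>dz = - dx / x\<^sup>2\<close> and
  \<open>dw = (x dy - y dx) / x\<^sup>2\<close>, we have \<open>dz/dw = - P / (x Q - y P)\<close> with \<open>x = 1/z\<close>, \<open>y = w/z\<close>.
\<close>

definition dz_dw :: "vfield \<Rightarrow> complex \<Rightarrow> complex \<Rightarrow> complex" where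
  "dz_dw v w z =
     (let x = 1 / z; y = w / z; V = vf_at v (vector [x, y])
      in - (V $ 1) / (x * V $ 2 - y * V $ 1))"

text \<open>
  \<open>W\<close> enumerates the three singular points at infinity, all of them being in the chart, and \<open>l\<close>
  the characteristic numbers in the same order.
\<close>

definition char_numbers_chart :: "vfield \<Rightarrow> complex ^ 3 \<Rightarrow> complex ^ 3 \<Rightarrow> bool" where
  "char_numbers_chart v W l \<longleftrightarrow>
     inj (($) W) \<and>
     infinite_singularities v = range (\<lambda>j. vec.span {vector [1, W $ j]}) \<and>
     (\<forall>w. w \<notin> range (($) W) \<longrightarrow>
        (\<lambda>z. dz_dw v w z - z * (\<Sum>j\<in>UNIV. l $ j / (w - W $ j))) \<in> O[at 0](\<lambda>z. z\<^sup>2))"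

text \<open>
  The linear change moves the infinite singularities into the chart; the characteristic numbers do not
  depend on it, and the identity is admissible if there is no singularity in the direction \<open>x = 0\<close>.
\<close>

definition char_numbers :: "vfield \<Rightarrow> complex ^ 3 \<Rightarrow> bool" where
  "char_numbers v l \<longleftrightarrow> (\<exists>A v' W. linear_change A v v' \<and> char_numbers_chart v' W l)"

text \<open>
  \<open>(t, d, l)\<close> is an extended spectrum of \<open>v\<close> for some enumeration \<open>p\<close> of the finite singularities
  and some enumeration of the infinite ones.
\<close>

definition extended_spectrum ::
    "vfield \<Rightarrow> complex ^ 4 \<Rightarrow> complex ^ 4 \<Rightarrow> complex ^ 3 \<Rightarrow> bool" where
  "extended_spectrum v t d l \<longleftrightarrow>
     (\<exists>p. bij_betw p UNIV (singularities v) \<and>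
          (\<forall>k. t $ k = trace (jacobian v (p k)) \<and> d $ k = det (jacobian v (p k)))) \<and>
     char_numbers v l"


section \<open>The classical relations\<close>

definition EJ1 :: "complex ^ 4 \<Rightarrow> bool" where
  "EJ1 d \<longleftrightarrow> (\<Sum>k\<in>UNIV. 1 / d $ k) = 0"

definition EJ2 :: "complex ^ 4 \<Rightarrow> complex ^ 4 \<Rightarrow> bool" where
  "EJ2 t d \<longleftrightarrow> (\<Sum>k\<in>UNIV. t $ k / d $ k) = 0"

definition BB :: "complex ^ 4 \<Rightarrow> complex ^ 4 \<Rightarrow> complex ^ 3 \<Rightarrow> bool" where
  "BB t d l \<longleftrightarrow>
     (\<Sum>k\<in>UNIV. (t $ k)\<^sup>2 / d $ k) + (\<Sum>j\<in>UNIV. (l $ j + 1)\<^sup>2 / l $ j) = 16"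

definition CS :: "complex ^ 3 \<Rightarrow> bool" where
  "CS l \<longleftrightarrow> (\<Sum>j\<in>UNIV. l $ j) = 1"

text \<open>The four relations, together with the inequations which give them a meaning.\<close>

definition classical_relations :: "complex ^ 4 \<Rightarrow> complex ^ 4 \<Rightarrow> complex ^ 3 \<Rightarrow> bool" where
  "classical_relations t d l \<longleftrightarrow>
     (\<forall>k. d $ k \<noteq> 0) \<and> (\<forall>j. l $ j \<noteq> 0) \<and> EJ1 d \<and> EJ2 t d \<and> BB t d l \<and> CS l"


section \<open>The polynomial rings\<close>

text \<open>
  The indeterminates of \<open>\<R> = \<complex>[t\<^sub>1,\<dots>,t\<^sub>4,d\<^sub>1,\<dots>,d\<^sub>4,\<Lambda>]\<close> and of
  \<open>\<complex>[t\<^sub>1,\<dots>,t\<^sub>4,d\<^sub>1,\<dots>,d\<^sub>4,\<lambda>\<^sub>1,\<lambda>\<^sub>2,\<lambda>\<^sub>3]\<close>. The elements of the numeral type \<open>4\<close> are \<open>1\<close>, \<open>2\<close>, \<open>3\<close>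
  and \<open>4 = 0\<close>; similarly for \<open>3\<close>.
\<close>

datatype rvar = RT "4" | RD "4" | RLambda

datatype svar = ST "4" | SD "4" | SL "3"

fun grade :: "rvar \<Rightarrow> nat" where
  "grade (RT k) = 1"
| "grade (RD k) = 2"
| "grade RLambda = 0"

definition subring_S :: "rvar mpoly set" where
  "subring_S = {F. \<forall>m\<in>Poly_Mapping.keys F. Poly_Mapping.keys m \<inter> {RT 4, RD 4, RLambda} = {}}"

definition R_eval :: "rvar mpoly \<Rightarrow> complex ^ 4 \<Rightarrow> complex ^ 4 \<Rightarrow> complex \<Rightarrow> complex" where
  "R_eval H t d L = peval H (case_rvar (($) t) (($) d) L)"

definition spectra_eval :: "svar mpoly \<Rightarrow> complex ^ 4 \<Rightarrow> complex ^ 4 \<Rightarrow> complex ^ 3 \<Rightarrow> complex" where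
  "spectra_eval F t d l = peval F (case_svar (($) t) (($) d) (($) l))"


section \<open>The missing relation\<close>

definition spectral_form :: "rvar mpoly \<Rightarrow> bool" where
  "spectral_form H \<longleftrightarrow>
     (\<exists>H0\<in>subring_S. \<exists>H1\<in>subring_S. \<exists>H2\<in>subring_S.
        homogeneous grade 14 H0 \<and> homogeneous grade 14 H1 \<and> homogeneous grade 14 H2 \<and>
        H = H2 * Var RLambda ^ 2 + H1 * Var RLambda + H0)"

definition holds_on_spectra :: "rvar mpoly \<Rightarrow> bool" where
  "holds_on_spectra H \<longleftrightarrow>
     (\<forall>v\<in>V2. \<forall>t d l. extended_spectrum v t d l \<longrightarrow> R_eval H t d (\<Prod>j\<in>UNIV. l $ j) = 0)"

definition independent_of_classical :: "rvar mpoly \<Rightarrow> bool" where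
  "independent_of_classical H \<longleftrightarrow>
     (\<exists>t d l. classical_relations t d l \<and> R_eval H t d (\<Prod>j\<in>UNIV. l $ j) \<noteq> 0)"

definition implies_all_relations :: "rvar mpoly \<Rightarrow> bool" where
  "implies_all_relations H \<longleftrightarrow>
     (\<forall>F. (\<forall>v\<in>V2. \<forall>t d l. extended_spectrum v t d l \<longrightarrow> spectra_eval F t d l = 0) \<longrightarrow>
        (\<forall>t d l. classical_relations t d l \<and> R_eval H t d (\<Prod>j\<in>UNIV. l $ j) = 0 \<longrightarrow>
           spectra_eval F t d l = 0))"

definition missing_relation :: "rvar mpoly \<Rightarrow> bool" where
  "missing_relation H \<longleftrightarrow>
     spectral_form H \<and> irreducible H \<and>
     holds_on_spectra H \<and> independent_of_classical H \<and> implies_all_relations H"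

end

theory Submission
  imports Defs "HOL-Computational_Algebra.Polynomial_Factorial" "HOL-Computational_Algebra.Field_as_Ring"
    "HOL-Computational_Algebra.Fundamental_Theorem_Algebra"
begin

text \<open>
  If three of the singular points are moved to \<open>(0,0)\<close>, \<open>(1,0)\<close>, \<open>(0,1)\<close>, the field becomes a matrix \<open>A\<close>
  applied to two conics which are determined by the ratios of the \<open>d\<^sub>k\<close>, while the \<open>t\<^sub>k\<close> are linear in \<open>A\<close>
  and \<open>d\<^sub>1 = det A\<close>. So \<open>t\<close> and \<open>d\<close> leave two possibilities for \<open>A\<close> (twin fields), which differ in the sign of a square
  root \<open>\<surd>E\<close>. The product of the characteristic numbers is \<open>\<Lambda> = e\<^sub>2 / D\<close>, where \<open>e\<^sub>2 = d\<^sub>1 d\<^sub>2 + d\<^sub>1 d\<^sub>3 + d\<^sub>2 d\<^sub>3\<close> and \<open>D\<close> is the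
  discriminant of the cubic form at infinity. One finds \<open>8 \<pi> D = T - C \<surd>E\<close> with polynomials \<open>T\<close>, \<open>C\<close>, \<open>E\<close> in \<open>t\<close>, \<open>d\<close>
  and \<open>\<pi> = (d\<^sub>2 + d\<^sub>3) (d\<^sub>1 + d\<^sub>3) (d\<^sub>1 + d\<^sub>2)\<close>. It turns out that \<open>T\<^sup>2 - C\<^sup>2 E = \<pi> N\<close> with a polynomial \<open>N\<close>, so that
  \<open>64 \<pi> D\<^sup>2 - 16 T D + N = 0\<close>; replacing \<open>D\<close> by \<open>e\<^sub>2 / \<Lambda>\<close> gives \<open>H = N \<Lambda>\<^sup>2 - 16 e\<^sub>2 T \<Lambda> + 64 \<pi> e\<^sub>2\<^sup>2\<close>.

  Conversely, a point which satisfies \<open>H = 0\<close> and the classical relations is the spectrum of a field as soon as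
  \<open>\<pi> \<noteq> 0\<close>. The other points are limits of such points: for fixed \<open>\<Lambda> \<noteq> 0\<close> the polynomial \<open>H\<close> vanishes
  identically in \<open>t\<close> only if \<open>d = 0\<close>, so \<open>d\<close> can be perturbed arbitrarily and \<open>t\<close> adapted by the continuity of the roots. The polynomial \<open>H\<close>
  is irreducible, hence prime, because its coefficients have no common factor and its discriminant is not a square. Any other
  candidate vanishes at both roots of \<open>H\<close> for generic \<open>(t, d)\<close>, so it is divisible by \<open>H\<close>.
\<close>

section \<open>Evaluation of polynomials\<close>

\<comment> \<open>Dimension count: the classical relations determine \<open>t$4\<close>,
  \<open>d$4\<close> and two symmetric functions of the characteristic numbers. So, up to the order
  of the latter, a point is given by seven numbers: three traces, three determinants and the
  product. Quadratic fields have twelve coefficients and the plane affine group has dimension six,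
  which leaves six parameters; so exactly one further equation is expected. Divisibility of the
  norm: for \<open>x3 = 0\<close> the radicand is \<open>(x1*T1 - x2*T2)^2\<close>, the coefficient
  of its root is \<open>x1*x2*(T1-T2)^3\<close>, and \<open>twin_sum\<close> is this coefficient
  times \<open>x1*T1 - x2*T2\<close>. Hence the norm vanishes for \<open>x3 = 0\<close>, and by
  cyclic symmetry also for \<open>x1 = 0\<close> and for \<open>x2 = 0\<close>. Without the division
  the relation would contain the factor \<open>x1*x2*x3\<close> and be reducible. The obstacle: this
  product can vanish both for fields in \<open>V2\<close> and at points of the hypersurface, and
  there the division breaks down. Therefore both directions contain a limit argument: for fields the
  parameters \<open>m\<close> and \<open>n\<close> are moved, for points the numbers
  \<open>d$k\<close>.\<close>
alias lookup = Poly_Mapping.lookup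
alias keys = Poly_Mapping.keys
alias single = Poly_Mapping.single

lemma poly_mapping_single_induct [case_names zero add]:
  fixes F :: "'a \<Rightarrow>\<^sub>0 'b::comm_monoid_add"
  assumes "P 0" and "\<And>m c F. P F \<Longrightarrow> P (single m c + F)"
  shows "P F"
proof -
  have F: "F = (\<Sum>m\<in>keys F. single m (lookup F m))"
    by (rule poly_mapping_eqI)
       (simp add: lookup_sum lookup_single when_def in_keys_iff)
  have "P (\<Sum>m\<in>A. single m (lookup F m))" if "finite A" for A
    using that by (induction A) (use assms in auto)
  from this[OF finite_keys] show ?thesis by (subst F)
qed

definition mono_eval :: "('x \<Rightarrow>\<^sub>0 nat) \<Rightarrow> ('x \<Rightarrow> complex) \<Rightarrow> complex" where
  "mono_eval m a = (\<Prod>i\<in>keys m. a i ^ lookup m i)"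

lemma mono_eval_superset:
  assumes "finite A" "keys m \<subseteq> A"
  shows "mono_eval m a = (\<Prod>i\<in>A. a i ^ lookup m i)"
  unfolding mono_eval_def using assms
  by (intro prod.mono_neutral_left) (auto simp: in_keys_iff)

lemma mono_eval_zero [simp]: "mono_eval 0 a = 1"
  by (simp add: mono_eval_def)

lemma mono_eval_add: "mono_eval (m + n) a = mono_eval m a*mono_eval n a"
proof -
  let ?A = "keys m \<union> keys n"
  show ?thesis
    by (simp add: mono_eval_superset[where A = ?A] keys_add lookup_add power_add prod.distrib)
qed

lemma mono_eval_single [simp]: "mono_eval (single i n) a = a i ^ n"
  by (cases "n = 0") (simp_all add: mono_eval_def)

lemma peval_superset:
  assumes "finite A" "keys F \<subseteq> A"
  shows "peval F a = (\<Sum>m\<in>A. lookup F m*mono_eval m a)"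
  unfolding peval_def mono_eval_def[symmetric] using assms
  by (intro sum.mono_neutral_left) (auto simp: in_keys_iff)

lemma peval_zero [simp]: "peval 0 a = 0"
  by (simp add: peval_def)

lemma peval_add [simp]: "peval (F + G) a = peval F a + peval G a"
proof -
  let ?A = "keys F \<union> keys G"
  show ?thesis
    by (simp add: peval_superset[where A = ?A] keys_add lookup_add algebra_simps sum.distrib)
qed

lemma peval_single [simp]: "peval (single m c) a = c*mono_eval m a"
  by (cases "c = 0") (simp_all add: peval_def mono_eval_def)

lemma peval_mult [simp]: "peval (F*G) a = peval F a*peval G a"
proof (induction F rule: poly_mapping_single_induct)
  case (add m c F)
  have "peval (single m c*G) a = c*mono_eval m a*peval G a"
    by (induction G rule: poly_mapping_single_induct)
       (simp_all add: mult_single mono_eval_add algebra_simps)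
  with add show ?case by (simp add: algebra_simps)
qed simp

lemma peval_uminus [simp]: "peval (- F) a = - peval F a"
  by (rule minus_unique[symmetric]) (simp flip: peval_add)

lemma peval_diff [simp]: "peval (F - G) a = peval F a - peval G a"
  using peval_add[of F "- G" a] by simp

lemma peval_one [simp]: "peval 1 a = 1"
  by (simp flip: single_one)

lemma peval_Const [simp]: "peval (Const c) a = c"
  by (simp add: Const_def)

lemma peval_Var [simp]: "peval (Var i) a = a i"
  by (simp add: Var_def)

lemma peval_power [simp]: "peval (F ^ n) a = peval F a ^ n"
  by (induction n) simp_all

lemma peval_numeral [simp]: "peval (numeral n) a = numeral n"
  by (simp flip: single_numeral)

lemma peval_sum [simp]: "peval (\<Sum>i\<in>A. f i) a = (\<Sum>i\<in>A. peval (f i) a)"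
  by (induction A rule: infinite_finite_induct) simp_all

lemma mpoly_induct [case_names Const Var add mult]:
  assumes "\<And>c. P (Const c)" "\<And>i. P (Var i)" "\<And>F G. P F \<Longrightarrow> P G \<Longrightarrow> P (F + G)"
    "\<And>F G. P F \<Longrightarrow> P G \<Longrightarrow> P (F*G)"
  shows "P F"
proof (induction F rule: poly_mapping_single_induct)
  case zero
  show ?case using assms(1)[of 0] by (simp add: Const_def)
next
  case (add m c F)
  have "P (single m 1)"
  proof (induction m rule: poly_mapping_single_induct)
    case zero
    show ?case using assms(1)[of 1] by (simp add: Const_def)
  next
    case (add i n m)
    have "P (single (single i n) 1)"
    proof (induction n)
      case 0
      show ?case using assms(1)[of 1] by (simp add: Const_def)
    next
      case (Suc n)
      have "single (single i (Suc n)) 1 =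
          Var i * single (single i n) (1::complex)"
        by (simp add: Var_def mult_single flip: single_add)
      with Suc assms(2,4) show ?case by simp
    qed
    with add assms(4) have "P (single (single i n) 1 * single m 1)"
      by blast
    then show ?case by (simp add: mult_single)
  qed
  with assms(1,4) have "P (Const c * single m 1)"
    by blast
  with add assms(3) show ?case
    by (simp add: Const_def mult_single)
qed

lemma tendsto_peval:
  assumes "\<And>i. ((\<lambda>x. f x i) \<longlongrightarrow> a i) L"
  shows "((\<lambda>x. peval F (f x)) \<longlongrightarrow> peval F a) L"
  by (induction F rule: mpoly_induct) (auto intro!: tendsto_intros assms)

text \<open>The degree bound holds for all lines at once. This uniformity is what
  \<open>small_perturbed_root\<close> needs, where the base point moves.\<close>

lemma peval_line_poly:
  "\<exists>N. \<forall>a b. \<exists>p. degree p \<le> N \<and> (\<forall>s. poly p s = peval F (\<lambda>i. a i + s*b i))"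
proof (induction F rule: mpoly_induct)
  case (Const c)
  show ?case by (intro exI[of _ 0] allI exI[of _ "[:c:]"]) simp
next
  case (Var i)
  have "degree [:x, y:] \<le> 1 \<and> (\<forall>s. poly [:x, y:] s = x + s*y)" for x y :: complex by simp
  then show ?case unfolding peval_Var by blast
next
  case (add F G)
  then obtain M N where
    M: "\<And>a b. \<exists>p. degree p \<le> M \<and> (\<forall>s. poly p s = peval F (\<lambda>i. a i + s*b i))" and
    N: "\<And>a b. \<exists>p. degree p \<le> N \<and> (\<forall>s. poly p s = peval G (\<lambda>i. a i + s*b i))" by blast
  show ?case
  proof (intro exI[of _ "max M N"] allI)
    fix a b :: "'a \<Rightarrow> complex"
    obtain p q where "degree p \<le> M" "\<forall>s. poly p s = peval F (\<lambda>i. a i + s*b i)"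
      "degree q \<le> N" "\<forall>s. poly q s = peval G (\<lambda>i. a i + s*b i)"
      using M[of a b] N[of a b] by blast
    then show "\<exists>p. degree p \<le> max M N \<and> (\<forall>s. poly p s = peval (F + G) (\<lambda>i. a i + s*b i))"
      by (intro exI[of _ "p + q"]) (auto intro!: degree_add_le)
  qed
next
  case (mult F G)
  then obtain M N where
    M: "\<And>a b. \<exists>p. degree p \<le> M \<and> (\<forall>s. poly p s = peval F (\<lambda>i. a i + s*b i))" and
    N: "\<And>a b. \<exists>p. degree p \<le> N \<and> (\<forall>s. poly p s = peval G (\<lambda>i. a i + s*b i))" by blast
  show ?case
  proof (intro exI[of _ "M + N"] allI)
    fix a b :: "'a \<Rightarrow> complex"
    obtain p q where "degree p \<le> M" "\<forall>s. poly p s = peval F (\<lambda>i. a i + s*b i)"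
      "degree q \<le> N" "\<forall>s. poly q s = peval G (\<lambda>i. a i + s*b i)"
      using M[of a b] N[of a b] by blast
    then show "\<exists>p. degree p \<le> M + N \<and> (\<forall>s. poly p s = peval (F*G) (\<lambda>i. a i + s*b i))"
      by (intro exI[of _ "p*q"]) (auto intro: order.trans[OF degree_mult_le])
  qed
qed

lemma keys_numeral_subset: "keys (numeral n :: 'x mpoly) \<subseteq> {0}"
  by (auto simp: in_keys_iff lookup_numeral when_def split: if_splits)

section \<open>Polynomials in a restricted set of indeterminates\<close>

definition mpoly_over :: "'x set \<Rightarrow> 'x mpoly set" where
  "mpoly_over V = {F. \<forall>m\<in>keys F. keys m \<subseteq> V}"

lemma mpoly_over_add: "F \<in> mpoly_over V \<Longrightarrow> G \<in> mpoly_over V \<Longrightarrow> F + G \<in> mpoly_over V"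
  unfolding mpoly_over_def using keys_add[of F G] by blast

lemma mpoly_over_diff: "F \<in> mpoly_over V \<Longrightarrow> G \<in> mpoly_over V \<Longrightarrow> F - G \<in> mpoly_over V"
  unfolding mpoly_over_def using keys_diff[of F G] by blast

lemma mpoly_over_uminus: "F \<in> mpoly_over V \<Longrightarrow> - F \<in> mpoly_over V"
  unfolding mpoly_over_def by simp

lemma mpoly_over_mult: "F \<in> mpoly_over V \<Longrightarrow> G \<in> mpoly_over V \<Longrightarrow> F*G \<in> mpoly_over V"
  unfolding mpoly_over_def
proof (safe, goal_cases)
  case (1 m i)
  then obtain m1 m2 where m: "m = m1 + m2" "m1 \<in> keys F" "m2 \<in> keys G"
    using keys_mult[of F G] by blast
  with 1 keys_add[of m1 m2] show ?case by blast
qed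

lemma mpoly_over_Const: "Const c \<in> mpoly_over V"
  by (simp add: mpoly_over_def Const_def)

lemma mpoly_over_one: "1 \<in> mpoly_over V"
  by (simp add: mpoly_over_def)

lemma mpoly_over_numeral: "numeral n \<in> mpoly_over V"
  using keys_numeral_subset[of n] by (auto simp: mpoly_over_def)

lemma mpoly_over_power: "F \<in> mpoly_over V \<Longrightarrow> F ^ n \<in> mpoly_over V"
  by (induction n) (auto intro: mpoly_over_one mpoly_over_mult)

lemma mpoly_over_Var: "i \<in> V \<Longrightarrow> Var i \<in> mpoly_over V"
  by (simp add: mpoly_over_def Var_def)

lemma mpoly_over_mono: "V \<subseteq> W \<Longrightarrow> mpoly_over V \<subseteq> mpoly_over W"
  by (auto simp: mpoly_over_def)

lemma mpoly_over_UNIV [simp]: "mpoly_over UNIV = UNIV"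
  by (simp add: mpoly_over_def)

lemma peval_cong_over:
  assumes "F \<in> mpoly_over V" "\<And>i. i \<in> V \<Longrightarrow> a i = b i"
  shows "peval F a = peval F b"
  using assms unfolding peval_def mpoly_over_def
  by (intro sum.cong refl arg_cong2[where f = "(*)"] prod.cong) (auto simp: subset_iff)

section \<open>Unique factorization\<close>

text \<open>
  \<open>h\<close> identifies the ring \<open>'b\<close> with the polynomials in the indeterminates \<open>V\<close>. The last clause is a
  form of injectivity which survives the adjunction of an indeterminate; iterating the adjunction, \<open>'b\<close> becomes
  a nested univariate polynomial type, for which factoriality is in the library.
\<close>

definition poly_model :: "('b::comm_ring_1 \<Rightarrow> 'x mpoly) \<Rightarrow> 'x set \<Rightarrow> bool" where
  "poly_model h V \<longleftrightarrow>
     (\<forall>a b. h (a + b) = h a + h b) \<and> (\<forall>a b. h (a*b) = h a*h b) \<and> h 1 = 1 \<and>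
     range h = mpoly_over V \<and> (\<forall>p. (\<forall>a. peval (h p) a = 0) \<longrightarrow> p = 0)"

lemma poly_modelD:
  assumes "poly_model h V"
  shows "h (a + b) = h a + h b" "h (a*b) = h a*h b" "h 1 = 1" "range h = mpoly_over V"
    "h a \<in> mpoly_over V" "(\<And>x. peval (h a) x = 0) \<Longrightarrow> a = 0"
    "h 0 = 0" "h (- a) = - h a" "h (a - b) = h a - h b" "h a = h b \<longleftrightarrow> a = b"
proof -
  show add: "h (a + b) = h a + h b" for a b using assms by (simp add: poly_model_def)
  show "h (a*b) = h a*h b" "h 1 = 1" "range h = mpoly_over V" "h a \<in> mpoly_over V"
    using assms by (auto simp: poly_model_def)
  show faith: "(\<And>x. peval (h a) x = 0) \<Longrightarrow> a = 0" for a using assms by (simp add: poly_model_def)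
  show zero: "h 0 = 0" using add[of 0 0] by simp
  show um: "h (- a) = - h a" for a using add[of a "- a"] zero by (simp add: eq_neg_iff_add_eq_0 add.commute)
  show diff: "h (a - b) = h a - h b" for a b using add[of a "- b"] um by simp
  show "h a = h b \<longleftrightarrow> a = b" using faith[of "a - b"] diff by auto
qed

lemma poly_model_Const: "poly_model Const {}"
proof -
  have "F \<in> range Const" if "F \<in> mpoly_over {}" for F :: "'a mpoly"
  proof -
    have "m = 0" if "m \<in> keys F" for m
    proof (rule poly_mapping_eqI)
      fix i show "lookup m i = lookup 0 i"
        using \<open>F \<in> mpoly_over {}\<close> that by (auto simp: mpoly_over_def in_keys_iff[symmetric])
    qed
    then have "F = Const (lookup F 0)"
      by (intro poly_mapping_eqI) (auto simp: Const_def lookup_single when_def in_keys_iff)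
    then show ?thesis by blast
  qed
  then show ?thesis
    by (auto simp: poly_model_def Const_def single_add mult_single mpoly_over_Const[unfolded Const_def])
qed

definition adjoin :: "('b::comm_ring_1 \<Rightarrow> 'x mpoly) \<Rightarrow> 'x \<Rightarrow> 'b poly \<Rightarrow> 'x mpoly" where
  "adjoin h v p = poly (map_poly h p) (Var v)"

lemma adjoin_pCons:
  assumes "h 0 = 0"
  shows "adjoin h v 0 = 0" "adjoin h v (pCons c p) = h c + Var v * adjoin h v p"
  using assms by (simp_all add: adjoin_def map_poly_pCons)

lemma adjoin_add:
  assumes "poly_model h V"
  shows "adjoin h v (p + q) = adjoin h v p + adjoin h v q"
  by (induction p q rule: poly_induct2)
     (simp_all add: adjoin_pCons poly_modelD[OF assms] algebra_simps)

lemma adjoin_smult: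
  assumes "poly_model h V"
  shows "adjoin h v (smult a q) = h a*adjoin h v q"
  by (induction q) (simp_all add: adjoin_pCons poly_modelD[OF assms] algebra_simps)

lemma adjoin_mult:
  assumes "poly_model h V"
  shows "adjoin h v (p*q) = adjoin h v p*adjoin h v q"
  by (induction p)
     (simp_all add: adjoin_pCons poly_modelD[OF assms] adjoin_add[OF assms] adjoin_smult[OF assms]
       algebra_simps)

lemma adjoin_monom:
  assumes "poly_model h V"
  shows "adjoin h v (monom b k) = h b*Var v ^ k"
  by (induction k) (simp_all add: monom_0 monom_Suc adjoin_pCons poly_modelD[OF assms] algebra_simps)

lemma adjoin_over:
  assumes "poly_model h V"
  shows "adjoin h v p \<in> mpoly_over (insert v V)"
proof (induction p)
  case (pCons c p)
  have "h c \<in> mpoly_over (insert v V)"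
    using poly_modelD(5)[OF assms] mpoly_over_mono[of V "insert v V"] by blast
  with pCons show ?case
    by (auto simp: adjoin_pCons poly_modelD[OF assms] intro!: mpoly_over_add mpoly_over_mult mpoly_over_Var)
qed (simp add: adjoin_pCons poly_modelD[OF assms] mpoly_over_def)

lemma peval_adjoin:
  assumes "poly_model h V"
  shows "peval (adjoin h v p) a = poly (map_poly (\<lambda>c. peval (h c) a) p) (a v)"
  by (induction p) (simp_all add: adjoin_pCons poly_modelD[OF assms] map_poly_pCons)

text \<open>Onto: every monomial is a power of \<open>v\<close> times a monomial in
  \<open>V\<close>. Faithful: with the other coordinates fixed, vanishing at all values of
  \<open>v\<close> kills the univariate polynomial coefficient by coefficient.\<close>

lemma poly_model_adjoin:
  assumes model: "poly_model h V" and v: "v \<notin> V"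
  shows "poly_model (adjoin h v) (insert v V)"
proof -
  have single: "single m c \<in> range (adjoin h v)"
    if "keys m \<subseteq> insert v V" for m c
  proof -
    define m' where "m' = Poly_Mapping.update v 0 m"
    have m: "m = m' + single v (lookup m v)"
      unfolding m'_def
      by (rule poly_mapping_eqI) (auto simp: lookup_add lookup_update lookup_single when_def)
    have "keys m' \<subseteq> V"
      using that unfolding m'_def by (auto simp: subset_iff in_keys_iff lookup_update split: if_splits)
    then have "single m' c \<in> mpoly_over V"
      by (auto simp: mpoly_over_def)
    then obtain b where b: "h b = single m' c"
      using poly_modelD(4)[OF model] by (metis rangeE)
    have power: "Var v ^ k = single (single v k) 1" for k
      by (induction k) (simp_all add: Var_def mult_single flip: single_add)
    have "single m c = adjoin h v (monom b (lookup m v))"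
      by (subst m) (simp add: adjoin_monom[OF model] b power mult_single)
    then show ?thesis by blast
  qed
  have "F \<in> range (adjoin h v)" if F: "F \<in> mpoly_over (insert v V)" for F
  proof -
    have sum: "F = (\<Sum>m\<in>keys F. single m (lookup F m))"
      by (rule poly_mapping_eqI)
         (simp add: lookup_sum lookup_single when_def in_keys_iff)
    have "(\<Sum>m\<in>A. single m (lookup F m)) \<in> range (adjoin h v)"
      if "finite A" "A \<subseteq> keys F" for A
      using that
    proof (induction A)
      case empty
      show ?case by (rule range_eqI[of _ _ 0]) (simp add: adjoin_def)
    next
      case (insert m A)
      have "keys m \<subseteq> insert v V"
        using insert.prems F by (auto simp: mpoly_over_def)
      then obtain p where p: "single m (lookup F m) = adjoin h v p"
        using single by blast
      obtain q where q: "(\<Sum>m\<in>A. single m (lookup F m)) = adjoin h v q"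
        using insert by blast
      from p q have "(\<Sum>m\<in>insert m A. single m (lookup F m)) = adjoin h v (p + q)"
        using insert.hyps by (simp add: adjoin_add[OF model])
      then show ?case by blast
    qed
    from this[OF finite_keys order.refl] show ?thesis using sum by simp
  qed
  moreover have "p = 0" if zero: "\<And>a. peval (adjoin h v p) a = 0" for p
  proof (rule poly_eqI)
    fix n
    have "peval (h (coeff p n)) a = 0" for a
    proof -
      have "poly (map_poly (\<lambda>c. peval (h c) a) p) x = 0" for x
      proof -
        \<comment> \<open>As \<open>v\<close> is outside \<open>V\<close>, the coordinate at
          \<open>v\<close> runs through all complex numbers while the values of the coefficients
          stay fixed.\<close>
        have "peval (h c) (a(v := x)) = peval (h c) a" for c
          using v by (intro peval_cong_over[OF poly_modelD(5)[OF model]]) auto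
        with zero[of "a(v := x)"] show ?thesis
          by (simp add: peval_adjoin[OF model])
      qed
      then have "map_poly (\<lambda>c. peval (h c) a) p = 0"
        using poly_all_0_iff_0 by blast
      then have "coeff (map_poly (\<lambda>c. peval (h c) a) p) n = 0"
        by simp
      then show ?thesis
        by (subst (asm) coeff_map_poly) (simp_all add: poly_modelD[OF model])
    qed
    then show "coeff p n = coeff 0 n"
      using poly_modelD(6)[OF model] by simp
  qed
  moreover have "adjoin h v 1 = 1"
    using adjoin_monom[OF model, of v 1 0] by (simp add: poly_modelD[OF model])
  ultimately show ?thesis
    using adjoin_over[OF model] unfolding poly_model_def
    by (auto simp: adjoin_add[OF model] adjoin_mult[OF model])
qed

lemma poly_model_onto:
  assumes "poly_model (h :: 'b::comm_ring_1 \<Rightarrow> 'x mpoly) UNIV"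
  obtains a where "h a = (F :: 'x mpoly)"
  using poly_modelD(4)[OF assms] by (metis UNIV_I mpoly_over_UNIV rangeE)

lemma poly_model_dvd_iff:
  fixes h :: "'b::comm_ring_1 \<Rightarrow> 'x mpoly"
  assumes "poly_model h UNIV"
  shows "h a dvd h b \<longleftrightarrow> a dvd b"
proof
  assume "h a dvd h b"
  then obtain G where G: "h b = h a*G" by blast
  obtain c where c: "h c = G" using poly_model_onto[OF assms] .
  have "h b = h (a*c)" unfolding G c[symmetric] poly_modelD(2)[OF assms] ..
  then have "b = a*c" by (simp only: poly_modelD(10)[OF assms])
  then show "a dvd b" by simp
next
  assume "a dvd b"
  then obtain c where "b = a*c" by blast
  then have "h b = h a*h c" by (simp only: poly_modelD(2)[OF assms])
  then show "h a dvd h b" by simp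
qed

lemma poly_model_irreducible_iff:
  fixes h :: "'b::comm_ring_1 \<Rightarrow> 'x mpoly"
  assumes "poly_model h UNIV"
  shows "irreducible (h p) \<longleftrightarrow> irreducible p"
proof -
  have unit: "h a dvd 1 \<longleftrightarrow> a dvd 1" for a
    using poly_model_dvd_iff[OF assms, of a 1] by (simp only: poly_modelD(3)[OF assms])
  have zero: "h p = 0 \<longleftrightarrow> p = 0"
    using poly_modelD(10)[OF assms, of p 0] by (simp only: poly_modelD(7)[OF assms])
  have "F dvd 1 \<or> G dvd 1" if *: "\<forall>a b. p = a*b \<longrightarrow> a dvd 1 \<or> b dvd 1" "h p = F*G" for F G
  proof -
    obtain a where a: "h a = F" using poly_model_onto[OF assms] .
    obtain b where b: "h b = G" using poly_model_onto[OF assms] .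
    have "h p = h (a*b)" unfolding *(2) a[symmetric] b[symmetric] poly_modelD(2)[OF assms] ..
    then have "p = a*b" by (simp only: poly_modelD(10)[OF assms])
    with *(1) have "a dvd 1 \<or> b dvd 1" by blast
    then show ?thesis unfolding a[symmetric] b[symmetric] unit .
  qed
  moreover have "a dvd 1 \<or> b dvd 1" if *: "\<forall>F G. h p = F*G \<longrightarrow> F dvd 1 \<or> G dvd 1" "p = a*b" for a b
  proof -
    have "h p = h a*h b" unfolding *(2) poly_modelD(2)[OF assms] ..
    with *(1) have "h a dvd 1 \<or> h b dvd 1" by blast
    then show ?thesis unfolding unit .
  qed
  ultimately show ?thesis unfolding irreducible_def unit zero by blast
qed

lemma peval_eq_zeroD:
  fixes h :: "'b::comm_ring_1 \<Rightarrow> 'x mpoly" and F :: "'x mpoly"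
  assumes "poly_model h UNIV" "\<And>a. peval F a = 0"
  shows "F = 0"
proof -
  obtain a where a: "h a = F" using poly_model_onto[OF assms(1)] .
  have "a = 0" using assms(2) by (intro poly_modelD(6)[OF assms(1)]) (simp add: a)
  then show ?thesis using a poly_modelD(7)[OF assms(1)] by simp
qed

text \<open>The sort constraint makes irreducible elements of the model prime; primality is then
  transported along \<open>h\<close>.\<close>

lemma irreducible_dvd_multD:
  fixes h :: "'b::{factorial_ring_gcd, semiring_gcd_mult_normalize} \<Rightarrow> 'x mpoly"
    and F G H :: "'x mpoly"
  assumes h: "poly_model h UNIV" and "irreducible H" "H dvd F*G"
  shows "H dvd F \<or> H dvd G"
proof -
  obtain a where a: "h a = F" using poly_model_onto[OF h] .
  obtain b where b: "h b = G" using poly_model_onto[OF h] .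
  obtain c where c: "h c = H" using poly_model_onto[OF h] .
  have "irreducible c" using assms(2) unfolding c[symmetric] poly_model_irreducible_iff[OF h] .
  then have "prime_elem c" by (rule irreducible_imp_prime_elem)
  moreover have "c dvd a*b"
    using assms(3) unfolding a[symmetric] b[symmetric] c[symmetric]
    by (simp only: poly_model_dvd_iff[OF h] flip: poly_modelD(2)[OF h])
  ultimately have "c dvd a \<or> c dvd b" by (rule prime_elem_dvd_multD)
  then show ?thesis
    unfolding a[symmetric] b[symmetric] c[symmetric] poly_model_dvd_iff[OF h] .
qed

lemma UNIV_rvar: "(UNIV :: rvar set) =
  insert RLambda {RD 4, RD 3, RD 2, RD 1, RT 4, RT 3, RT 2, RT 1}"
proof -
  have "i = RLambda \<or> i \<in> {RD 4, RD 3, RD 2, RD 1, RT 4, RT 3, RT 2, RT 1}" for i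
    using exhaust_4 by (cases i) auto
  then show ?thesis by blast
qed

text \<open>The indeterminate \<open>RLambda\<close> is left for the last adjunction, so that the
  relation becomes a univariate quadratic with coefficients in the other eight.\<close>

definition td_model :: "complex poly poly poly poly poly poly poly poly \<Rightarrow> rvar mpoly" where
  "td_model = adjoin (adjoin (adjoin (adjoin (adjoin (adjoin (adjoin (adjoin Const
     (RT 1)) (RT 2)) (RT 3)) (RT 4)) (RD 1)) (RD 2)) (RD 3)) (RD 4)"

lemma td_model: "poly_model td_model (- {RLambda})"
proof -
  have "poly_model td_model {RD 4, RD 3, RD 2, RD 1, RT 4, RT 3, RT 2, RT 1}"
    unfolding td_model_def by (intro poly_model_adjoin poly_model_Const) auto
  also have "{RD 4, RD 3, RD 2, RD 1, RT 4, RT 3, RT 2, RT 1} = - {RLambda}"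
    using UNIV_rvar by auto
  finally show ?thesis .
qed

lemma td_model_adjoin: "poly_model (adjoin td_model RLambda) UNIV"
proof -
  have "insert RLambda (- {RLambda}) = UNIV" by auto
  with poly_model_adjoin[OF td_model, of RLambda] show ?thesis by simp
qed

section \<open>The polynomial\<close>

text \<open>
  The arguments stand for the sums \<open>x\<^sub>1 = d\<^sub>2 + d\<^sub>3\<close>, \<open>T\<^sub>1 = t\<^sub>2 + t\<^sub>3\<close> and so on. They are natural because
  \<open>Dv(p\<^sub>i) + Dv(p\<^sub>j)\<close> kills \<open>p\<^sub>i - p\<^sub>j\<close>: with respect to the polarized determinant, the three sums
  of Jacobian matrices are isotropic vectors whose mutual products are \<open>- 2 x\<^sub>i\<close>, and whose products with the identity
  matrix are \<open>T\<^sub>i\<close>. If \<open>D, D'\<close> are the discriminants at infinity of two twin fields and \<open>\<pi> = x\<^sub>1 x\<^sub>2 x\<^sub>3\<close>, then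
  \<open>twin_sum = 4 \<pi> (D + D')\<close>, \<open>twin_prod = 64 \<pi> D D'\<close> and \<open>twin_diff\<^sup>2 twin_radicand = (4 \<pi> (D - D'))\<^sup>2\<close>.
\<close>

definition twin_sum_lead :: "'a::comm_ring_1 \<Rightarrow> 'a \<Rightarrow> 'a \<Rightarrow> 'a \<Rightarrow> 'a \<Rightarrow> 'a \<Rightarrow> 'a" where
  "twin_sum_lead T1 T2 T3 x1 x2 x3 =
     x1*x2*(T1-T2)^3*(x1*T1-x2*T2) + x2*x3*(T2-T3)^3*(x2*T2-x3*T3) + x3*x1*(T3-T1)^3*(x3*T3-x1*T1)"

definition twin_sum_rest :: "'a::comm_ring_1 \<Rightarrow> 'a \<Rightarrow> 'a \<Rightarrow> 'a \<Rightarrow> 'a \<Rightarrow> 'a \<Rightarrow> 'a" where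
  "twin_sum_rest T1 T2 T3 x1 x2 x3 =
     T1^3*(T2+T3) + T2^3*(T1+T3) + T3^3*(T1+T2) - 4*(T1^2*T2^2 + T1^2*T3^2 + T2^2*T3^2)
     + 2*T1*T2*T3*(T1+T2+T3) - 36*(x1*T1^2 + x2*T2^2 + x3*T3^2)
     + 36*(T1*T2*(x1+x2-x3) + T1*T3*(x1+x3-x2) + T2*T3*(x2+x3-x1))
     - 54*(x1^2 + x2^2 + x3^2 - 2*(x1*x2 + x1*x3 + x2*x3))"

definition twin_sum :: "'a::comm_ring_1 \<Rightarrow> 'a \<Rightarrow> 'a \<Rightarrow> 'a \<Rightarrow> 'a \<Rightarrow> 'a \<Rightarrow> 'a" where
  "twin_sum T1 T2 T3 x1 x2 x3 =
     twin_sum_lead T1 T2 T3 x1 x2 x3 + x1*x2*x3*twin_sum_rest T1 T2 T3 x1 x2 x3"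

definition twin_diff :: "'a::comm_ring_1 \<Rightarrow> 'a \<Rightarrow> 'a \<Rightarrow> 'a \<Rightarrow> 'a \<Rightarrow> 'a \<Rightarrow> 'a" where
  "twin_diff T1 T2 T3 x1 x2 x3 = x1*x2*(T1-T2)^3 + x2*x3*(T2-T3)^3 + x3*x1*(T3-T1)^3"

text \<open>By Heron's formula this is minus sixteen times the squared area of a triangle with
  squared sides \<open>y1\<close>, \<open>y2\<close>, \<open>y3\<close>.\<close>

definition heron :: "'a::comm_ring_1 \<Rightarrow> 'a \<Rightarrow> 'a \<Rightarrow> 'a" where
  "heron y1 y2 y3 = y1^2 + y2^2 + y3^2 - 2*(y1*y2 + y1*y3 + y2*y3)"

definition twin_radicand :: "'a::comm_ring_1 \<Rightarrow> 'a \<Rightarrow> 'a \<Rightarrow> 'a \<Rightarrow> 'a \<Rightarrow> 'a \<Rightarrow> 'a" where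
  "twin_radicand T1 T2 T3 x1 x2 x3 = heron (x1*T1) (x2*T2) (x3*T3) - 8*(x1*x2*x3)"

text \<open>The quotient is read off by viewing \<open>twin_sum_lead^2 - twin_diff^2*Q\<close> as a
  quadratic form in the three cubes such as \<open>(T1-T2)^3\<close>. The square of this cube has
  the coefficient \<open>x1^2*x2^2*((y1-y2)^2 - Q) = x1^2*x2^2*y3*(2*y1+2*y2-y3)\<close>; the mixed
  products carry \<open>x1*x2*x3\<close> and one further \<open>x\<close> from the start.\<close>

definition twin_prod_lead :: "'a::comm_ring_1 \<Rightarrow> 'a \<Rightarrow> 'a \<Rightarrow> 'a \<Rightarrow> 'a \<Rightarrow> 'a \<Rightarrow> 'a" where
  "twin_prod_lead T1 T2 T3 x1 x2 x3 =
     (let y1 = x1*T1; y2 = x2*T2; y3 = x3*T3; Q = heron y1 y2 y3 in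
     x1*x2*(T1-T2)^6*T3*(2*y1+2*y2-y3) + x2*x3*(T2-T3)^6*T1*(2*y2+2*y3-y1)
     + x3*x1*(T3-T1)^6*T2*(2*y3+2*y1-y2)
     + 2*(x2*(T1-T2)^3*(T2-T3)^3*((y1-y2)*(y2-y3)-Q) + x3*(T2-T3)^3*(T3-T1)^3*((y2-y3)*(y3-y1)-Q)
          + x1*(T3-T1)^3*(T1-T2)^3*((y3-y1)*(y1-y2)-Q)))"

text \<open>Since \<open>twin_sum\<close> is its lead plus \<open>x1*x2*x3\<close> times its rest,
  and the radicand is \<open>heron\<close> minus \<open>8*x1*x2*x3\<close>, all terms of the norm
  beyond the leading difference are visibly divisible. The last three summands are these terms after
  the division.\<close>

definition twin_prod :: "'a::comm_ring_1 \<Rightarrow> 'a \<Rightarrow> 'a \<Rightarrow> 'a \<Rightarrow> 'a \<Rightarrow> 'a \<Rightarrow> 'a" where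
  "twin_prod T1 T2 T3 x1 x2 x3 = twin_prod_lead T1 T2 T3 x1 x2 x3
     + 2*twin_sum_lead T1 T2 T3 x1 x2 x3*twin_sum_rest T1 T2 T3 x1 x2 x3
     + x1*x2*x3*(twin_sum_rest T1 T2 T3 x1 x2 x3)^2 + 8*(twin_diff T1 T2 T3 x1 x2 x3)^2"

lemma twin_prod_lead_eq:
  fixes T1 :: complex
  shows "x1*x2*x3*twin_prod_lead T1 T2 T3 x1 x2 x3 = (twin_sum_lead T1 T2 T3 x1 x2 x3)^2
     - (twin_diff T1 T2 T3 x1 x2 x3)^2*heron (x1*T1) (x2*T2) (x3*T3)"
proof -
  \<comment> \<open>The identity is valid for arbitrary \<open>a\<close>, \<open>b\<close>,
    \<open>c\<close>; hiding the cubes keeps the degrees small.\<close>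
  define a b c where "a = (T1-T2)^3" and "b = (T2-T3)^3" and "c = (T3-T1)^3"
  have 6: "(T1-T2)^6 = a^2" "(T2-T3)^6 = b^2" "(T3-T1)^6 = c^2"
    unfolding a_def b_def c_def by (simp_all flip: power_mult)
  show ?thesis
    unfolding twin_prod_lead_def Let_def twin_sum_lead_def twin_diff_def heron_def 6
      a_def[symmetric] b_def[symmetric] c_def[symmetric]
    by algebra
qed

lemma twin_prod_eq:
  fixes T1 :: complex
  shows "x1*x2*x3*twin_prod T1 T2 T3 x1 x2 x3 = (twin_sum T1 T2 T3 x1 x2 x3)^2
     - (twin_diff T1 T2 T3 x1 x2 x3)^2*twin_radicand T1 T2 T3 x1 x2 x3"
  using twin_prod_lead_eq[of x1 x2 x3 T1 T2 T3]
  unfolding twin_prod_def twin_sum_def twin_radicand_def by algebra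

lemma twin_prod_cyclic:
  fixes T1 :: complex
  shows "twin_prod T1 T2 T3 x1 x2 x3 = twin_prod T2 T3 T1 x2 x3 x1"
proof -
  have "twin_prod_lead T1 T2 T3 x1 x2 x3 = twin_prod_lead T2 T3 T1 x2 x3 x1"
    unfolding twin_prod_lead_def Let_def heron_def by (simp add: ac_simps)
  moreover have "twin_sum_lead T1 T2 T3 x1 x2 x3 = twin_sum_lead T2 T3 T1 x2 x3 x1"
    unfolding twin_sum_lead_def by (simp add: ac_simps)
  moreover have "twin_sum_rest T1 T2 T3 x1 x2 x3 = twin_sum_rest T2 T3 T1 x2 x3 x1"
    unfolding twin_sum_rest_def by algebra
  moreover have "twin_diff T1 T2 T3 x1 x2 x3 = twin_diff T2 T3 T1 x2 x3 x1"
    unfolding twin_diff_def by (simp add: ac_simps)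
  ultimately show ?thesis unfolding twin_prod_def by (simp add: ac_simps)
qed

lemma twin_sum_cyclic:
  fixes T1 :: complex
  shows "twin_sum T1 T2 T3 x1 x2 x3 = twin_sum T2 T3 T1 x2 x3 x1"
  unfolding twin_sum_def twin_sum_lead_def twin_sum_rest_def by algebra

definition relation_value ::
    "'a::comm_ring_1 \<Rightarrow> 'a \<Rightarrow> 'a \<Rightarrow> 'a \<Rightarrow> 'a \<Rightarrow> 'a \<Rightarrow> 'a \<Rightarrow> 'a \<Rightarrow> 'a" where
  "relation_value T1 T2 T3 x1 x2 x3 e L =
     twin_prod T1 T2 T3 x1 x2 x3*L^2 + (- 16*e*twin_sum T1 T2 T3 x1 x2 x3)*L + 64*x1*x2*x3*e^2"

text \<open>Lets a nonzero \<open>x2\<close> or \<open>x3\<close> take the place of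
  \<open>x1\<close> in \<open>relation_value_nonzero_aux\<close>.\<close>

lemma relation_value_cyclic:
  fixes T1 :: complex
  shows "relation_value T1 T2 T3 x1 x2 x3 e L = relation_value T2 T3 T1 x2 x3 x1 e L"
  using twin_prod_cyclic[of T1 T2 T3 x1 x2 x3] twin_sum_cyclic[of T1 T2 T3 x1 x2 x3]
  unfolding relation_value_def by (simp add: ac_simps)

text \<open>For \<open>T2 = T3 = 0\<close> the value is a polynomial of degree 8 in
  \<open>T1\<close>. Its top coefficient \<open>4*x1^3*L^2\<close> comes only from the term with
  \<open>(T3-T1)^3*(T1-T2)^3\<close> in \<open>twin_prod_lead\<close>.\<close>

lemma relation_value_nonzero_aux:
  fixes x1 :: complex
  assumes "x1 \<noteq> 0" "L \<noteq> 0"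
  shows "\<exists>s. relation_value s 0 0 x1 x2 x3 e L \<noteq> 0"
proof (rule ccontr)
  define K where "K = 54*(x1^2 + x2^2 + x3^2 - 2*(x1*x2 + x1*x3 + x2*x3))"
  define p where "p = [:x1*x2*x3*K^2*L^2 + 16*e*x1*x2*x3*K*L + 64*x1*x2*x3*e^2, 0,
     72*x1^2*x2*x3*K*L^2 + 16*e*36*x1^2*x2*x3*L, 0,
     (- 2*x1^2*(x2+x3)*K + 1296*x1^3*x2*x3)*L^2 - 16*e*x1^2*(x2+x3)*L, 0,
     (8*(x1*x2-x3*x1)^2 - 72*x1^3*(x2+x3))*L^2, 0, 4*x1^3*L^2:]"
  have "poly p s = relation_value s 0 0 x1 x2 x3 e L" for s
    unfolding p_def relation_value_def twin_prod_def twin_sum_def twin_prod_lead_def Let_def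
      twin_sum_lead_def twin_sum_rest_def twin_diff_def heron_def K_def
    by (simp add: field_simps power_numeral_reduce)
  moreover assume "\<not> (\<exists>s. relation_value s 0 0 x1 x2 x3 e L \<noteq> 0)"
  ultimately have "p = 0" using poly_all_0_iff_0[of p] by simp
  then have "4*x1^3*L^2 = 0" unfolding p_def by (metis pCons_eq_0_iff)
  with assms show False by simp
qed

lemma relation_value_nonzero:
  fixes x1 :: complex
  assumes "x1 \<noteq> 0 \<or> x2 \<noteq> 0 \<or> x3 \<noteq> 0" "L \<noteq> 0"
  shows "\<exists>T1 T2 T3. relation_value T1 T2 T3 x1 x2 x3 e L \<noteq> 0"
  using assms relation_value_nonzero_aux relation_value_cyclic by metis

definition coeff0 :: "rvar mpoly" where
  "coeff0 = 64*(Var (RD 2) + Var (RD 3))*(Var (RD 1) + Var (RD 3))*(Var (RD 1) + Var (RD 2))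
     * (Var (RD 1)*Var (RD 2) + Var (RD 1)*Var (RD 3) + Var (RD 2)*Var (RD 3))^2"

definition coeff1 :: "rvar mpoly" where
  "coeff1 = - 16*(Var (RD 1)*Var (RD 2) + Var (RD 1)*Var (RD 3) + Var (RD 2)*Var (RD 3))
     * twin_sum (Var (RT 2) + Var (RT 3)) (Var (RT 1) + Var (RT 3)) (Var (RT 1) + Var (RT 2))
         (Var (RD 2) + Var (RD 3)) (Var (RD 1) + Var (RD 3)) (Var (RD 1) + Var (RD 2))"

definition coeff2 :: "rvar mpoly" where
  "coeff2 =
     twin_prod (Var (RT 2) + Var (RT 3)) (Var (RT 1) + Var (RT 3)) (Var (RT 1) + Var (RT 2))
       (Var (RD 2) + Var (RD 3)) (Var (RD 1) + Var (RD 3)) (Var (RD 1) + Var (RD 2))"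

definition hidden_relation :: "rvar mpoly" where
  "hidden_relation = coeff2*Var RLambda ^ 2 + coeff1*Var RLambda + coeff0"

lemma four_neq: "(1::4) \<noteq> 4" "(2::4) \<noteq> 4" "(3::4) \<noteq> 4" "(1::4) \<noteq> 2" "(1::4) \<noteq> 3" "(2::4) \<noteq> 3"
  by simp_all

lemma subring_S_eq: "subring_S = mpoly_over {RT 1, RT 2, RT 3, RD 1, RD 2, RD 3}"
proof -
  have "- {RT 4, RD 4, RLambda} = {RT 1, RT 2, RT 3, RD 1, RD 2, RD 3}"
    using UNIV_rvar four_neq by auto
  then show ?thesis unfolding subring_S_def mpoly_over_def by (auto simp: subset_iff)
qed

lemmas over_intros = mpoly_over_add mpoly_over_diff mpoly_over_uminus mpoly_over_mult mpoly_over_power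
  mpoly_over_one mpoly_over_numeral mpoly_over_Var

lemma coeff_over: "coeff0 \<in> subring_S" "coeff1 \<in> subring_S" "coeff2 \<in> subring_S"
  unfolding coeff0_def coeff1_def coeff2_def subring_S_eq twin_sum_def twin_sum_lead_def
    twin_sum_rest_def twin_prod_def twin_prod_lead_def twin_diff_def heron_def Let_def
  by (intro over_intros; simp)+

lemma peval_twin:
  "peval (twin_sum T1 T2 T3 x1 x2 x3) a =
     twin_sum (peval T1 a) (peval T2 a) (peval T3 a) (peval x1 a) (peval x2 a) (peval x3 a)"
  "peval (twin_prod T1 T2 T3 x1 x2 x3) a =
     twin_prod (peval T1 a) (peval T2 a) (peval T3 a) (peval x1 a) (peval x2 a) (peval x3 a)"
  unfolding twin_sum_def twin_sum_lead_def
    twin_sum_rest_def twin_prod_def twin_prod_lead_def twin_diff_def heron_def Let_def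
  by simp_all

definition elem2 :: "(rvar \<Rightarrow> complex) \<Rightarrow> complex" where
  "elem2 a = a (RD 1)*a (RD 2) + a (RD 1)*a (RD 3) + a (RD 2)*a (RD 3)"

lemma peval_coeff:
  "peval coeff0 a = 64*(a (RD 2) + a (RD 3))*(a (RD 1) + a (RD 3))*(a (RD 1) + a (RD 2))*(elem2 a)^2"
  "peval coeff1 a = - 16*elem2 a *
     twin_sum (a (RT 2) + a (RT 3)) (a (RT 1) + a (RT 3)) (a (RT 1) + a (RT 2))
       (a (RD 2) + a (RD 3)) (a (RD 1) + a (RD 3)) (a (RD 1) + a (RD 2))"
  "peval coeff2 a =
     twin_prod (a (RT 2) + a (RT 3)) (a (RT 1) + a (RT 3)) (a (RT 1) + a (RT 2))
       (a (RD 2) + a (RD 3)) (a (RD 1) + a (RD 3)) (a (RD 1) + a (RD 2))"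
  by (simp_all add: coeff0_def coeff1_def coeff2_def peval_twin elem2_def)

text \<open>Homogeneity is checked on the values; the scalar 2 suffices because its powers are distinct.\<close>

lemma homogeneous_of_scaling:
  fixes F :: "rvar mpoly"
  assumes "\<And>a. peval F (\<lambda>i. 2 ^ wt i*a i) = 2 ^ n*peval F a"
  shows "homogeneous wt n F"
proof -
  let ?c = "\<lambda>m. lookup F m*(2 ^ mdegree wt m - 2 ^ n)"
  define G where "G = (\<Sum>m\<in>keys F. single m (?c m))"
  have mono: "mono_eval m (\<lambda>i. 2 ^ wt i*a i) = 2 ^ mdegree wt m*mono_eval m a" for m a
    by (simp add: mono_eval_def mdegree_def power_mult_distrib prod.distrib power_sum power_mult)
  have F: "peval F a = (\<Sum>m\<in>keys F. lookup F m*mono_eval m a)" for a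
    by (simp add: peval_superset)
  have FS: "peval F (\<lambda>i. 2 ^ wt i*a i) = (\<Sum>m\<in>keys F. lookup F m*(2 ^ mdegree wt m*mono_eval m a))" for a
    by (simp only: F mono)
  have "peval G a = peval F (\<lambda>i. 2 ^ wt i*a i) - 2 ^ n*peval F a" for a
    unfolding FS by (simp add: G_def F sum_distrib_left sum_subtractf algebra_simps)
  then have "G = 0" using assms by (intro peval_eq_zeroD[OF td_model_adjoin]) simp
  have "mdegree wt m = n" if m: "m \<in> keys F" for m
  proof -
    have "lookup G m = ?c m" using m by (simp add: G_def lookup_sum lookup_single when_def)
    with \<open>G = 0\<close> m have "(2::complex) ^ mdegree wt m = 2 ^ n" by (simp add: in_keys_iff)
    then have "norm ((2::complex) ^ mdegree wt m) = norm ((2::complex) ^ n)" by simp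
    then show ?thesis by (simp add: norm_power)
  qed
  then show ?thesis by (simp add: homogeneous_def)
qed

text \<open>The weights fit together: \<open>twin_sum^2\<close> has weight 20 and
  \<open>x1*x2*x3\<close> weight 6, so the quotient has weight 14. As \<open>elem2\<close> has
  weight 4, the products in \<open>coeff1\<close> and \<open>coeff0\<close> have the weights 4+10
  and 6+8.\<close>

lemma twin_scaling:
  fixes s T1 :: complex
  shows "twin_sum_lead (s*T1) (s*T2) (s*T3) (s^2*x1) (s^2*x2) (s^2*x3) = s^10*twin_sum_lead T1 T2 T3 x1 x2 x3"
    "twin_sum_rest (s*T1) (s*T2) (s*T3) (s^2*x1) (s^2*x2) (s^2*x3) = s^4*twin_sum_rest T1 T2 T3 x1 x2 x3"
    "twin_diff (s*T1) (s*T2) (s*T3) (s^2*x1) (s^2*x2) (s^2*x3) = s^7*twin_diff T1 T2 T3 x1 x2 x3"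
    "twin_prod_lead (s*T1) (s*T2) (s*T3) (s^2*x1) (s^2*x2) (s^2*x3) = s^14*twin_prod_lead T1 T2 T3 x1 x2 x3"
    "twin_sum (s*T1) (s*T2) (s*T3) (s^2*x1) (s^2*x2) (s^2*x3) = s^10*twin_sum T1 T2 T3 x1 x2 x3"
    "twin_prod (s*T1) (s*T2) (s*T3) (s^2*x1) (s^2*x2) (s^2*x3) = s^14*twin_prod T1 T2 T3 x1 x2 x3"
proof -
  show 1: "twin_sum_lead (s*T1) (s*T2) (s*T3) (s^2*x1) (s^2*x2) (s^2*x3) = s^10*twin_sum_lead T1 T2 T3 x1 x2 x3"
    unfolding twin_sum_lead_def by algebra
  show 2: "twin_sum_rest (s*T1) (s*T2) (s*T3) (s^2*x1) (s^2*x2) (s^2*x3) = s^4*twin_sum_rest T1 T2 T3 x1 x2 x3"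
    unfolding twin_sum_rest_def by algebra
  show 3: "twin_diff (s*T1) (s*T2) (s*T3) (s^2*x1) (s^2*x2) (s^2*x3) = s^7*twin_diff T1 T2 T3 x1 x2 x3"
    unfolding twin_diff_def by algebra
  show 4: "twin_prod_lead (s*T1) (s*T2) (s*T3) (s^2*x1) (s^2*x2) (s^2*x3) = s^14*twin_prod_lead T1 T2 T3 x1 x2 x3"
    unfolding twin_prod_lead_def Let_def heron_def by algebra
  show "twin_sum (s*T1) (s*T2) (s*T3) (s^2*x1) (s^2*x2) (s^2*x3) = s^10*twin_sum T1 T2 T3 x1 x2 x3"
    unfolding twin_sum_def 1 2 by algebra
  show "twin_prod (s*T1) (s*T2) (s*T3) (s^2*x1) (s^2*x2) (s^2*x3) = s^14*twin_prod T1 T2 T3 x1 x2 x3"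
    unfolding twin_prod_def 1 2 3 4 by algebra
qed

lemma homogeneous_coeff:
  "homogeneous grade 14 coeff0" "homogeneous grade 14 coeff1" "homogeneous grade 14 coeff2"
proof -
  have sums: "2 ^ grade (RT i)*x + 2 ^ grade (RT j)*y = 2*(x + y)"
    "2 ^ grade (RD i)*x + 2 ^ grade (RD j)*y = 2^2*(x + y)" for i j and x y :: complex
    by simp_all
  have e: "elem2 (\<lambda>i. 2 ^ grade i*a i) = 2^4*elem2 a" for a by (simp add: elem2_def)
  show "homogeneous grade 14 coeff0" "homogeneous grade 14 coeff1" "homogeneous grade 14 coeff2"
    by (rule homogeneous_of_scaling, unfold peval_coeff e sums twin_scaling, (rule refl | algebra))+
qed

lemma spectral_form_hidden_relation: "spectral_form hidden_relation"
  unfolding spectral_form_def hidden_relation_def using coeff_over homogeneous_coeff by blast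

lemma peval_hidden_relation:
  "peval hidden_relation a = 
     relation_value (a (RT 2) + a (RT 3)) (a (RT 1) + a (RT 3)) (a (RT 1) + a (RT 2))
       (a (RD 2) + a (RD 3)) (a (RD 1) + a (RD 3)) (a (RD 1) + a (RD 2)) (elem2 a) (a RLambda)"
  by (simp add: hidden_relation_def relation_value_def peval_coeff)

section \<open>Irreducibility\<close>

lemma poly_no_root_const:
  fixes p :: "complex poly"
  assumes "\<And>s. poly p s \<noteq> 0"
  shows "poly p s = poly p t"
  using fundamental_theorem_of_algebra[of p] assms unfolding constant_def by blast

lemma poly_eq_off_point:
  fixes p :: "complex poly"
  assumes "\<And>s. s \<noteq> s0 \<Longrightarrow> poly p s = k"
  shows "poly p s = k"
proof -
  have "p - [:k:] = 0"
  proof (rule ccontr)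
    assume "p - [:k:] \<noteq> 0"
    then have "finite {s. poly (p - [:k:]) s = 0}" by (rule poly_roots_finite)
    moreover have "- {s0} \<subseteq> {s. poly (p - [:k:]) s = 0}" using assms by auto
    ultimately have "finite (- {s0})" using finite_subset by blast
    then show False using infinite_UNIV_char_0[where 'a = complex] by (simp add: finite_compl)
  qed
  then show ?thesis by (metis eq_iff_diff_eq_0 poly_0 poly_diff poly_const_conv right_minus_eq)
qed

definition line_poly :: "'x mpoly \<Rightarrow> ('x \<Rightarrow> complex) \<Rightarrow> ('x \<Rightarrow> complex) \<Rightarrow> complex poly" where
  "line_poly F a b = (SOME p. \<forall>s. poly p s = peval F (\<lambda>i. a i + s*b i))"

lemma poly_line_poly: "poly (line_poly F a b) s = peval F (\<lambda>i. a i + s*b i)"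
proof -
  have "\<exists>p. \<forall>s. poly p s = peval F (\<lambda>i. a i + s*b i)" using peval_line_poly[of F] by blast
  then show ?thesis unfolding line_poly_def by (rule someI2_ex) blast
qed

text \<open>The restriction to the complex line through \<open>a\<close> and \<open>b\<close> has no
  root, hence is constant. In this way divisors are controlled through their zeros alone.\<close>

lemma peval_const_on_line:
  assumes "\<And>s. peval F (\<lambda>i. a i + s*(b i - a i)) \<noteq> 0"
  shows "peval F a = peval F b"
proof -
  obtain p where p: "\<And>s. poly p s = peval F (\<lambda>i. a i + s*(b i - a i))"
    by (rule that[OF poly_line_poly])
  have "poly p 0 = poly p 1"
    using assms by (intro poly_no_root_const) (simp add: p)
  then show ?thesis by (simp add: p)
qed

text \<open>
  A common divisor of the coefficients is constant in the directions of the \<open>t\<^sub>k\<close>, because the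
  constant coefficient depends on the \<open>d\<^sub>k\<close> only. So it could only vanish at
  \<open>d\<^sub>1 = d\<^sub>2 = d\<^sub>3 = 0\<close>, and this set has codimension three.
\<close>

lemma content_constant:
  assumes "F dvd coeff0" "F dvd coeff2"
  shows "\<exists>k. F = Const k"
proof -
  define dR :: "rvar set" where "dR = {RD 1, RD 2, RD 3}"
  obtain G0 G2 where G: "coeff0 = F*G0" "coeff2 = F*G2" using assms by blast
  have F0: "peval coeff0 a = 0" "peval coeff2 a = 0" if "peval F a = 0" for a
    using that unfolding G by simp_all
  have c0: "peval coeff0 a = peval coeff0 b" if "\<And>i. i \<in> dR \<Longrightarrow> a i = b i" for a b
    using that by (simp add: peval_coeff elem2_def dR_def)
  have eq_generic: "peval F a = peval F b"
    if "\<And>i. i \<in> dR \<Longrightarrow> a i = b i" "peval coeff0 a \<noteq> 0" for a b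
  proof (rule peval_const_on_line)
    fix s
    have "peval coeff0 (\<lambda>i. a i + s*(b i - a i)) = peval coeff0 a"
      using that by (intro c0) auto
    then show "peval F (\<lambda>i. a i + s*(b i - a i)) \<noteq> 0" using F0 that by metis
  qed
  have eq: "peval F a = peval F b" if ab: "\<And>i. i \<in> dR \<Longrightarrow> a i = b i" for a b
  proof -
    \<comment> \<open>Both points are moved along the same direction until \<open>d1\<close>,
      \<open>d2\<close>, \<open>d3\<close> are all 1, where \<open>coeff0\<close> is nonzero. So the
      generic case applies for all but finitely many \<open>s\<close>, and the two restrictions
      agree.\<close>
    define v where "v i = (if i \<in> dR then 1 - a i else 0)" for i
    obtain p where p: "\<And>s. poly p s = peval F (\<lambda>i. a i + s * v i)" by (rule that[OF poly_line_poly])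
    obtain q where q: "\<And>s. poly q s = peval F (\<lambda>i. b i + s * v i)" by (rule that[OF poly_line_poly])
    obtain r where r: "\<And>s. poly r s = peval coeff0 (\<lambda>i. a i + s * v i)" by (rule that[OF poly_line_poly])
    have "poly (r*(p - q)) s = 0" for s
      using eq_generic[of "\<lambda>i. a i + s * v i" "\<lambda>i. b i + s * v i"] ab by (auto simp: p q r)
    then have "r*(p - q) = 0" using poly_all_0_iff_0 by blast
    moreover have "poly r 1 \<noteq> 0" by (simp add: r peval_coeff elem2_def v_def dR_def)
    ultimately have "p = q" by auto
    with p[of 0] q[of 0] show ?thesis by simp
  qed
  \<comment> \<open>A zero of \<open>F\<close> with some nonzero \<open>d\<close> would propagate to
    all \<open>t\<close> with the same \<open>d\<close>, and \<open>coeff2\<close> would vanish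
    there identically in \<open>t\<close>.\<close>
  have nonzero: "peval F a \<noteq> 0" if "i \<in> dR" "a i \<noteq> 0" for a i
  proof
    assume "peval F a = 0"
    let ?x1 = "a (RD 2) + a (RD 3)" and ?x2 = "a (RD 1) + a (RD 3)" and ?x3 = "a (RD 1) + a (RD 2)"
    have "?x1 \<noteq> 0 \<or> ?x2 \<noteq> 0 \<or> ?x3 \<noteq> 0"
    proof (rule ccontr)
      assume "\<not> ?thesis"
      then have "2*a (RD 1) = 0" "2*a (RD 2) = 0" "2*a (RD 3) = 0" by algebra+
      with that show False by (auto simp: dR_def)
    qed
    \<comment> \<open>For \<open>e = 0\<close> and \<open>L = 1\<close> only
      \<open>twin_prod\<close> is left, that is, the value of \<open>coeff2\<close>.\<close>
    then obtain T1 T2 T3 where T: "relation_value T1 T2 T3 ?x1 ?x2 ?x3 0 1 \<noteq> 0"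
      using relation_value_nonzero[of ?x1 ?x2 ?x3 1 0] by auto
    define b where "b = a(RT 1 := (T2+T3-T1)/2, RT 2 := (T1+T3-T2)/2, RT 3 := (T1+T2-T3)/2)"
    have b: "b (RT 2) + b (RT 3) = T1" "b (RT 1) + b (RT 3) = T2" "b (RT 1) + b (RT 2) = T3"
      "b (RD i) = a (RD i)" for i
      by (simp_all add: b_def field_simps)
    have "peval F b = 0" using \<open>peval F a = 0\<close> eq[of a b] b(4) by (fastforce simp: dR_def)
    then have "peval coeff2 b = 0" by (rule F0)
    with T show False by (simp add: peval_coeff b relation_value_def)
  qed
  define e :: "rvar \<Rightarrow> complex" where "e i = (if i = RD 1 then 1 else 0)" for i
  have e: "peval F a = peval F e" if "a (RD 2) \<noteq> 0" for a
  proof (rule peval_const_on_line)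
    fix s
    let ?l = "\<lambda>i. a i + s*(e i - a i)"
    \<comment> \<open>On this line the second determinant is \<open>(1 - s)*a (RD 2)\<close>; it
      vanishes only at \<open>s = 1\<close>, where the first one is 1. So the line misses the locus
      on which all three vanish.\<close>
    have "?l (RD 1) = 1 \<or> ?l (RD 2) \<noteq> 0" using that by (auto simp: e_def algebra_simps)
    then show "peval F ?l \<noteq> 0"
      using nonzero[of "RD 1" ?l] nonzero[of "RD 2" ?l] by (auto simp: dR_def)
  qed
  have "peval F a = peval F e" for a
  proof -
    \<comment> \<open>Points with \<open>a (RD 2) = 0\<close> are reached by varying this single
      coordinate: the restriction is constant off one point.\<close>
    obtain p where p: "\<And>s. poly p s = peval F (\<lambda>i. a i + s*(if i = RD 2 then 1 else 0))"
      by (rule that[OF poly_line_poly])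
    have "poly p s = peval F e" if "s \<noteq> - a (RD 2)" for s
      unfolding p using that by (intro e) (simp add: eq_neg_iff_add_eq_0 add.commute)
    then have "poly p 0 = peval F e" by (rule poly_eq_off_point)
    then show ?thesis by (simp add: p)
  qed
  then have "F - Const (peval F e) = 0"
    by (intro peval_eq_zeroD[OF td_model_adjoin]) simp
  then show ?thesis by auto
qed

text \<open>
  The discriminant is a square times the radicand, which has a simple zero on a suitable line.
\<close>

lemma discriminant_not_square:
  assumes "\<And>a. (peval G a)^2 = (peval coeff1 a)^2 - 4*peval coeff0 a*peval coeff2 a"
  shows False
proof -
  \<comment> \<open>On this line the arguments are \<open>T1 = 4 + s\<close>,
    \<open>T2 = T3 = 0\<close>, \<open>x1 = x2 = 1\<close>, \<open>x3 = 2\<close> and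
    \<open>elem2\<close> is 1. The radicand becomes \<open>(4 + s)^2 - 16 = s*(s + 8)\<close>, and
    \<open>twin_diff\<close> is \<open>- (4 + s)^3\<close>, which does not vanish at the simple root
    \<open>s = 0\<close>.\<close>
  define a b :: "rvar \<Rightarrow> complex" where
    "a i = (case i of RT k \<Rightarrow> (if k = 1 then -2 else 2) | RD k \<Rightarrow> (if k = 1 \<or> k = 2 then 1 else 0) | RLambda \<Rightarrow> 0)" and
    "b i = (case i of RT k \<Rightarrow> (if k = 1 then -1/2 else 1/2) | RD k \<Rightarrow> 0 | RLambda \<Rightarrow> 0)" for i
  obtain p where p: "\<And>s. poly p s = peval G (\<lambda>i. a i + s*b i)" by (rule that[OF poly_line_poly])
  define q :: "complex poly" where "q = [:4, 1:]^6 * [:8, 1:]"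
  have "poly (p^2) s = poly (smult 256 q * [:0, 1:]) s" for s
  proof -
    define c where "c = (\<lambda>i. a i + s*b i)"
    have c: "c (RD 1) = 1" "c (RD 2) = 1" "c (RD 3) = 0"
      and t: "c (RT 2) + c (RT 3) = 4 + s" "c (RT 1) + c (RT 3) = 0" "c (RT 1) + c (RT 2) = 0"
      by (simp_all add: c_def a_def b_def)
    have e: "elem2 c = 1" by (simp add: elem2_def c)
    have "(poly p s)^2 = 256*((twin_sum (4+s) 0 0 1 1 2)^2 - 1*1*2*twin_prod (4+s) 0 0 1 1 2)"
      unfolding p c_def[symmetric] assms peval_coeff e t c by (simp add: power2_eq_square algebra_simps)
    also have "\<dots> = 256*((twin_diff (4+s) 0 0 1 1 2)^2*twin_radicand (4+s) 0 0 1 1 2)"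
      unfolding twin_prod_eq by simp
    also have "\<dots> = 256*((4+s)^6*(s*(8+s)))"
      unfolding twin_diff_def twin_radicand_def heron_def by (simp add: power2_eq_square power_numeral_reduce algebra_simps)
    finally show ?thesis by (simp add: q_def algebra_simps)
  qed
  then have "poly (p^2) = poly (smult 256 q * [:0, 1:])" by (rule ext)
  then have eq: "p^2 = smult 256 q * [:0, 1:]" by (simp only: poly_eq_poly_eq_iff)
  have "poly (p^2) 0 = 0" unfolding eq by simp
  then have "[:0, 1:] dvd p" by (simp add: poly_eq_0_iff_dvd[of p 0, simplified])
  then obtain r where r: "p = [:0, 1:] * r" by blast
  have "[:0, 1:] * ([:0, 1:] * r^2) = [:0, 1:] * smult 256 q"
    using eq unfolding r by (simp add: power2_eq_square mult_ac)
  then have "[:0, 1:] * r^2 = smult 256 q" by (simp only: mult_cancel_left) simp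
  then have "poly ([:0, 1:] * r^2) 0 = poly (smult 256 q) 0" by simp
  then show False by (simp add: q_def)
qed

lemma coeff0_nonzero: "coeff0 \<noteq> 0"
proof
  assume "coeff0 = 0"
  then have "peval coeff0 (\<lambda>_. 1) = 0" by simp
  then show False by (simp add: peval_coeff elem2_def)
qed

lemma coeff2_nonzero: "coeff2 \<noteq> 0"
proof
  assume zero: "coeff2 = 0"
  obtain T1 T2 T3 where T: "relation_value T1 T2 T3 2 2 2 0 (1::complex) \<noteq> 0"
    using relation_value_nonzero[of 2 2 2 1 0] by auto
  define b :: "rvar \<Rightarrow> complex" where
    "b = (\<lambda>_. 1)(RT 1 := (T2+T3-T1)/2, RT 2 := (T1+T3-T2)/2, RT 3 := (T1+T2-T3)/2)"
  have b: "b (RT 2) + b (RT 3) = T1" "b (RT 1) + b (RT 3) = T2" "b (RT 1) + b (RT 2) = T3"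
    "b (RD i) = 1" for i
    by (simp_all add: b_def field_simps)
  have "peval coeff2 b = 0" using zero by simp
  with T show False by (simp add: peval_coeff b relation_value_def)
qed

lemma Const_unit: "k \<noteq> 0 \<Longrightarrow> Const k dvd 1"
  by (rule dvdI[of _ _ "Const (1/k)"]) (simp add: Const_def mult_single)

lemma irreducible_hidden_relation: "irreducible hidden_relation"
proof -
  note model = td_model and model' = td_model_adjoin
  have sub: "subring_S \<subseteq> range td_model"
    unfolding poly_modelD(4)[OF model] subring_S_eq by (rule mpoly_over_mono) auto
  obtain b0 where b0: "td_model b0 = coeff0" using coeff_over sub by (metis rangeE subsetD)
  obtain b1 where b1: "td_model b1 = coeff1" using coeff_over sub by (metis rangeE subsetD)
  obtain b2 where b2: "td_model b2 = coeff2" using coeff_over sub by (metis rangeE subsetD)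
  define P where "P = [:b0, b1, b2:]"
  have H: "hidden_relation = adjoin td_model RLambda P"
    by (simp add: P_def hidden_relation_def adjoin_pCons poly_modelD[OF model] b0 b1 b2
        power2_eq_square algebra_simps)
  have b2_nz: "b2 \<noteq> 0" using coeff2_nonzero b2 poly_modelD(7)[OF model] by metis
  have degP: "degree P = 2" and P_nz: "P \<noteq> 0" using b2_nz by (simp_all add: P_def)
  have dvd: "td_model a dvd td_model b" if "a dvd b" for a b
    using that by (auto simp: poly_modelD[OF model])
  have unit: "p dvd 1" if pq: "P = p*q" and deg: "degree p = 0" for p q
  proof -
    obtain c where c: "p = [:c:]" using deg by (metis degree_eq_zeroE)
    have "[:c:] dvd P" unfolding pq c by (rule dvd_triv_left)
    then have "c dvd b0" "c dvd b2"
      unfolding const_poly_dvd_iff P_def by (metis coeff_pCons_0, metis coeff_pCons_0 coeff_pCons_Suc)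
    then obtain k where k: "td_model c = Const k"
      using content_constant[of "td_model c"] dvd[of c b0] dvd[of c b2] b0 b2 by metis
    have "c \<noteq> 0" using pq c P_nz by auto
    then have "k \<noteq> 0" using k poly_modelD(6)[OF model, of c] by auto
    have "adjoin td_model RLambda p = Const k"
      by (simp add: c adjoin_pCons poly_modelD[OF model] k)
    then have "adjoin td_model RLambda p dvd adjoin td_model RLambda 1"
      using Const_unit[OF \<open>k \<noteq> 0\<close>] by (simp add: poly_modelD(3)[OF model'])
    then show ?thesis unfolding poly_model_dvd_iff[OF model'] .
  qed
  have "irreducible P"
  proof (rule irreducibleI)
    show "\<not> P dvd 1"
    proof
      assume "P dvd 1"
      then have "degree P = 0" using dvd_imp_degree_le[of P 1] by simp
      with degP show False by simp
    qed
    fix p q assume pq: "P = p*q"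
    then have "degree p + degree q = 2"
      using P_nz degP by (metis degree_mult_eq mult_zero_left mult_zero_right)
    then consider "degree p = 0" | "degree q = 0" | "degree p = 1" "degree q = 1" by linarith
    then show "p dvd 1 \<or> q dvd 1"
    proof cases
      case 1
      with unit[OF pq] show ?thesis by blast
    next
      case 2
      with unit[of q p] pq show ?thesis by (simp add: mult.commute)
    next
      case 3
      then obtain p0 p1 q0 q1 where p: "p = [:p0, p1:]" and q: "q = [:q0, q1:]"
        by (metis degree1_coeffs)
      have "b0 = p0*q0" "b1 = p0*q1 + p1*q0" "b2 = p1*q1"
        using pq unfolding P_def p q by (simp_all add: add.commute)
      \<comment> \<open>The discriminant of a product of two linear factors is the square of
        \<open>p0*q1 - p1*q0\<close>.\<close>
      then have "(peval (td_model (p0*q1 - p1*q0)) a)^2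
          = (peval coeff1 a)^2 - 4*peval coeff0 a*peval coeff2 a" for a
        by (simp add: poly_modelD[OF model] power2_eq_square algebra_simps flip: b0 b1 b2)
      then show ?thesis using discriminant_not_square by blast
    qed
  qed (use P_nz in auto)
  then show ?thesis unfolding H poly_model_irreducible_iff[OF model'] .
qed

section \<open>Quadratic vector fields\<close>

definition expo :: "nat \<Rightarrow> nat \<Rightarrow> 2 \<Rightarrow>\<^sub>0 nat" where
  "expo i j = single 1 i + single 2 j"

lemma two_neq: "(1::2) \<noteq> 2" "(2::2) \<noteq> 1"
  by simp_all

lemma lookup_expo [simp]:
  "lookup (expo i j) 1 = i" "lookup (expo i j) 2 = j"
  using two_neq by (simp_all add: expo_def lookup_add lookup_single when_def)

lemma expo_eq_iff [simp]: "expo i j = expo k l \<longleftrightarrow> i = k \<and> j = l"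
  by (metis lookup_expo)

lemma expo_lookup: "m = expo (lookup m 1) (lookup m 2)"
proof (rule poly_mapping_eqI)
  fix i :: 2
  show "lookup m i = lookup (expo (lookup m 1) (lookup m 2)) i"
    using exhaust_2[of i] by auto
qed

lemma mono_eval_expo [simp]: "mono_eval (expo i j) a = a 1 ^ i*a 2 ^ j"
  by (simp add: expo_def mono_eval_add)

lemma mdegree_expo: "mdegree (\<lambda>_. 1) (expo i j) = i + j"
proof -
  have "mdegree (\<lambda>_. 1) (expo i j) = (\<Sum>k\<in>UNIV. lookup (expo i j) k)"
    unfolding mdegree_def by (simp, intro sum.mono_neutral_left) (auto simp: in_keys_iff)
  then show ?thesis by (simp add: UNIV_2)
qed

lemma total_degree_le_2_keys:
  assumes "total_degree_le 2 F"
  shows "keys F \<subseteq> {expo 0 0, expo 1 0, expo 0 1, expo 2 0, expo 1 1, expo 0 2}"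
proof
  fix m assume "m \<in> keys F"
  with assms have "mdegree (\<lambda>_. 1) m \<le> 2" by (auto simp: total_degree_le_def)
  moreover obtain i j where m: "m = expo i j" using expo_lookup by metis
  ultimately have "i + j \<le> 2" by (simp only: mdegree_expo)
  then have "(i, j) \<in> {(0,0),(1,0),(0,1),(2,0),(1,1),(0,2)}" by auto
  then show "m \<in> {expo 0 0, expo 1 0, expo 0 1, expo 2 0, expo 1 1, expo 0 2}" unfolding m by auto
qed

lemma peval_total_degree_le_2:
  assumes "total_degree_le 2 F"
  defines "c \<equiv> \<lambda>i j. lookup F (expo i j)"
  shows "peval F a = c 0 0 + c 1 0*a 1 + c 0 1*a 2 + c 2 0*(a 1)^2 + c 1 1*a 1*a 2 + c 0 2*(a 2)^2"
    "peval (hom_part 2 F) a = c 2 0*(a 1)^2 + c 1 1*a 1*a 2 + c 0 2*(a 2)^2"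
proof -
  show "peval F a = c 0 0 + c 1 0*a 1 + c 0 1*a 2 + c 2 0*(a 1)^2 + c 1 1*a 1*a 2 + c 0 2*(a 2)^2"
    by (subst peval_superset[OF _ total_degree_le_2_keys[OF assms(1)]])
       (simp_all add: c_def)
  let ?A = "{m \<in> keys F. mdegree (\<lambda>_. 1) m = 2}"
  have "?A \<subseteq> {expo 2 0, expo 1 1, expo 0 2}"
    using total_degree_le_2_keys[OF assms(1)] by (auto simp: mdegree_expo simp del: One_nat_def)
  then have "(\<Sum>m\<in>?A. lookup F m*mono_eval m a) =
      (\<Sum>m\<in>{expo 2 0, expo 1 1, expo 0 2}. lookup F m*mono_eval m a)"
    by (intro sum.mono_neutral_left) (auto simp: mdegree_expo mdegree_expo[unfolded One_nat_def] in_keys_iff)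
  then show "peval (hom_part 2 F) a = c 2 0*(a 1)^2 + c 1 1*a 1*a 2 + c 0 2*(a 2)^2"
    by (simp add: hom_part_def c_def)
qed

definition quad_part :: "vfield \<Rightarrow> complex ^ 2 \<Rightarrow> complex ^ 2" where
  "quad_part v z = (\<chi> i. peval (hom_part 2 (v$i)) (($) z))"

lemma infinity_form_quad_part:
  "infinity_form v u = u$2*quad_part v u$1 - u$1*quad_part v u$2"
  by (simp add: infinity_form_def quad_part_def)

definition has_coeffs :: "vfield \<Rightarrow> complex ^ 2 \<Rightarrow> complex ^ 2 \<Rightarrow> complex ^ 2 \<Rightarrow> complex ^ 2 \<Rightarrow> complex ^ 2 \<Rightarrow> complex ^ 2 \<Rightarrow> bool"
  where "has_coeffs v k0 k1 k2 p q r \<longleftrightarrow> (\<forall>z i.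
     vf_at v z$i = k0$i + z$1*k1$i + z$2*k2$i
       + (z$1)^2*p$i + z$1*z$2*q$i + (z$2)^2*r$i \<and>
     quad_part v z$i = (z$1)^2*p$i + z$1*z$2*q$i + (z$2)^2*r$i \<and>
     jacobian v z$i$1 = k1$i + 2*z$1*p$i + z$2*q$i \<and>
     jacobian v z$i$2 = k2$i + z$1*q$i + 2*z$2*r$i)"

lemma has_coeffsD:
  assumes "has_coeffs v k0 k1 k2 p q r"
  shows "vf_at v z$i = k0$i + z$1*k1$i + z$2*k2$i
       + (z$1)^2*p$i + z$1*z$2*q$i + (z$2)^2*r$i"
    "quad_part v z$i = (z$1)^2*p$i + z$1*z$2*q$i + (z$2)^2*r$i"
    "jacobian v z$i$1 = k1$i + 2*z$1*p$i + z$2*q$i"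
    "jacobian v z$i$2 = k2$i + z$1*q$i + 2*z$2*r$i"
  using assms unfolding has_coeffs_def by blast+

lemma quadratic_coeffs:
  assumes "quadratic v"
  obtains k0 k1 k2 p q r where "has_coeffs v k0 k1 k2 p q r"
proof -
  define c :: "nat \<Rightarrow> nat \<Rightarrow> complex ^ 2" where
    "c m n = (\<chi> i. lookup (v$i) (expo m n))" for m n
  have deg: "total_degree_le 2 (v$i)" for i using assms by (simp add: quadratic_def)
  note ev = peval_total_degree_le_2[OF deg]
  have 1: "vf_at v z$i = c 0 0$i + z$1*c 1 0$i + z$2*c 0 1$i
        + (z$1)^2*c 2 0$i + z$1*z$2*c 1 1$i + (z$2)^2*c 0 2$i" for z i
    by (simp add: vf_at_def ev c_def)
  have 2: "quad_part v z$i = (z$1)^2*c 2 0$i + z$1*z$2*c 1 1$i + (z$2)^2*c 0 2$i" for z i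
    by (simp add: quad_part_def ev c_def)
  have 3: "jacobian v z$i$1 = c 1 0$i + 2*z$1*c 2 0$i + z$2*c 1 1$i" for z i
    unfolding jacobian_def by (simp add: ev c_def two_neq, rule DERIV_imp_deriv)
      (auto intro!: derivative_eq_intros)
  have 4: "jacobian v z$i$2 = c 0 1$i + z$1*c 1 1$i + 2*z$2*c 0 2$i" for z i
    unfolding jacobian_def by (simp add: ev c_def two_neq, rule DERIV_imp_deriv)
      (auto intro!: derivative_eq_intros)
  show ?thesis
    by (rule that[of "c 0 0" "c 1 0" "c 0 1" "c 2 0" "c 1 1" "c 0 2"])
       (unfold has_coeffs_def, intro allI conjI; rule 1 2 3 4)
qed

text \<open>A second difference at any base point isolates the quadratic part. So a change of
  coordinates can be followed on the values of the field instead of its coefficients.\<close>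

lemma quad_part_second_difference:
  assumes "quadratic v"
  shows "2*quad_part v h$i = vf_at v (p + h)$i + vf_at v (p - h)$i - 2 * vf_at v p$i"
proof -
  obtain k0 k1 k2 p' q r where "has_coeffs v k0 k1 k2 p' q r" by (rule quadratic_coeffs[OF assms])
  note k = has_coeffsD(1,2)[OF this]
  show ?thesis unfolding k by (simp add: power2_eq_square algebra_simps)
qed

lemma quad_part_eq:
  assumes "quadratic v"
  shows "2*quad_part v z$i = vf_at v z$i + vf_at v (- z)$i - 2 * vf_at v 0$i"
  using quad_part_second_difference[OF assms, of z i 0] by simp

lemma affine_change_quad_part:
  assumes v: "quadratic v" and v': "quadratic v'"
    and eq: "\<And>z. vf_at v (p + B *v z) = B *v vf_at v' z"
  shows "quad_part v (B *v z) = B *v quad_part v' z"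
proof -
  have neg: "p - B *v z = p + B *v (- z)"
    by (simp add: vec_eq_iff matrix_vector_mult_def sum_2)
  have zero: "vf_at v p = B *v vf_at v' 0"
    using eq[of 0] by simp
  have "2*quad_part v (B *v z)$i = 2*(B *v quad_part v' z)$i" for i
  proof -
    have "2*quad_part v (B *v z)$i
        = (B *v vf_at v' z)$i + (B *v vf_at v' (- z))$i - 2*(B *v vf_at v' 0)$i"
      unfolding quad_part_second_difference[OF v, of _ _ p] neg eq zero ..
    also have "\<dots> = B$i$1*(2*quad_part v' z$1) + B$i$2*(2*quad_part v' z$2)"
      unfolding quad_part_eq[OF v']
      by (simp add: matrix_vector_mult_def sum_2 algebra_simps)
    finally show ?thesis by (simp add: matrix_vector_mult_def sum_2 algebra_simps)
  qed
  then show ?thesis by (simp add: vec_eq_iff)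
qed

lemma quad_part_linear_change:
  assumes "linear_change A v v'" "quadratic v"
  shows "quad_part v' (A *v z) = A *v quad_part v z"
  using assms by (intro affine_change_quad_part[where p = 0]) (auto simp: linear_change_def)

section \<open>Characteristic numbers\<close>

definition wedge :: "complex ^ 2 \<Rightarrow> complex ^ 2 \<Rightarrow> complex" where
  "wedge u z = u$1*z$2 - u$2*z$1"

text \<open>
  The \<open>u\<^sub>j\<close> are the directions of the singular points at infinity. This description of
  the characteristic numbers does not refer to a chart.
\<close>

definition infinity_rep :: "vfield \<Rightarrow> complex ^ 3 \<Rightarrow> complex \<Rightarrow> complex ^ 2 ^ 3 \<Rightarrow> bool" where
  "infinity_rep v l c u \<longleftrightarrow> c \<noteq> 0 \<and> wedge (u$1) (u$2) \<noteq> 0 \<and> wedge (u$1) (u$3) \<noteq> 0 \<and> wedge (u$2) (u$3) \<noteq> 0 \<and>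
     l$1 + l$2 + l$3 = 1 \<and>
     (\<forall>z i. quad_part v z$i = c*(l$1*wedge (u$2) z*wedge (u$3) z*u$1$i
        + l$2*wedge (u$1) z*wedge (u$3) z*u$2$i
        + l$3*wedge (u$1) z*wedge (u$2) z*u$3$i))"

text \<open>As \<open>z$2*u$1 - z$1*u$2\<close> is \<open>wedge u z\<close>, every summand of the
  representation contributes \<open>l$j\<close> times the same product, and the \<open>l$j\<close>
  add up to 1.\<close>

lemma infinity_rep_form:
  assumes "infinity_rep v l c u"
  shows "infinity_form v z = c*wedge (u$1) z*wedge (u$2) z*wedge (u$3) z"
proof -
  have l: "l$1 = 1 - l$2 - l$3" using assms by (auto simp: infinity_rep_def algebra_simps)
  have "infinity_form v z = c*(l$1 + l$2 + l$3)*wedge (u$1) z*wedge (u$2) z*wedge (u$3) z"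
  proof -
    have q: "quad_part v z$i = c*(l$1*wedge (u$2) z*wedge (u$3) z*u$1$i
        + l$2*wedge (u$1) z*wedge (u$3) z*u$2$i
        + l$3*wedge (u$1) z*wedge (u$2) z*u$3$i)" for i
      using assms unfolding infinity_rep_def by blast
    show ?thesis unfolding infinity_form_quad_part q unfolding wedge_def by algebra
  qed
  then show ?thesis by (simp add: l)
qed

lemma wedge_zero_span:
  assumes "wedge u z = 0" "u \<noteq> 0" "z \<noteq> 0"
  shows "vec.span {z} = vec.span {u}"
proof -
  have "\<exists>k. z = k *s u"
  proof (cases "u$1 = 0")
    case True
    then have "u$2 \<noteq> 0" using assms(2) by (auto simp: vec_eq_iff forall_2)
    with assms(1) True show ?thesis
      by (intro exI[of _ "z$2 / u$2"]) (auto simp: vec_eq_iff forall_2 wedge_def)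
  next
    case False
    with assms(1) show ?thesis
      by (intro exI[of _ "z$1 / u$1"]) (auto simp: vec_eq_iff forall_2 wedge_def field_simps)
  qed
  then obtain k where k: "z = k *s u" by blast
  with assms(3) have "k \<noteq> 0" by auto
  then have "u = (1 / k) *s z" by (simp add: k vec_eq_iff)
  then have "u \<in> vec.span {z}" by (metis vec.span_base vec.span_scale singletonI)
  moreover have "z \<in> vec.span {u}" unfolding k by (intro vec.span_scale vec.span_base) simp
  ultimately show ?thesis by (simp add: vec.span_eq)
qed

lemma span_wedge_zero:
  assumes "vec.span {z} = vec.span {u}"
  shows "wedge u z = 0"
proof -
  have "z \<in> vec.span {u}" using assms vec.span_base[of z "{z}"] by simp
  then obtain k where "z = k *s u" unfolding vec.span_singleton by blast
  then show ?thesis by (simp add: wedge_def)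
qed

lemma chart_direction: "(vector [1, w] :: complex ^ 2)$1 = 1" "(vector [1, w] :: complex ^ 2)$2 = w"
  "vector [1, w] \<noteq> (0 :: complex ^ 2)"
  by (simp_all add: vec_eq_iff forall_2)

lemma ex_3: "(\<exists>j::3. P j) \<longleftrightarrow> P 1 \<or> P 2 \<or> P 3"
  using exhaust_3 by metis

lemma infinite_singularities_rep:
  assumes "infinity_rep v l c u"
  shows "infinite_singularities v = range (\<lambda>j. vec.span {u$j})"
proof -
  have nz: "u$j \<noteq> 0" for j
    using assms exhaust_3[of j] by (auto simp: infinity_rep_def wedge_def)
  have c: "c \<noteq> 0" using assms by (simp add: infinity_rep_def)
  have root: "infinity_form v z = 0 \<longleftrightarrow> (\<exists>j. wedge (u$j) z = 0)" for z
    using c by (auto simp: infinity_rep_form[OF assms] ex_3)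
  show ?thesis
  proof (intro equalityI subsetI)
    fix s assume "s \<in> infinite_singularities v"
    then obtain z j where "s = vec.span {z}" "z \<noteq> 0" "wedge (u$j) z = 0"
      by (auto simp: infinite_singularities_def root)
    then show "s \<in> range (\<lambda>j. vec.span {u$j})" using wedge_zero_span[OF _ nz] by blast
  next
    fix s assume "s \<in> range (\<lambda>j. vec.span {u$j})"
    then obtain j where s: "s = vec.span {u$j}" by blast
    have "wedge (u$j) (u$j) = 0" by (simp add: wedge_def)
    then show "s \<in> infinite_singularities v" unfolding s infinite_singularities_def using root nz by blast
  qed
qed

lemma card_infinite_singularities_rep:
  assumes "infinity_rep v l c u"
  shows "card (infinite_singularities v) = 3"
proof -
  have "inj (\<lambda>j. vec.span {u$j})"
  proof (rule injI)
    fix i j assume "vec.span {u$i} = vec.span {u$j}"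
    then have "wedge (u$i) (u$j) = 0" "wedge (u$j) (u$i) = 0" using span_wedge_zero by metis+
    then show "i = j"
      using assms exhaust_3[of i] exhaust_3[of j] by (auto simp: infinity_rep_def)
  qed
  then show ?thesis unfolding infinite_singularities_rep[OF assms] by (simp add: card_image)
qed

text \<open>On the ray \<open>y = w*x\<close> the powers of \<open>x = 1/z\<close> cancel.
  \<open>A\<close> is the linear part of the field at \<open>(1, w)\<close> and \<open>B\<close> its
  constant term.\<close>

lemma dz_dw_expansion:
  assumes "quadratic v"
  obtains A B :: "complex ^ 2" where
    "\<And>z. z \<noteq> 0 \<Longrightarrow> dz_dw v w z =
       z*(quad_part v (vector [1, w])$1 + z*(A$1 + z*B$1)) /
         (infinity_form v (vector [1, w]) + z*((w*A$1 - A$2) + z*(w*B$1 - B$2)))"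
proof -
  obtain k0 k1 k2 p q r where "has_coeffs v k0 k1 k2 p q r" by (rule quadratic_coeffs[OF assms])
  note k = has_coeffsD(1,2)[OF this]
  have "dz_dw v w z = z*(quad_part v (vector [1, w])$1 + z*((k1 + w *s k2)$1 + z*k0$1)) /
         (infinity_form v (vector [1, w]) + z*((w*(k1 + w *s k2)$1 - (k1 + w *s k2)$2)
           + z*(w*k0$1 - k0$2)))" if z: "z \<noteq> 0" for z
  proof -
    define y where "y = 1 / z"
    have yz: "y*z = 1" and y: "y \<noteq> 0" "1 / z = y" "w / z = w*y" using z by (simp_all add: y_def)
    define V where "V = vf_at v (vector [y, w*y])"
    have V: "V$i = k0$i + y*k1$i + w*y*k2$i + y^2*p$i + y*(w*y)*q$i + (w*y)^2*r$i" for i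
      by (simp add: V_def k)
    define N where "N = quad_part v (vector [1, w])$1 + z*((k1 + w *s k2)$1 + z*k0$1)"
    define D where "D = infinity_form v (vector [1, w]) + z*((w*(k1 + w *s k2)$1 - (k1 + w *s k2)$2)
           + z*(w*k0$1 - k0$2))"
    have N': "N = p$1 + w*q$1 + w^2*r$1 + z*(k1$1 + w*k2$1 + z*k0$1)"
      by (simp add: N_def k)
    have D': "D = w*(p$1 + w*q$1 + w^2*r$1) - (p$2 + w*q$2 + w^2*r$2)
        + z*(w*(k1$1 + w*k2$1) - (k1$2 + w*k2$2) + z*(w*k0$1 - k0$2))"
      by (simp add: D_def k infinity_form_quad_part)
    have N: "V$1 = y^2*N"
      unfolding V N' using yz by algebra
    have D: "y*V$2 - w*y*V$1 = - (y^3*D)"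
      unfolding V D' using yz by algebra
    have "dz_dw v w z = - (V$1) / (y*V$2 - w*y*V$1)"
      unfolding dz_dw_def Let_def y(2,3) V_def ..
    also have "\<dots> = (y^2*N) / (y^2*(y*D))"
      unfolding D unfolding N by (simp add: power2_eq_square power3_eq_cube)
    also have "\<dots> = z*N / D" using z y(1) by (simp add: y_def)
    finally show ?thesis unfolding N_def D_def .
  qed
  then show ?thesis using that[of "k1 + w *s k2" k0] by blast
qed

lemma dz_dw_limit:
  assumes "quadratic v" "infinity_form v (vector [1, w]) \<noteq> 0"
  shows "((\<lambda>z. dz_dw v w z / z) \<longlongrightarrow> quad_part v (vector [1, w])$1 / infinity_form v (vector [1, w])) (at 0)"
proof -
  obtain A B :: "complex ^ 2" where AB: 
    "\<And>z. z \<noteq> 0 \<Longrightarrow> dz_dw v w z =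
       z*(quad_part v (vector [1, w])$1 + z*(A$1 + z*B$1)) /
         (infinity_form v (vector [1, w]) + z*((w*A$1 - A$2) + z*(w*B$1 - B$2)))"
    using dz_dw_expansion[OF assms(1)] by metis
  have "((\<lambda>z. (quad_part v (vector [1, w])$1 + z*(A$1 + z*B$1)) /
         (infinity_form v (vector [1, w]) + z*((w*A$1 - A$2) + z*(w*B$1 - B$2))))
        \<longlongrightarrow> (quad_part v (vector [1, w])$1 + 0*(A$1 + 0*B$1)) /
         (infinity_form v (vector [1, w]) + 0*((w*A$1 - A$2) + 0*(w*B$1 - B$2)))) (at 0)"
    using assms(2) by (intro tendsto_intros) simp_all
  then have *: "((\<lambda>z. (quad_part v (vector [1, w])$1 + z*(A$1 + z*B$1)) /
         (infinity_form v (vector [1, w]) + z*((w*A$1 - A$2) + z*(w*B$1 - B$2))))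
        \<longlongrightarrow> quad_part v (vector [1, w])$1 / infinity_form v (vector [1, w])) (at 0)" by simp
  show ?thesis
    by (rule Lim_transform_eventually[OF *], rule eventually_mono[OF eventually_neq_at_within[of 0]])
       (simp add: AB)
qed

lemma dz_dw_bigo:
  assumes "quadratic v" "infinity_form v (vector [1, w]) \<noteq> 0"
  shows "(\<lambda>z. dz_dw v w z - z*(quad_part v (vector [1, w])$1 / infinity_form v (vector [1, w])))
    \<in> O[at 0](\<lambda>z. z\<^sup>2)"
proof -
  define g s where "g = infinity_form v (vector [1, w])" and "s = quad_part v (vector [1, w])$1 / g"
  have g: "g \<noteq> 0" using assms(2) by (simp add: g_def)
  obtain A B :: "complex ^ 2" where AB: 
    "\<And>z. z \<noteq> 0 \<Longrightarrow> dz_dw v w z =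
       z*(quad_part v (vector [1, w])$1 + z*(A$1 + z*B$1)) /
         (infinity_form v (vector [1, w]) + z*((w*A$1 - A$2) + z*(w*B$1 - B$2)))"
    using dz_dw_expansion[OF assms(1)] by metis
  define N where "N z = A$1 + z*B$1" for z
  define D where "D z = (w*A$1 - A$2) + z*(w*B$1 - B$2)" for z
  have dz: "dz_dw v w z = z*(s*g + z*N z) / (g + z*D z)" if "z \<noteq> 0" for z
    using AB[OF that] g by (simp add: N_def D_def s_def g_def)
  have "((\<lambda>z. g + z*D z) \<longlongrightarrow> g + 0*D 0) (at 0)"
    unfolding D_def by (intro tendsto_intros)
  then have lim: "((\<lambda>z. g + z*D z) \<longlongrightarrow> g) (at 0)" by simp
  have ev: "eventually (\<lambda>z. g + z*D z \<noteq> 0) (at 0)"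
    using tendsto_imp_eventually_ne[OF lim g] .
  have "((\<lambda>z. (N z - s*D z) / (g + z*D z)) \<longlongrightarrow> (N 0 - s*D 0) / g) (at 0)"
    by (rule tendsto_divide[OF _ lim g]) (unfold N_def D_def, intro tendsto_intros)
  then have "((\<lambda>z. (dz_dw v w z - z * s) / z\<^sup>2) \<longlongrightarrow> (N 0 - s*D 0) / g) (at 0)"
  proof (rule Lim_transform_eventually)
    show "eventually (\<lambda>z. (N z - s*D z) / (g + z*D z) = (dz_dw v w z - z * s) / z\<^sup>2) (at 0)"
      using ev eventually_neq_at_within[of 0]
    proof eventually_elim
      case (elim z)
      have "z*(s*g + z*N z) - z * s*(g + z*D z) = z^2*(N z - s*D z)" by algebra
      moreover have "dz_dw v w z - z * s = (z*(s*g + z*N z) - z * s*(g + z*D z)) / (g + z*D z)"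
        unfolding dz[OF elim(2)] using elim(1) by (simp add: diff_divide_distrib)
      ultimately have "dz_dw v w z - z * s = z^2*(N z - s*D z) / (g + z*D z)" by simp
      with elim(2) show ?case by simp
    qed
  qed
  then show ?thesis unfolding s_def g_def
    by (rule bigoI_tendsto) (rule eventually_mono[OF eventually_neq_at_within[of 0]], simp)
qed

lemma quadratic_poly_zero:
  fixes a b c :: complex
  assumes "finite S" "\<And>w. w \<notin> S \<Longrightarrow> a + b*w + c*w^2 = 0"
  shows "a = 0" "b = 0" "c = 0"
proof -
  have "[:a, b, c:] = 0"
  proof (rule ccontr)
    assume "[:a, b, c:] \<noteq> 0"
    then have "finite {w. poly [:a, b, c:] w = 0}" by (rule poly_roots_finite)
    moreover have "- S \<subseteq> {w. poly [:a, b, c:] w = 0}"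
      using assms(2) by (auto simp: power2_eq_square algebra_simps)
    ultimately have "finite (- S)" using finite_subset by blast
    with assms(1) show False using infinite_UNIV_char_0[where 'a = complex] by (simp add: finite_compl)
  qed
  then show "a = 0" "b = 0" "c = 0" by (auto simp: pCons_eq_0_iff)
qed

lemma quadratic_three_roots:
  fixes a b c :: complex
  assumes "a + b*w1 + c*w1^2 = 0" "a + b*w2 + c*w2^2 = 0" "a + b*w3 + c*w3^2 = 0"
    "w1 \<noteq> w2" "w1 \<noteq> w3" "w2 \<noteq> w3"
  shows "a = 0" "b = 0" "c = 0"
proof -
  have "(w1 - w2)*(b + c*(w1 + w2)) = 0" "(w1 - w3)*(b + c*(w1 + w3)) = 0"
    using assms(1-3) by algebra+
  then have e: "b + c*(w1 + w2) = 0" "b + c*(w1 + w3) = 0" using assms(4-6) by auto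
  then have "c*(w2 - w3) = 0" by algebra
  then show "c = 0" using assms by auto
  with e show "b = 0" by simp
  with \<open>c = 0\<close> assms show "a = 0" by simp
qed

lemma partial_fractions_3:
  fixes x1 x2 x3 c :: complex
  assumes "x1 \<noteq> 0" "x2 \<noteq> 0" "x3 \<noteq> 0" "c \<noteq> 0"
  shows "c*(l1*x2*x3 + l2*x1*x3 + l3*x1*x2) / (c*x1*x2*x3) = l1 / x1 + l2 / x2 + l3 / x3"
proof -
  have "l1 / x1 = c*(l1*x2*x3) / (c*x1*x2*x3)" "l2 / x2 = c*(l2*x1*x3) / (c*x1*x2*x3)"
    "l3 / x3 = c*(l3*x1*x2) / (c*x1*x2*x3)"
    using assms by simp_all
  then show ?thesis by (simp only: distrib_left add_divide_distrib)
qed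

text \<open>The condition at \<open>z = 0\<close> says that the first component of
  \<open>quad_part\<close> over \<open>infinity_form\<close> at \<open>(1, w)\<close> is the sum of
  the \<open>l$j / (w - W$j)\<close>. Clearing denominators gives the first component of the
  representation; the second follows from the factorization of the form at infinity.\<close>

lemma char_numbers_chart_iff:
  assumes v: "quadratic v"
  shows "char_numbers_chart v W l \<longleftrightarrow> (\<exists>c. infinity_rep v l c (\<chi> j. vector [1, W$j]))"
proof
  assume "\<exists>c. infinity_rep v l c (\<chi> j. vector [1, W$j])"
  then obtain c where rep: "infinity_rep v l c (\<chi> j. vector [1, W$j])" by blast
  have form: "infinity_form v (vector [1, w]) = c*(w - W$1)*(w - W$2)*(w - W$3)" for w
    by (simp add: infinity_rep_form[OF rep] wedge_def)
  have c: "c \<noteq> 0" and W: "W$1 \<noteq> W$2" "W$1 \<noteq> W$3" "W$2 \<noteq> W$3"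
    using rep by (auto simp: infinity_rep_def wedge_def)
  have inj: "inj (($) W)" using W
  proof (intro injI)
    fix i j assume "W$i = W$j"
    with W exhaust_3[of i] exhaust_3[of j] show "i = j" by auto
  qed
  have sing: "infinite_singularities v = range (\<lambda>j. vec.span {vector [1, W$j]})"
    using infinite_singularities_rep[OF rep] by simp
  have "(\<lambda>z. dz_dw v w z - z*(\<Sum>j\<in>UNIV. l$j / (w - W$j))) \<in> O[at 0](\<lambda>z. z\<^sup>2)"
    if "w \<notin> range (($) W)" for w
  proof -
    have w: "w \<noteq> W$1" "w \<noteq> W$2" "w \<noteq> W$3" using that by auto
    have nz: "infinity_form v (vector [1, w]) \<noteq> 0" using c w by (simp add: form)
    have P: "quad_part v (vector [1, w])$1 = c*(l$1*(w - W$2)*(w - W$3)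
       + l$2*(w - W$1)*(w - W$3) + l$3*(w - W$1)*(w - W$2))"
      using rep by (simp add: infinity_rep_def wedge_def)
    have "quad_part v (vector [1, w])$1 / infinity_form v (vector [1, w]) = (\<Sum>j\<in>UNIV. l$j / (w - W$j))"
      unfolding P form sum_3 using c w by (intro partial_fractions_3) simp_all
    with dz_dw_bigo[OF v nz] show ?thesis by simp
  qed
  with inj sing show "char_numbers_chart v W l" unfolding char_numbers_chart_def by simp
next
  assume chart: "char_numbers_chart v W l"
  then have inj: "inj (($) W)"
    and sing: "infinite_singularities v = range (\<lambda>j. vec.span {vector [1, W$j]})"
    and bigo: "\<And>w. w \<notin> range (($) W) \<Longrightarrow>
      (\<lambda>z. dz_dw v w z - z*(\<Sum>j\<in>UNIV. l$j / (w - W$j))) \<in> O[at 0](\<lambda>z. z\<^sup>2)"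
    by (auto simp: char_numbers_chart_def)
  have W: "W$1 \<noteq> W$2" "W$1 \<noteq> W$3" "W$2 \<noteq> W$3"
    using inj by (auto dest!: injD)
  obtain k0 k1 k2 p q r where "has_coeffs v k0 k1 k2 p q r" by (rule quadratic_coeffs[OF v])
  note k = has_coeffsD(2)[OF this]
  have form0: "infinity_form v u = 0 \<longleftrightarrow> (\<exists>j. wedge (vector [1, W$j]) u = 0)" if u: "u \<noteq> 0" for u
  proof
    assume "infinity_form v u = 0"
    then have "vec.span {u} \<in> range (\<lambda>j. vec.span {vector [1, W$j]})"
      using u unfolding sing[symmetric] infinite_singularities_def by blast
    then obtain j where "vec.span {u} = vec.span {vector [1, W$j]}" by blast
    then show "\<exists>j. wedge (vector [1, W$j]) u = 0" using span_wedge_zero by metis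
  next
    assume "\<exists>j. wedge (vector [1, W$j]) u = 0"
    then obtain j where "wedge (vector [1, W$j]) u = 0" by blast
    from wedge_zero_span[OF this chart_direction(3) u]
    have "vec.span {u} \<in> infinite_singularities v" unfolding sing by blast
    then obtain u' where u': "vec.span {u'} = vec.span {u}" "u' \<noteq> 0" "infinity_form v u' = 0"
      unfolding infinite_singularities_def by blast
    then have "u \<in> vec.span {u'}" using vec.span_base[of u "{u}"] by simp
    then obtain s where s: "u = s *s u'" unfolding vec.span_singleton by blast
    have "infinity_form v u = s^3*infinity_form v u'"
      unfolding infinity_form_quad_part k s by (simp add: power2_eq_square power3_eq_cube algebra_simps)
    then show "infinity_form v u = 0" using u' by simp
  qed
  define c where "c = r$1"
  \<comment> \<open>All singular directions lie in the chart, so the vertical direction is not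
    singular and the cubic in \<open>w\<close> has degree exactly three.\<close>
  have c: "c \<noteq> 0"
  proof -
    have "vector [0, 1] \<noteq> (0 :: complex ^ 2)" by (simp add: vec_eq_iff forall_2)
    from form0[OF this] have "infinity_form v (vector [0, 1]) \<noteq> 0" by (simp add: wedge_def)
    then show ?thesis by (simp add: infinity_form_quad_part k c_def)
  qed
  have form1: "infinity_form v (vector [1, w]) = - p$2 + (p$1 - q$2)*w + (q$1 - r$2)*w^2 + c*w^3" for w
    by (simp add: infinity_form_quad_part k c_def power2_eq_square power3_eq_cube algebra_simps)
  have root: "infinity_form v (vector [1, W$j]) = 0" for j
    using form0[OF chart_direction(3)] by (auto simp: wedge_def)
  define e1 e2 e3 where "e1 = W$1 + W$2 + W$3" and "e2 = W$1*W$2 + W$1*W$3 + W$2*W$3"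
    and "e3 = W$1*W$2*W$3"
  \<comment> \<open>The cubic minus \<open>c\<close> times the product of the linear factors has
    degree at most two but the three roots \<open>W$j\<close>, so it vanishes.\<close>
  have cub: "(- p$2 + c*e3) + (p$1 - q$2 - c*e2)*w + (q$1 - r$2 + c*e1)*w^2
      = infinity_form v (vector [1, w]) - c*(w - W$1)*(w - W$2)*(w - W$3)" for w
    unfolding form1 e1_def e2_def e3_def by (simp add: power2_eq_square power3_eq_cube algebra_simps)
  have z: "- p$2 + c*e3 = 0" "p$1 - q$2 - c*e2 = 0" "q$1 - r$2 + c*e1 = 0"
    using quadratic_three_roots[OF _ _ _ W, of "- p$2 + c*e3" "p$1 - q$2 - c*e2" "q$1 - r$2 + c*e1"]
    unfolding cub by (simp_all add: root)
  then have form: "infinity_form v (vector [1, w]) = c*(w - W$1)*(w - W$2)*(w - W$3)" for w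
    using cub[of w] by simp
  have P: "quad_part v (vector [1, w])$1 = c*(l$1*(w - W$2)*(w - W$3)
       + l$2*(w - W$1)*(w - W$3) + l$3*(w - W$1)*(w - W$2))"
    if w: "w \<notin> range (($) W)" for w
  proof -
    have w': "w \<noteq> W$1" "w \<noteq> W$2" "w \<noteq> W$3" using w by auto
    have nz: "infinity_form v (vector [1, w]) \<noteq> 0" using c w' by (simp add: form)
    define s where "s = (\<Sum>j\<in>UNIV. l$j / (w - W$j))"
    have "(\<lambda>z. dz_dw v w z - z * s) \<in> o[at 0](\<lambda>z. z)"
    proof (rule landau_o.big_small_trans[OF bigo[OF w, folded s_def]])
      have "((\<lambda>z::complex. z^2 / z) \<longlongrightarrow> 0) (at 0)"
        by (rule Lim_transform_eventually[OF tendsto_ident_at])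
           (rule eventually_mono[OF eventually_neq_at_within[of 0]], simp add: power2_eq_square)
      then show "(\<lambda>z::complex. z\<^sup>2) \<in> o[at 0](\<lambda>z. z)" by (rule smalloI_tendsto)
         (rule eventually_neq_at_within)
    qed
    then have "((\<lambda>z. (dz_dw v w z - z * s) / z) \<longlongrightarrow> 0) (at 0)" by (rule smalloD_tendsto)
    then have "((\<lambda>z. dz_dw v w z / z - s) \<longlongrightarrow> 0) (at 0)"
      by (rule Lim_transform_eventually)
         (rule eventually_mono[OF eventually_neq_at_within[of 0]], simp add: diff_divide_distrib)
    then have "((\<lambda>z. dz_dw v w z / z) \<longlongrightarrow> s) (at 0)" by (simp add: LIM_zero_iff)
    with dz_dw_limit[OF v nz] have "s = quad_part v (vector [1, w])$1 / infinity_form v (vector [1, w])"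
      by (metis LIM_unique)
    then have "quad_part v (vector [1, w])$1 = s*infinity_form v (vector [1, w])" using nz by simp
    also have "\<dots> = c*(l$1*(w - W$2)*(w - W$3)
       + l$2*(w - W$1)*(w - W$3) + l$3*(w - W$1)*(w - W$2))"
      unfolding s_def form sum_3
      using partial_fractions_3[of "w - W$1" "w - W$2" "w - W$3" c "l$1" "l$2" "l$3", symmetric] c w'
      by simp
    finally show ?thesis .
  qed
  define f0 f1 f2 where "f0 = l$1*W$2*W$3 + l$2*W$1*W$3 + l$3*W$1*W$2"
    and "f1 = l$1*(W$2 + W$3) + l$2*(W$1 + W$3) + l$3*(W$1 + W$2)"
    and "f2 = l$1 + l$2 + l$3"
  \<comment> \<open>The number \<open>c\<close> is both the leading coefficient of the cubic and the
    coefficient of \<open>w^2\<close> in the first component. Comparing the latter gives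
    \<open>f2 = 1\<close>, which is the Camacho-Sad relation.\<close>
  have "(p$1 - c*f0) + (q$1 + c*f1)*w + (c - c*f2)*w^2 = 0" if "w \<notin> range (($) W)" for w
    using P[OF that] unfolding k f0_def f1_def f2_def
    by (simp add: power2_eq_square algebra_simps c_def)
  from quadratic_poly_zero[OF _ this, of "range (($) W)"]
  have pq: "p$1 = c*f0" "q$1 = - c*f1" and "c - c*f2 = 0"
    by (simp_all add: eq_neg_iff_add_eq_0)
  then have f2: "f2 = 1" using c by (simp add: algebra_simps)
  have qr: "p$2 = c*e3" "q$2 = c*f0 - c*e2" "r$2 = - c*f1 + c*e1"
    using z pq by (simp_all add: algebra_simps)
  have l1: "l$1 = 1 - l$2 - l$3" using f2 by (simp add: f2_def algebra_simps)
  define u :: "complex ^ 2 ^ 3" where "u = (\<chi> j. vector [1, W$j])"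
  have "quad_part v z$i = c*(l$1*wedge (u$2) z*wedge (u$3) z*u$1$i
      + l$2*wedge (u$1) z*wedge (u$3) z*u$2$i
      + l$3*wedge (u$1) z*wedge (u$2) z*u$3$i)" for z i
    using exhaust_2[of i] unfolding k
    by (auto simp: u_def pq qr c_def[symmetric] wedge_def e1_def e2_def e3_def f0_def f1_def l1 power2_eq_square
        algebra_simps)
  then have "infinity_rep v l c u"
    unfolding infinity_rep_def using c W f2 by (auto simp: wedge_def f2_def u_def)
  then have "infinity_rep v l c (\<chi> j. vector [1, W$j])" unfolding u_def .
  then show "\<exists>c. infinity_rep v l c (\<chi> j. vector [1, W$j])" by blast
qed

lemma vfield_of_coeffs:
  fixes k0 k1 k2 p q r :: "complex ^ 2"
  shows "\<exists>v. quadratic v \<and> (\<forall>z i. vf_at v z$i = k0$i + z$1*k1$i + z$2*k2$i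
        + (z$1)^2*p$i + z$1*z$2*q$i + (z$2)^2*r$i)"
proof -
  define v :: vfield where "v = (\<chi> i. single (expo 0 0) (k0$i)
    + single (expo 1 0) (k1$i) + single (expo 0 1) (k2$i)
    + single (expo 2 0) (p$i) + single (expo 1 1) (q$i)
    + single (expo 0 2) (r$i))"
  have add: "total_degree_le n (F + G)" if "total_degree_le n F" "total_degree_le n G"
    for n and F G :: "2 mpoly"
    using that keys_add[of F G] unfolding total_degree_le_def by blast
  have single: "total_degree_le n (single (expo i j) c)" if "i + j \<le> n" for n i j c
    using that by (simp add: total_degree_le_def mdegree_expo del: One_nat_def)
  have "quadratic v"
    unfolding quadratic_def v_def by (simp del: One_nat_def, intro allI add single; simp)
  moreover have "vf_at v z$i = k0$i + z$1*k1$i + z$2*k2$i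
        + (z$1)^2*p$i + z$1*z$2*q$i + (z$2)^2*r$i" for z i
    by (simp add: vf_at_def v_def algebra_simps)
  ultimately show ?thesis by blast
qed

lemma wedge_matrix_vector: "wedge (A *v u) (A *v z) = det A*wedge u z"
  by (simp add: wedge_def det_2 matrix_vector_mult_def sum_2 algebra_simps)

text \<open>Each wedge is multiplied by \<open>det A\<close>, and every summand contains two of
  them, whence the square in the denominator.\<close>

lemma infinity_rep_map:
  assumes rep: "infinity_rep v l c u" and inv: "invertible A"
    and A: "\<And>z. quad_part v' (A *v z) = A *v quad_part v z"
  shows "infinity_rep v' l (c / (det A)^2) (\<chi> j. A *v u$j)"
proof -
  have dA: "det A \<noteq> 0" using inv by (simp add: invertible_det_nz)
  have "quad_part v' z$i = c / (det A)^2*(l$1*wedge (A *v u$2) z*wedge (A *v u$3) z*(A *v u$1)$i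
        + l$2*wedge (A *v u$1) z*wedge (A *v u$3) z*(A *v u$2)$i
        + l$3*wedge (A *v u$1) z*wedge (A *v u$2) z*(A *v u$3)$i)" for z i
  proof -
    obtain y where z: "z = A *v y"
      using inv by (metis invertible_def matrix_vector_mul_assoc matrix_vector_mul_lid)
    define a1 a2 a3 where "a1 = wedge (u$1) y" and "a2 = wedge (u$2) y" and "a3 = wedge (u$3) y"
    have q: "quad_part v y$j = c*(l$1*a2*a3*u$1$j
        + l$2*a1*a3*u$2$j + l$3*a1*a2*u$3$j)" for j
      using rep unfolding infinity_rep_def a1_def a2_def a3_def by blast
    have cd: "c = c / (det A)^2*(det A*det A)" using dA by (simp add: power2_eq_square)
    have "quad_part v' z$i = A$i$1*quad_part v y$1 + A$i$2*quad_part v y$2"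
      unfolding z A by (simp add: matrix_vector_mult_def sum_2)
    also have "\<dots> = c*(l$1*a2*a3*(A *v u$1)$i
        + l$2*a1*a3*(A *v u$2)$i + l$3*a1*a2*(A *v u$3)$i)"
      unfolding q by (simp add: matrix_vector_mult_def sum_2 algebra_simps)
    also have "\<dots> = c / (det A)^2*(l$1*(det A*a2)*(det A*a3)*(A *v u$1)$i
        + l$2*(det A*a1)*(det A*a3)*(A *v u$2)$i
        + l$3*(det A*a1)*(det A*a2)*(A *v u$3)$i)"
      by (subst cd) (simp add: algebra_simps)
    finally show ?thesis unfolding z wedge_matrix_vector a1_def a2_def a3_def .
  qed
  then show ?thesis using rep dA by (simp add: infinity_rep_def wedge_matrix_vector)
qed

lemma infinity_rep_linear_change:
  assumes "infinity_rep v l c u" "linear_change A v v'" "quadratic v"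
  shows "infinity_rep v' l (c / (det A)^2) (\<chi> j. A *v u$j)"
  using infinity_rep_map[OF assms(1) _ quad_part_linear_change[OF assms(2,3)]] assms(2)
  by (simp add: linear_change_def)

lemma linear_change_inverse:
  assumes "linear_change A v v'" "quadratic v"
  shows "\<exists>A'. linear_change A' v' v"
proof -
  have A: "invertible A" "\<And>z. vf_at v' (A *v z) = A *v vf_at v z"
    using assms by (auto simp: linear_change_def)
  then obtain B where AB: "A ** B = mat 1" "B ** A = mat 1"
    unfolding invertible_def by blast
  then have "invertible B" unfolding invertible_def by blast
  moreover have "vf_at v (B *v z) = B *v vf_at v' z" for z
  proof -
    have "B *v vf_at v' (A *v (B *v z)) = vf_at v (B *v z)"
      unfolding A(2) by (simp add: matrix_vector_mul_assoc AB)
    then show ?thesis by (simp add: matrix_vector_mul_assoc AB)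
  qed
  ultimately show ?thesis using assms(2) unfolding linear_change_def by blast
qed

text \<open>In each summand every \<open>u$j\<close> occurs exactly once, in a wedge or as the
  vector, so all summands scale by the same factor.\<close>

lemma infinity_rep_rescale:
  assumes "infinity_rep v l c u" and s: "\<And>j. s j \<noteq> 0" and u: "\<And>j. u$j = s j *s u'$j"
  shows "infinity_rep v l (c * s 1 * s 2 * s 3) u'"
proof -
  have w: "wedge (s *s a) z = s*wedge a z" "wedge a (s *s z) = s*wedge a z" for s a z
    by (simp_all add: wedge_def algebra_simps)
  show ?thesis
    using assms(1) s unfolding infinity_rep_def u w by (simp add: algebra_simps)
qed

lemma char_numbers_iff:
  assumes v: "quadratic v"
  shows "char_numbers v l \<longleftrightarrow> (\<exists>c u. infinity_rep v l c u)"
proof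
  assume "char_numbers v l"
  then obtain A v' W where A: "linear_change A v v'" and W: "char_numbers_chart v' W l"
    unfolding char_numbers_def by blast
  have v': "quadratic v'" using A by (simp add: linear_change_def)
  from W obtain c u where rep: "infinity_rep v' l c u" unfolding char_numbers_chart_iff[OF v'] by blast
  obtain B where "linear_change B v' v" using linear_change_inverse[OF A v] by blast
  from infinity_rep_linear_change[OF rep this v'] show "\<exists>c u. infinity_rep v l c u" by blast
next
  assume "\<exists>c u. infinity_rep v l c u"
  then obtain c u where rep: "infinity_rep v l c u" by blast
  \<comment> \<open>For \<open>t\<close> off this finite set the shear that adds \<open>t\<close>
    times the second coordinate to the first moves all three directions into the chart. If
    \<open>u$j$2 = 0\<close>, the quotient is 0 by convention and merely excludes one more
    value.\<close>
  define S where "S = (\<lambda>j. - (u$j$1 / u$j$2)) ` UNIV"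
  have "finite S" unfolding S_def by simp
  then obtain t where t: "t \<notin> S" using ex_new_if_finite infinite_UNIV_char_0[where 'a = complex] by blast
  have nz: "u$j \<noteq> 0" for j
    using rep exhaust_3[of j] by (auto simp: infinity_rep_def wedge_def)
  have lin: "u$j$1 + t*u$j$2 \<noteq> 0" for j
  proof
    assume 0: "u$j$1 + t*u$j$2 = 0"
    show False
    proof (cases "u$j$2 = 0")
      case True
      with 0 nz[of j] show ?thesis by (auto simp: vec_eq_iff forall_2)
    next
      case False
      with 0 have "t = - (u$j$1 / u$j$2)" by (simp add: field_simps eq_neg_iff_add_eq_0)
      with t show ?thesis by (auto simp: S_def)
    qed
  qed
  define A :: "complex ^ 2 ^ 2" where "A = vector [vector [1, t], vector [0, 1]]"
  have A: "(A *v z)$1 = z$1 + t*z$2" "(A *v z)$2 = z$2" for z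
    by (simp_all add: A_def matrix_vector_mult_def sum_2)
  have "det A = 1" by (simp add: A_def det_2)
  then have inv: "invertible A" by (simp add: invertible_det_nz)
  obtain k0 k1 k2 p q r where "has_coeffs v k0 k1 k2 p q r" by (rule quadratic_coeffs[OF v])
  note k = has_coeffsD(1)[OF this]
  obtain v' where v': "quadratic v'" and k':
    "\<And>z i. vf_at v' z$i = (A *v k0)$i + z$1*(A *v k1)$i + z$2*(A *v (k2 - t *s k1))$i
        + (z$1)^2*(A *v p)$i + z$1*z$2*(A *v (q - (2*t) *s p))$i
        + (z$2)^2*(A *v (r - t *s q + t^2 *s p))$i"
    using vfield_of_coeffs by metis
  have "vf_at v' (A *v z)$i = (A *v vf_at v z)$i" for z i
    using exhaust_2[of i] unfolding k' by (auto simp: A k power2_eq_square algebra_simps)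
  then have lc: "linear_change A v v'" using inv v' by (simp add: linear_change_def vec_eq_iff)
  define s where "s j = u$j$1 + t*u$j$2" for j
  define W :: "complex ^ 3" where "W = (\<chi> j. u$j$2 / s j)"
  have "infinity_rep v' l (c / (det A)^2 * s 1 * s 2 * s 3) (\<chi> j. vector [1, W$j])"
  proof (rule infinity_rep_rescale[OF infinity_rep_linear_change[OF rep lc v]])
    show "s j \<noteq> 0" for j using lin by (simp add: s_def)
    then show "(\<chi> j. A *v u$j)$j = s j *s (\<chi> j. vector [1, W$j])$j" for j
      unfolding vec_eq_iff forall_2 by (simp add: A W_def s_def[symmetric])
  qed
  then have "char_numbers_chart v' W l" unfolding char_numbers_chart_iff[OF v'] by blast
  with lc show "char_numbers v l" unfolding char_numbers_def by blast
qed

text \<open>Needed because \<open>realize\<close> recovers the characteristic numbers only as the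
  roots of a cubic.\<close>

lemma char_numbers_permute:
  assumes f: "bij f" and "char_numbers v l"
  shows "char_numbers v (\<chi> j. l$f j)"
proof -
  obtain A v' W where A: "linear_change A v v'" and W: "char_numbers_chart v' W l"
    using assms(2) unfolding char_numbers_def by blast
  define W' :: "complex ^ 3" where "W' = (\<chi> j. W$f j)"
  have W': "($) W' = ($) W \<circ> f" by (auto simp: W'_def)
  have range: "range (($) W') = range (($) W)"
    unfolding W' by (metis bij_is_surj f image_comp)
  have "inj (($) W')"
    unfolding W' using W bij_is_inj[OF f] by (intro inj_compose) (auto simp: char_numbers_chart_def)
  moreover have "range (\<lambda>j. vec.span {vector [1, W'$j]}) = range (\<lambda>j. vec.span {vector [1, W$j] :: complex ^ 2})"
  proof -
    have "range (\<lambda>j. vec.span {vector [1, W'$j] :: complex ^ 2}) = (\<lambda>w. vec.span {vector [1, w]}) ` range (($) W')"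
      by (simp add: image_image)
    also have "\<dots> = range (\<lambda>j. vec.span {vector [1, W$j]})"
      unfolding range by (simp add: image_image)
    finally show ?thesis .
  qed
  moreover have "(\<Sum>j\<in>UNIV. (\<chi> j. l$f j)$j / (w - W'$j)) = (\<Sum>j\<in>UNIV. l$j / (w - W$j))" for w
    using sum.reindex_bij_betw[OF f, of "\<lambda>j. l$j / (w - W$j)"] by (simp add: W'_def)
  ultimately have "char_numbers_chart v' W' (\<chi> j. l$f j)"
    using W range unfolding char_numbers_chart_def by simp
  with A show ?thesis unfolding char_numbers_def by blast
qed

section \<open>Symmetric functions of the characteristic numbers\<close>

definition cubic_disc :: "complex \<Rightarrow> complex \<Rightarrow> complex \<Rightarrow> complex \<Rightarrow> complex" where
  "cubic_disc p q r s = q^2*r^2 - 4*p*r^3 - 4*q^3 * s - 27*p^2 * s^2 + 18*p*q*r * s"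

text \<open>The arguments are the coefficients of \<open>c\<close> times the product of the factors
  \<open>a1*y - b1*x\<close>, \<open>a2*y - b2*x\<close>, \<open>a3*y - b3*x\<close>. The
  homogeneous form allows a root in the direction \<open>x = 0\<close>.\<close>

lemma cubic_disc_product:
  "cubic_disc (- c*b1*b2*b3) (c*(a1*b2*b3 + b1*a2*b3 + b1*b2*a3)) (- c*(b1*a2*a3 + a1*b2*a3 + a1*a2*b3)) (c*a1*a2*a3)
    = c^4*((a1*b2-b1*a2)*(a1*b3-b1*a3)*(a2*b3-b2*a3))^2"
  unfolding cubic_disc_def by algebra

text \<open>These are invariants of binary forms. The right side of the second claim is minus the
  resultant of the two quadratic forms. The third claim is the apolar pairing of the Hessian of the
  cubic (divided by 4) with half the Jacobian determinant of the two quadratic forms.\<close>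

lemma infinity_rep_invariants:
  assumes rep: "infinity_rep v l c u"
    and P: "\<And>z. quad_part v z$1 = p0*(z$1)^2 + p1*z$1*z$2 + p2*(z$2)^2"
    and Q: "\<And>z. quad_part v z$2 = q0*(z$1)^2 + q1*z$1*z$2 + q2*(z$2)^2"
  defines "g0 \<equiv> - q0" and "g1 \<equiv> p0 - q1" and "g2 \<equiv> p1 - q2" and "g3 \<equiv> p2"
  shows "cubic_disc g0 g1 g2 g3 \<noteq> 0"
    and "l$1*l$2*l$3*cubic_disc g0 g1 g2 g3 = (p0*q1-p1*q0)*(p1*q2-p2*q1) - (p0*q2-p2*q0)^2"
    and "(l$1*l$2 + l$1*l$3 + l$2*l$3)*cubic_disc g0 g1 g2 g3 =
      (3*g0*g2 - g1^2)*(p1*q2-p2*q1) - (9*g0*g3 - g1*g2)*(p0*q2-p2*q0) + (3*g1*g3 - g2^2)*(p0*q1-p1*q0)"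
proof -
  define a1 b1 a2 b2 a3 b3 where ab: "a1 = u$1$1" "b1 = u$1$2" "a2 = u$2$1" "b2 = u$2$2"
    "a3 = u$3$1" "b3 = u$3$2"
  define l1 l2 l3 where l: "l1 = l$1" "l2 = l$2" "l3 = l$3"
  have sum: "l1 + l2 + l3 = 1" using rep by (simp add: infinity_rep_def l)
  have q: "quad_part v z$i = c*(l1*(a2*z$2 - b2*z$1)*(a3*z$2 - b3*z$1)*u$1$i
        + l2*(a1*z$2 - b1*z$1)*(a3*z$2 - b3*z$1)*u$2$i
        + l3*(a1*z$2 - b1*z$1)*(a2*z$2 - b2*z$1)*u$3$i)" for z i
    using rep unfolding infinity_rep_def l ab wedge_def by blast
  note P' = q[of _ 1, unfolded P, folded ab] and Q' = q[of _ 2, unfolded Q, folded ab]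
  have p0: "p0 = c*(l1*b2*b3*a1 + l2*b1*b3*a2 + l3*b1*b2*a3)"
    using P'[of "vector [1, 0]"] by simp
  have p2: "p2 = c*(l1*a2*a3*a1 + l2*a1*a3*a2 + l3*a1*a2*a3)"
    using P'[of "vector [0, 1]"] by simp
  have p1: "p1 = - c*(l1*(a2*b3+a3*b2)*a1 + l2*(a1*b3+a3*b1)*a2 + l3*(a1*b2+a2*b1)*a3)"
    using P'[of "vector [1, 1]"] unfolding p0 p2 by simp algebra
  have q0: "q0 = c*(l1*b2*b3*b1 + l2*b1*b3*b2 + l3*b1*b2*b3)"
    using Q'[of "vector [1, 0]"] by simp
  have q2: "q2 = c*(l1*a2*a3*b1 + l2*a1*a3*b2 + l3*a1*a2*b3)"
    using Q'[of "vector [0, 1]"] by simp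
  have q1: "q1 = - c*(l1*(a2*b3+a3*b2)*b1 + l2*(a1*b3+a3*b1)*b2 + l3*(a1*b2+a2*b1)*b3)"
    using Q'[of "vector [1, 1]"] unfolding q0 q2 by simp algebra
  have l1: "l1 = 1 - l2 - l3" using sum by (simp add: algebra_simps)
  have g: "g0 = - c*b1*b2*b3" "g1 = c*(a1*b2*b3 + b1*a2*b3 + b1*b2*a3)"
    "g2 = - c*(b1*a2*a3 + a1*b2*a3 + a1*a2*b3)" "g3 = c*a1*a2*a3"
    unfolding g0_def g1_def g2_def g3_def p0 p1 p2 q0 q1 q2 l1 by algebra+
  define w12 w13 w23 where w: "w12 = a1*b2-b1*a2" "w13 = a1*b3-b1*a3" "w23 = a2*b3-b2*a3"
  have disc: "cubic_disc g0 g1 g2 g3 = c^4*(w12*w13*w23)^2"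
    unfolding g cubic_disc_product w ..
  have "c \<noteq> 0" "w12 \<noteq> 0" "w13 \<noteq> 0" "w23 \<noteq> 0"
    using rep by (auto simp: infinity_rep_def wedge_def ab w)
  then show "cubic_disc g0 g1 g2 g3 \<noteq> 0" by (simp add: disc)
  \<comment> \<open>Half the Jacobian determinant of the quadratic forms is \<open>- (c^2)\<close>
    times the sum of \<open>k1*(b1*x - a1*y)^2\<close> and its two analogues, so it is diagonal in
    the linear factors of the cubic. The Hessian below is diagonal in the same way, with the weights
    \<open>w23^2 / 2\<close> and so on, and the pairings collapse to products of the
    \<open>w\<close>.\<close>
  define k1 k2 k3 where k: "k1 = l2*l3*w23^2" "k2 = l1*l3*w13^2" "k3 = l1*l2*w12^2"
  have m01: "p0*q1-p1*q0 = - (c^2)*(k1*b1^2 + k2*b2^2 + k3*b3^2)"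
    unfolding p0 p1 q0 q1 k w by algebra
  have m02: "p0*q2-p2*q0 = c^2*(k1*a1*b1 + k2*a2*b2 + k3*a3*b3)"
    unfolding p0 p2 q0 q2 k w by algebra
  have m12: "p1*q2-p2*q1 = - (c^2)*(k1*a1^2 + k2*a2^2 + k3*a3^2)"
    unfolding p1 p2 q1 q2 k w by algebra
  have "(p0*q1-p1*q0)*(p1*q2-p2*q1) - (p0*q2-p2*q0)^2
      = c^4*(k1*k2*w12^2 + k1*k3*w13^2 + k2*k3*w23^2)"
    unfolding m01 m02 m12 w by algebra
  also have "\<dots> = l1*l2*l3*(l1+l2+l3)*(c^4*(w12*w13*w23)^2)"
    unfolding k by algebra
  finally show "l$1*l$2*l$3*cubic_disc g0 g1 g2 g3 = (p0*q1-p1*q0)*(p1*q2-p2*q1) - (p0*q2-p2*q0)^2"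
    by (simp add: disc sum flip: l)
  have "3*g0*g2 - g1^2 = - (c^2)*((b3^2*w12^2 + b2^2*w13^2 + b1^2*w23^2)/2)"
    "9*g0*g3 - g1*g2 = c^2*(a3*b3*w12^2 + a2*b2*w13^2 + a1*b1*w23^2)"
    "3*g1*g3 - g2^2 = - (c^2)*((a3^2*w12^2 + a2^2*w13^2 + a1^2*w23^2)/2)"
    unfolding g w by algebra+
  then have "(3*g0*g2 - g1^2)*(p1*q2-p2*q1) - (9*g0*g3 - g1*g2)*(p0*q2-p2*q0) + (3*g1*g3 - g2^2)*(p0*q1-p1*q0)
      = c^4*(k1*w12^2*w13^2 + k2*w12^2*w23^2 + k3*w13^2*w23^2)"
    unfolding m01 m02 m12 w by algebra
  also have "\<dots> = (l1*l2+l1*l3+l2*l3)*(c^4*(w12*w13*w23)^2)"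
    unfolding k by algebra
  finally show "(l$1*l$2 + l$1*l$3 + l$2*l$3)*cubic_disc g0 g1 g2 g3 =
      (3*g0*g2 - g1^2)*(p1*q2-p2*q1) - (9*g0*g3 - g1*g2)*(p0*q2-p2*q0) + (3*g1*g3 - g2^2)*(p0*q1-p1*q0)"
    by (simp add: disc flip: l)
qed

section \<open>The normal form\<close>

text \<open>
  In affine coordinates with three of the singular points at \<open>(0,0)\<close>, \<open>(1,0)\<close>, \<open>(0,1)\<close>, the field is a
  linear matrix applied to two conics through the four points. The fourth point is
  \<open>((1 - m) / (1 - m n), (1 - n) / (1 - m n))\<close>.
\<close>

definition normal_form ::
    "vfield \<Rightarrow> complex \<Rightarrow> complex \<Rightarrow> complex \<Rightarrow> complex \<Rightarrow> complex \<Rightarrow> complex \<Rightarrow> bool" where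
  "normal_form v al be ga de m n \<longleftrightarrow> quadratic v \<and>
     (\<forall>z. vf_at v z$1 = al*(z$1 - (z$1)^2 - m*z$1*z$2) + be*(z$2 - (z$2)^2 - n*z$1*z$2) \<and>
          vf_at v z$2 = ga*(z$1 - (z$1)^2 - m*z$1*z$2) + de*(z$2 - (z$2)^2 - n*z$1*z$2))"

lemma normal_form_vf:
  assumes "normal_form v al be ga de m n"
  shows "quadratic v"
    "vf_at v z$1 = al*(z$1 - (z$1)^2 - m*z$1*z$2) + be*(z$2 - (z$2)^2 - n*z$1*z$2)"
    "vf_at v z$2 = ga*(z$1 - (z$1)^2 - m*z$1*z$2) + de*(z$2 - (z$2)^2 - n*z$1*z$2)"
  using assms by (auto simp: normal_form_def)

lemma normal_form_exists: "\<exists>v. normal_form v al be ga de m n"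
proof -
  obtain v where "quadratic v" and v: "\<And>z i. vf_at v z$i = (0 :: complex ^ 2)$i + z$1 * vector [al, ga]$i
      + z$2 * vector [be, de]$i + (z$1)^2 * vector [- al, - ga]$i
      + z$1*z$2 * vector [- al*m - be*n, - ga*m - de*n]$i + (z$2)^2 * vector [- be, - de]$i"
    using vfield_of_coeffs[of 0 "vector [al, ga]" "vector [be, de]" "vector [- al, - ga]"
      "vector [- al*m - be*n, - ga*m - de*n]" "vector [- be, - de]"] by metis
  then show ?thesis unfolding normal_form_def by (intro exI[of _ v]) (auto simp: algebra_simps)
qed

text \<open>For a quadratic field the central difference is exact, as the terms of even degree in
  \<open>h\<close> cancel. So Jacobian matrices, too, can be computed from values of the
  field.\<close>

lemma jacobian_difference:
  assumes "quadratic v"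
  shows "2*(jacobian v z *v h)$i = vf_at v (z + h)$i - vf_at v (z - h)$i"
proof -
  obtain k0 k1 k2 p q r where "has_coeffs v k0 k1 k2 p q r" by (rule quadratic_coeffs[OF assms])
  note k = has_coeffsD(1,3,4)[OF this]
  show ?thesis unfolding matrix_vector_mult_def sum_2
    by (simp add: k power2_eq_square algebra_simps)
qed

lemma normal_form_jacobian:
  assumes "normal_form v al be ga de m n"
  shows "jacobian v z$1$1 = al*(1 - 2*z$1 - m*z$2) - be*n*z$2"
    "jacobian v z$1$2 = - al*m*z$1 + be*(1 - 2*z$2 - n*z$1)"
    "jacobian v z$2$1 = ga*(1 - 2*z$1 - m*z$2) - de*n*z$2"
    "jacobian v z$2$2 = - ga*m*z$1 + de*(1 - 2*z$2 - n*z$1)"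
proof -
  note v = normal_form_vf[OF assms]
  note J = jacobian_difference[OF v(1), of z "vector [1, 0]"] jacobian_difference[OF v(1), of z "vector [0, 1]"]
  have two: "x = y" if "2*x = 2*y" for x y :: complex using that by simp
  show "jacobian v z$1$1 = al*(1 - 2*z$1 - m*z$2) - be*n*z$2"
    by (rule two, insert J(1)[of 1], unfold matrix_vector_mult_def sum_2)
       (simp add: v power2_eq_square algebra_simps)
  show "jacobian v z$1$2 = - al*m*z$1 + be*(1 - 2*z$2 - n*z$1)"
    by (rule two, insert J(2)[of 1], unfold matrix_vector_mult_def sum_2)
       (simp add: v power2_eq_square algebra_simps)
  show "jacobian v z$2$1 = ga*(1 - 2*z$1 - m*z$2) - de*n*z$2"
    by (rule two, insert J(1)[of 2], unfold matrix_vector_mult_def sum_2)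
       (simp add: v power2_eq_square algebra_simps)
  show "jacobian v z$2$2 = - ga*m*z$1 + de*(1 - 2*z$2 - n*z$1)"
    by (rule two, insert J(2)[of 2], unfold matrix_vector_mult_def sum_2)
       (simp add: v power2_eq_square algebra_simps)
qed

lemma normal_form_trace:
  assumes "normal_form v al be ga de m n"
  shows "trace (jacobian v z) = al*(1 - 2*z$1 - m*z$2) - be*n*z$2
    - ga*m*z$1 + de*(1 - 2*z$2 - n*z$1)"
  by (simp add: trace_def sum_2 normal_form_jacobian[OF assms])

lemma normal_form_det:
  assumes "normal_form v al be ga de m n"
  shows "det (jacobian v z) = (al*de - be*ga) *
    ((1 - 2*z$1 - m*z$2)*(1 - 2*z$2 - n*z$1) - m*n*z$1*z$2)"
  unfolding det_2 normal_form_jacobian[OF assms] by algebra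

lemma normal_form_quad_part:
  assumes "normal_form v al be ga de m n"
  shows "quad_part v z$1 = (- al)*(z$1)^2 + (- al*m - be*n)*z$1*z$2 + (- be)*(z$2)^2"
    "quad_part v z$2 = (- ga)*(z$1)^2 + (- ga*m - de*n)*z$1*z$2 + (- de)*(z$2)^2"
proof -
  note v = normal_form_vf[OF assms]
  have two: "x = y" if "2*x = 2*y" for x y :: complex using that by simp
  show "quad_part v z$1 = (- al)*(z$1)^2 + (- al*m - be*n)*z$1*z$2 + (- be)*(z$2)^2"
    by (rule two, unfold quad_part_eq[OF v(1)]) (simp add: v algebra_simps)
  show "quad_part v z$2 = (- ga)*(z$1)^2 + (- ga*m - de*n)*z$1*z$2 + (- de)*(z$2)^2"
    by (rule two, unfold quad_part_eq[OF v(1)]) (simp add: v algebra_simps)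
qed

section \<open>The discriminant at infinity in the normal form\<close>

definition nf_disc :: "complex \<Rightarrow> complex \<Rightarrow> complex \<Rightarrow> complex \<Rightarrow> complex \<Rightarrow> complex \<Rightarrow> complex" where
  "nf_disc al be ga de m n = cubic_disc ga (m*ga + n*de - al) (de - m*al - n*be) (- be)"

text \<open>With \<open>d = al*de - be*ga\<close> the determinants at the three chosen points are
  \<open>d\<close>, \<open>d*(n-1)\<close>, \<open>d*(m-1)\<close>, and their second symmetric
  function is \<open>d^2*(m*n-1)\<close>. So the second claim says that the product of the
  characteristic numbers is this function over the discriminant.\<close>

lemma normal_form_infinity:
  assumes nf: "normal_form v al be ga de m n" and rep: "infinity_rep v l c u"
  defines "g1 \<equiv> m*ga + n*de - al" and "g2 \<equiv> de - m*al - n*be"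
  shows "nf_disc al be ga de m n \<noteq> 0"
    and "l$1*l$2*l$3*nf_disc al be ga de m n = (al*de - be*ga)^2*(m*n - 1)"
    and "(l$1*l$2 + l$1*l$3 + l$2*l$3)*nf_disc al be ga de m n =
      (al*de - be*ga)*((3*ga*g2 - g1^2)*m - (- 9*ga*be - g1*g2) + (- 3*g1*be - g2^2)*n)"
proof -
  note inv = infinity_rep_invariants[OF rep normal_form_quad_part[OF nf]]
  have g: "- (- ga) = ga" "- al - (- ga*m - de*n) = m*ga + n*de - al" "- al*m - be*n - - de = de - m*al - n*be"
    by (simp_all add: algebra_simps)
  show "nf_disc al be ga de m n \<noteq> 0" using inv(1) unfolding nf_disc_def g .
  show "l$1*l$2*l$3*nf_disc al be ga de m n = (al*de - be*ga)^2*(m*n - 1)"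
    using inv(2) unfolding nf_disc_def g by (rule trans) algebra
  show "(l$1*l$2 + l$1*l$3 + l$2*l$3)*nf_disc al be ga de m n =
      (al*de - be*ga)*((3*ga*g2 - g1^2)*m - (- 9*ga*be - g1*g2) + (- 3*g1*be - g2^2)*n)"
    using inv(3) unfolding nf_disc_def g by (rule trans) (unfold g1_def g2_def, algebra)
qed

text \<open>
  The square root of the radicand that occurs in the discriminant of the normal form. Its sign distinguishes the
  twin fields, that is, the two fields with the same \<open>t\<^sub>k\<close> and \<open>d\<^sub>k\<close>.
\<close>

definition nf_root :: "complex \<Rightarrow> complex \<Rightarrow> complex \<Rightarrow> complex \<Rightarrow> complex \<Rightarrow> complex \<Rightarrow> complex" where
  "nf_root al be ga de m n = (al*de - be*ga)*(2*(m+n-2)*(al-de) - (m+n-2)*(((2-m)*al - n*be) - ((2-n)*de - m*ga))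
     + m*((2-m)*al - n*be) - n*((2-n)*de - m*ga))"

text \<open>\<open>T1\<close>, \<open>T2\<close>, \<open>T3\<close> are the sums of two traces at
  the chosen points, and \<open>d*(m+n-2)\<close>, \<open>d*m\<close>, \<open>d*n\<close> are the
  sums of two determinants.\<close>

lemma nf_disc_eq:
  fixes al be ga de m n :: complex
  defines "d \<equiv> al*de - be*ga" and "T1 \<equiv> - m*al - n*de - m*ga - n*be" and "T2 \<equiv> (2-m)*al - n*be" and "T3 \<equiv> (2-n)*de - m*ga"
  shows "8*((d*(m+n-2))*(d*m)*(d*n))*nf_disc al be ga de m n
    = twin_sum T1 T2 T3 (d*(m+n-2)) (d*m) (d*n) - twin_diff T1 T2 T3 (d*(m+n-2)) (d*m) (d*n)*nf_root al be ga de m n"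
    "(nf_root al be ga de m n)^2 = twin_radicand T1 T2 T3 (d*(m+n-2)) (d*m) (d*n)"
proof -
  \<comment> \<open>\<open>S\<close> is \<open>nf_root\<close> without its factor \<open>d\<close>,
    and \<open>R\<close> is \<open>twin_sum_rest\<close> written out in \<open>m\<close>,
    \<open>n\<close> and \<open>d\<close>. Splitting off the common factor \<open>d^3\<close> leaves
    a smaller identity.\<close>
  define S where "S = 2*(m+n-2)*(al-de) - (m+n-2)*(T2-T3) + m*T2 - n*T3"
  define R where "R = T1^3*(T2+T3) + T2^3*(T1+T3) + T3^3*(T1+T2) - 4*(T1^2*T2^2 + T1^2*T3^2 + T2^2*T3^2)
     + 2*T1*T2*T3*(T1+T2+T3) - 36*d*((m+n-2)*T1^2 + m*T2^2 + n*T3^2)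
     + 36*d*(T1*T2*((m+n-2)+m-n) + T1*T3*((m+n-2)+n-m) + T2*T3*(m+n-(m+n-2)))
     - 54*d^2*((m+n-2)^2 + m^2 + n^2 - 2*((m+n-2)*m + (m+n-2)*n + m*n))"
  have root: "nf_root al be ga de m n = d*S"
    unfolding nf_root_def d_def S_def T2_def T3_def ..
  have "8*(m*n*(m+n-2))*nf_disc al be ga de m n
      = twin_sum_lead T1 T2 T3 (m+n-2) m n + (m*n*(m+n-2))*R - twin_diff T1 T2 T3 (m+n-2) m n*S"
    unfolding nf_disc_def cubic_disc_def twin_sum_lead_def twin_diff_def R_def S_def d_def T1_def T2_def T3_def
    by algebra
  then have "d^3*(8*(m*n*(m+n-2))*nf_disc al be ga de m n)
      = d^3*(twin_sum_lead T1 T2 T3 (m+n-2) m n + (m*n*(m+n-2))*R - twin_diff T1 T2 T3 (m+n-2) m n*S)"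
    by simp
  moreover have "twin_sum T1 T2 T3 (d*(m+n-2)) (d*m) (d*n)
      = d^3*(twin_sum_lead T1 T2 T3 (m+n-2) m n + (m*n*(m+n-2))*R)"
    unfolding twin_sum_def twin_sum_lead_def twin_sum_rest_def R_def by algebra
  moreover have "twin_diff T1 T2 T3 (d*(m+n-2)) (d*m) (d*n) = d^2*twin_diff T1 T2 T3 (m+n-2) m n"
    unfolding twin_diff_def by algebra
  ultimately show "8*((d*(m+n-2))*(d*m)*(d*n))*nf_disc al be ga de m n
    = twin_sum T1 T2 T3 (d*(m+n-2)) (d*m) (d*n) - twin_diff T1 T2 T3 (d*(m+n-2)) (d*m) (d*n)*nf_root al be ga de m n"
    unfolding root by algebra
  have "S^2 = heron ((m+n-2)*T1) (m*T2) (n*T3) - 8*d*((m+n-2)*m*n)"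
    unfolding S_def heron_def T1_def T2_def T3_def d_def by algebra
  then show "(nf_root al be ga de m n)^2 = twin_radicand T1 T2 T3 (d*(m+n-2)) (d*m) (d*n)"
    unfolding root twin_radicand_def heron_def by algebra
qed

text \<open>Multiplied by the product \<open>X\<close> of the sums of determinants, the left side
  becomes \<open>(8*X*D - T)^2 - C^2*E\<close>, where \<open>D\<close>, \<open>T\<close>,
  \<open>C\<close>, \<open>E\<close> are the values of \<open>nf_disc\<close>,
  \<open>twin_sum\<close>, \<open>twin_diff\<close>, \<open>twin_radicand\<close>.\<close>

lemma twin_quadratic_generic:
  fixes al be ga de m n :: complex
  defines "d \<equiv> al*de - be*ga" and "T1 \<equiv> - m*al - n*de - m*ga - n*be" and "T2 \<equiv> (2-m)*al - n*be" and "T3 \<equiv> (2-n)*de - m*ga"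
  assumes nz: "(d*(m+n-2))*(d*m)*(d*n) \<noteq> 0"
  shows "64*((d*(m+n-2))*(d*m)*(d*n))*(nf_disc al be ga de m n)^2
     - 16*twin_sum T1 T2 T3 (d*(m+n-2)) (d*m) (d*n)*nf_disc al be ga de m n
     + twin_prod T1 T2 T3 (d*(m+n-2)) (d*m) (d*n) = 0" (is "?X = 0")
proof -
  note eq = nf_disc_eq[where al = al and be = be and ga = ga and de = de and m = m and n = n, folded d_def T1_def T2_def T3_def]
  have "(d*(m+n-2))*(d*m)*(d*n) * ?X = 0"
    using eq twin_prod_eq[of "d*(m+n-2)" "d*m" "d*n" T1 T2 T3] by algebra
  with nz show ?thesis by simp
qed

lemma twin_quadratic:
  fixes al be ga de m n :: complex
  defines "d \<equiv> al*de - be*ga"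
  defines "X \<equiv> \<lambda>m n. 64*((d*(m+n-2))*(d*m)*(d*n))*(nf_disc al be ga de m n)^2
     - 16*twin_sum (- m*al - n*de - m*ga - n*be) ((2-m)*al - n*be) ((2-n)*de - m*ga)
         (d*(m+n-2)) (d*m) (d*n)*nf_disc al be ga de m n
     + twin_prod (- m*al - n*de - m*ga - n*be) ((2-m)*al - n*be) ((2-n)*de - m*ga) (d*(m+n-2)) (d*m) (d*n)"
  assumes d: "d \<noteq> 0"
  shows "X m n = 0"
proof -
  have "((\<lambda>s. X (m + s) (n + 2 * s)) \<longlongrightarrow> X (m + 0) (n + 2*0)) (at 0)"
    unfolding X_def nf_disc_def cubic_disc_def twin_sum_def twin_sum_lead_def
      twin_sum_rest_def twin_prod_def twin_prod_lead_def twin_diff_def heron_def Let_def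
    by (intro tendsto_intros)
  \<comment> \<open>When \<open>(m, n)\<close> moves in the direction \<open>(1, 2)\<close>, the
    factors \<open>m\<close>, \<open>n\<close> and \<open>m+n-2\<close> have the slopes 1, 2 and 3,
    so each of them vanishes for one value of \<open>s\<close> only. The matrix, and with it
    \<open>d\<close>, stays fixed.\<close>
  moreover have "eventually (\<lambda>s. X (m + s) (n + 2 * s) = 0) (at 0)"
    using eventually_neq_at_within[of "- m"] eventually_neq_at_within[of "- n / 2"]
      eventually_neq_at_within[of "(2 - m - n) / 3"]
  proof eventually_elim
    case (elim s)
    have "m + s \<noteq> 0" "n + 2 * s \<noteq> 0" "(m + s) + (n + 2 * s) - 2 \<noteq> 0"
    proof -
      have "s = (m + s) - m" "s = ((n + 2 * s) - n) / 2" "s = (((m + s) + (n + 2 * s) - 2) + (2 - m - n)) / 3"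
        by simp_all
      with elim show "m + s \<noteq> 0" "n + 2 * s \<noteq> 0" "(m + s) + (n + 2 * s) - 2 \<noteq> 0"
        by (metis diff_0, metis diff_0, metis add_0)
    qed
    then have "(d*((m+s)+(n + 2 * s)-2))*(d*(m+s))*(d*(n + 2 * s)) \<noteq> 0" using d by simp
    then show ?case unfolding X_def d_def by (rule twin_quadratic_generic)
  qed
  ultimately have "((\<lambda>s. 0) \<longlongrightarrow> X (m + 0) (n + 2*0)) (at (0::complex))"
    by (rule Lim_transform_eventually)
  then have "0 = X (m + 0) (n + 2*0)" by (rule LIM_const_eq)
  then show ?thesis by simp
qed

lemma normal_form_relation_value:
  assumes nf: "normal_form v al be ga de m n" and rep: "infinity_rep v l c u"
    and d: "d = al*de - be*ga" "d \<noteq> 0"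
  shows "relation_value (- m*al - n*de - m*ga - n*be) ((2-m)*al - n*be) ((2-n)*de - m*ga)
     (d*(m+n-2)) (d*m) (d*n) (d^2*(m*n-1)) (l$1*l$2*l$3) = 0"
proof -
  define D L where "D = nf_disc al be ga de m n" and "L = l$1*l$2*l$3"
  have D: "D \<noteq> 0" and LD: "L*D = d^2*(m*n-1)"
    using normal_form_infinity(1,2)[OF nf rep] d by (simp_all add: D_def L_def)
  define s p e where "s = twin_sum (- m*al - n*de - m*ga - n*be) ((2-m)*al - n*be) ((2-n)*de - m*ga) (d*(m+n-2)) (d*m) (d*n)"
    and "p = twin_prod (- m*al - n*de - m*ga - n*be) ((2-m)*al - n*be) ((2-n)*de - m*ga) (d*(m+n-2)) (d*m) (d*n)"
    and "e = d^2*(m*n-1)"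
  have "64*((d*(m+n-2))*(d*m)*(d*n))*D^2 - 16 * s*D + p = 0"
    unfolding D_def s_def p_def d(1) by (rule twin_quadratic) (use d in simp)
  then have "D^2*(p*L^2 + (- 16*e * s)*L + 64*(d*(m+n-2))*(d*m)*(d*n)*e^2) = 0"
    using LD[folded e_def] by algebra
  then show ?thesis using D unfolding relation_value_def s_def p_def e_def L_def by simp
qed

section \<open>Reduction to the normal form\<close>

lemma vf_at_affine_coeffs:
  assumes "quadratic v"
  obtains c0 c1 c2 p q r :: "complex ^ 2" where
    "\<And>x y i. vf_at v (z + x *s e + y *s f)$i = c0$i + x*c1$i + y*c2$i
      + x^2*p$i + x*y*q$i + y^2*r$i"
proof -
  obtain k0 k1 k2 p q r where "has_coeffs v k0 k1 k2 p q r" by (rule quadratic_coeffs[OF assms])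
  note k = has_coeffsD(1)[OF this]
  let ?d = "\<lambda>e i. e$1*k1$i + e$2*k2$i + 2*z$1*e$1*p$i
    + (z$1*e$2 + z$2*e$1)*q$i + 2*z$2*e$2*r$i"
  let ?q = "\<lambda>e i. (e$1)^2*p$i + e$1*e$2*q$i + (e$2)^2*r$i"
  show ?thesis
    by (rule that[of "vf_at v z" "\<chi> i. ?d e i" "\<chi> i. ?d f i" "\<chi> i. ?q e i"
          "\<chi> i. 2*e$1*f$1*p$i + (e$1*f$2 + e$2*f$1)*q$i + 2*e$2*f$2*r$i"
          "\<chi> i. ?q f i"])
       (simp add: k power2_eq_square algebra_simps)
qed

lemma infinite_complex_param:
  fixes f :: "complex \<Rightarrow> 'a"
  assumes "inj f" "\<And>x. f x \<in> S"
  shows "infinite S"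
proof
  assume "finite S"
  then have "finite (range f)" using assms(2) by (auto intro: finite_subset)
  then show False using assms(1) infinite_UNIV_char_0[where 'a = complex] by (metis finite_imageD)
qed

text \<open>On a line both components are quadratic polynomials; with three roots they vanish on the
  whole line, which then consists of singularities.\<close>

lemma no_three_collinear:
  assumes v: "quadratic v" and fin: "finite (singularities v)" and e: "e \<noteq> 0" and s: "s \<noteq> 0" "s \<noteq> 1"
    and sing: "vf_at v z = 0" "vf_at v (z + e) = 0" "vf_at v (z + s *s e) = 0"
  shows False
proof -
  obtain c0 c1 c2 p q r :: "complex ^ 2" where c:
    "\<And>x y i. vf_at v (z + x *s e + y *s 0)$i = c0$i + x*c1$i + y*c2$i
      + x^2*p$i + x*y*q$i + y^2*r$i"
    using vf_at_affine_coeffs[OF v, of z e 0] by metis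
  have line: "vf_at v (z + x *s e)$i = c0$i + c1$i*x + p$i*x^2" for x i
    using c[of x 0 i] by (simp add: mult.commute)
  have "c0$i = 0" "c1$i = 0" "p$i = 0" for i
    using quadratic_three_roots[of "c0$i" "c1$i" 0 "p$i" 1 s] s
      line[of 0 i] line[of 1 i] line[of s i] sing by auto
  then have zero: "z + x *s e \<in> singularities v" for x by (simp add: singularities_def vec_eq_iff line)
  have "inj (\<lambda>x. z + x *s e)"
    using e by (auto intro!: injI simp: vec_eq_iff)
  from infinite_complex_param[OF this zero] fin show False by contradiction
qed

lemma wedge_decompose:
  assumes "wedge e f \<noteq> 0"
  obtains x y where "z = x *s e + y *s f"
proof -
  define w where "w = wedge e f"
  have w: "w \<noteq> 0" "w = e$1*f$2 - e$2*f$1" using assms by (simp_all add: w_def wedge_def)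
  have "w*z$1 = wedge z f*e$1 + wedge e z*f$1" "w*z$2 = wedge z f*e$2 + wedge e z*f$2"
    unfolding w(2) wedge_def by algebra+
  then have "z = (wedge z f / w) *s e + (wedge e z / w) *s f"
    using w(1) by (simp add: vec_eq_iff forall_2 field_simps)
  then show ?thesis by (rule that)
qed

lemma dependent_common_multiple:
  assumes "wedge c d = 0"
  obtains h x y where "c = x *s h" "d = y *s h"
proof (cases "c = 0")
  case True
  then show ?thesis using that[of 0 d 1] by simp
next
  case False
  show ?thesis
  proof (cases "c$1 = 0")
    case True
    with False have "c$2 \<noteq> 0" by (simp add: vec_eq_iff forall_2)
    with assms True show ?thesis using that[of 1 c "d$2 / c$2"]
      by (auto simp: vec_eq_iff forall_2 wedge_def)
  next
    case False
    with assms show ?thesis using that[of 1 c "d$1 / c$1"]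
      by (auto simp: vec_eq_iff forall_2 wedge_def field_simps)
  qed
qed

lemma quadratic_root_exists:
  fixes a b c :: complex
  assumes "c \<noteq> 0"
  obtains y where "a + b*y + c*y^2 = 0"
proof -
  have "\<not> constant (poly [:a, b, c:])" using assms by (simp add: constant_degree)
  then obtain y where "poly [:a, b, c:] y = 0" using fundamental_theorem_of_algebra by blast
  then show ?thesis using that[of y] by (simp add: power2_eq_square algebra_simps)
qed

lemma four_points_normal_form:
  assumes v: "quadratic v" and fin: "finite (singularities v)"
    and p: "{p1, p2, p3, p4} \<subseteq> singularities v" "distinct [p1, p2, p3, p4]"
  obtains B v' al be ga de m n where
    "invertible (B :: complex ^ 2 ^ 2)" "normal_form v' al be ga de m n" "al*de - be*ga \<noteq> 0"
    "\<And>z. vf_at v (p1 + B *v z) = B *v vf_at v' z"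
    "p2 = p1 + B *v vector [1, 0]" "p3 = p1 + B *v vector [0, 1]"
proof -
  have sing: "vf_at v p1 = 0" "vf_at v p2 = 0" "vf_at v p3 = 0" "vf_at v p4 = 0"
    using p by (auto simp: singularities_def)
  define e f where "e = p2 - p1" and "f = p3 - p1"
  have ef: "e \<noteq> 0" "f \<noteq> 0" "e \<noteq> f" using p by (auto simp: e_def f_def)
  have p23: "p2 = p1 + e" "p3 = p1 + f" by (simp_all add: e_def f_def)
  have w: "wedge e f \<noteq> 0"
  proof
    assume "wedge e f = 0"
    then obtain h x y where h: "e = x *s h" "f = y *s h" by (rule dependent_common_multiple)
    have "x \<noteq> 0" using h ef by auto
    have f: "f = (y / x) *s e" using \<open>x \<noteq> 0\<close> by (simp add: h)
    have "y / x \<noteq> 0" "y / x \<noteq> 1" using f ef by auto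
    from no_three_collinear[OF v fin ef(1) this sing(1)] sing(2,3) f show False by (simp add: p23)
  qed
  obtain a b where "p4 - p1 = a *s e + b *s f" using wedge_decompose[OF w] by blast
  then have p4: "p4 = p1 + a *s e + b *s f" by (simp add: algebra_simps)
  have ab: "a \<noteq> 0" "b \<noteq> 0"
  proof -
    show "b \<noteq> 0"
    proof
      assume "b = 0"
      then have "a \<noteq> 0" "a \<noteq> 1" using p p4 p23 by auto
      from no_three_collinear[OF v fin ef(1) this sing(1)] sing p4 \<open>b = 0\<close> show False by (simp add: p23)
    qed
    show "a \<noteq> 0"
    proof
      assume "a = 0"
      then have "b \<noteq> 0" "b \<noteq> 1" using p p4 p23 by auto
      from no_three_collinear[OF v fin ef(2) this sing(1)] sing p4 \<open>a = 0\<close> show False by (simp add: p23)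
    qed
  qed
  obtain c0 c1 c2 p q r :: "complex ^ 2" where c:
    "\<And>x y i. vf_at v (p1 + x *s e + y *s f)$i = c0$i + x*c1$i + y*c2$i
      + x^2*p$i + x*y*q$i + y^2*r$i"
    using vf_at_affine_coeffs[OF v, of p1 e f] by metis
  \<comment> \<open>Chosen so that the conics \<open>x - x^2 - m*x*y\<close> and
    \<open>y - y^2 - n*x*y\<close> pass through the fourth point \<open>(a, b)\<close>.\<close>
  define m n where "m = (1 - a) / b" and "n = (1 - b) / a"
  have c0: "c0$i = 0" for i using c[of 0 0 i] sing by simp
  have cp: "p$i = - c1$i" for i using c[of 1 0 i] sing by (simp add: p23 c0 eq_neg_iff_add_eq_0 add.commute)
  have cr: "r$i = - c2$i" for i using c[of 0 1 i] sing by (simp add: p23 c0 eq_neg_iff_add_eq_0 add.commute)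
  have cq: "q$i = - m*c1$i - n*c2$i" for i
  proof -
    have "0 + a*c1$i + b*c2$i + a^2*(- c1$i) + a*b*q$i + b^2*(- c2$i) = 0"
      using c[of a b i] sing(4) unfolding p4 c0 cp cr by simp
    then have "a*b*q$i = - a*(1 - a)*c1$i - b*(1 - b)*c2$i"
      by algebra
    also have "\<dots> = a*b*(- m*c1$i - n*c2$i)"
      using ab by (simp add: m_def n_def field_simps)
    finally show ?thesis using ab by simp
  qed
  have vf: "vf_at v (p1 + x *s e + y *s f)$i = (x - x^2 - m*x*y)*c1$i + (y - y^2 - n*x*y)*c2$i" for x y i
    unfolding c c0 cp cr cq by (simp add: algebra_simps)
  obtain al ga where c1: "c1 = al *s e + ga *s f" using wedge_decompose[OF w] .
  obtain be de where c2: "c2 = be *s e + de *s f" using wedge_decompose[OF w] .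
  have inj: "x = x' \<and> y = y'" if "p1 + x *s e + y *s f = p1 + x' *s e + y' *s f" for x y x' y'
  proof -
    have 1: "x*e$1 + y*f$1 = x' * e$1 + y' * f$1" and 2: "x*e$2 + y*f$2 = x' * e$2 + y' * f$2"
      using that by (simp_all add: vec_eq_iff forall_2)
    have "(x - x')*wedge e f = 0" "(y - y')*wedge e f = 0"
      using 1 2 unfolding wedge_def by algebra+
    with w show ?thesis by simp
  qed
  \<comment> \<open>If \<open>c1\<close> and \<open>c2\<close> were dependent, both components would
    be multiples of a single conic. Its zero set is infinite: it contains a line for
    \<open>t = 0\<close>, and otherwise some point over every \<open>x\<close>.\<close>
  have "wedge c1 c2 \<noteq> 0"
  proof
    assume "wedge c1 c2 = 0"
    then obtain h s t where h: "c1 = s *s h" "c2 = t *s h" by (rule dependent_common_multiple)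
    have zero: "p1 + x *s e + y *s f \<in> singularities v"
      if "s*(x - x^2 - m*x*y) + t*(y - y^2 - n*x*y) = 0" for x y
    proof -
      have "vf_at v (p1 + x *s e + y *s f)$i = (s*(x - x^2 - m*x*y) + t*(y - y^2 - n*x*y))*h$i" for i
        unfolding vf h by (simp add: algebra_simps)
      with that show ?thesis by (simp add: singularities_def vec_eq_iff)
    qed
    show False
    proof (cases "t = 0")
      case True
      have "inj (\<lambda>y. p1 + 0 *s e + y *s f)" using inj by (intro injI) blast
      moreover have "p1 + 0 *s e + y *s f \<in> singularities v" for y by (rule zero) (simp add: True)
      ultimately have "infinite (singularities v)" by (rule infinite_complex_param)
      with fin show False by contradiction
    next
      case False
      have "\<exists>y. s*(x - x^2 - m*x*y) + t*(y - y^2 - n*x*y) = 0" for x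
      proof -
        obtain y where "s*(x - x^2) + (t - s*m*x - t*n*x)*y + (- t)*y^2 = 0"
          using quadratic_root_exists[of "- t"] False by auto
        then show ?thesis by (intro exI[of _ y]) (simp add: algebra_simps)
      qed
      then obtain Y where Y: "\<And>x. s*(x - x^2 - m*x*Y x) + t*(Y x - (Y x)^2 - n*x*Y x) = 0"
        by metis
      have "inj (\<lambda>x. p1 + x *s e + Y x *s f)" using inj by (intro injI) blast
      moreover have "p1 + x *s e + Y x *s f \<in> singularities v" for x by (rule zero) (rule Y)
      ultimately have "infinite (singularities v)" by (rule infinite_complex_param)
      with fin show False by contradiction
    qed
  qed
  moreover have "wedge c1 c2 = (al*de - be*ga)*wedge e f"
    unfolding c1 c2 wedge_def by (simp add: algebra_simps)
  ultimately have det: "al*de - be*ga \<noteq> 0" by auto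
  obtain v' where nf: "normal_form v' al be ga de m n" using normal_form_exists by blast
  define B :: "complex ^ 2 ^ 2" where "B = (\<chi> i j. if j = 1 then e$i else f$i)"
  have B: "B *v z = z$1 *s e + z$2 *s f" for z
    by (simp add: B_def vec_eq_iff matrix_vector_mult_def sum_2 algebra_simps)
  have "det B = wedge e f" by (simp add: det_2 B_def wedge_def algebra_simps)
  then have "invertible B" using w by (simp add: invertible_det_nz)
  moreover have "vf_at v (p1 + B *v z) = B *v vf_at v' z" for z
  proof -
    note nf' = normal_form_vf(2,3)[OF nf]
    have "vf_at v (p1 + z$1 *s e + z$2 *s f)$i = (vf_at v' z$1 *s e + vf_at v' z$2 *s f)$i" for i
      unfolding vf nf' c1 c2 by (simp add: algebra_simps)
    then show ?thesis unfolding B by (simp add: vec_eq_iff add.assoc)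
  qed
  moreover have "p2 = p1 + B *v vector [1, 0]" "p3 = p1 + B *v vector [0, 1]"
    by (simp_all add: B p23)
  ultimately show ?thesis using that[OF _ nf det] by blast
qed

lemma affine_change_jacobian:
  assumes v: "quadratic v" and v': "quadratic v'" and B: "invertible B"
    and eq: "\<And>z. vf_at v (p + B *v z) = B *v vf_at v' z"
  shows "trace (jacobian v (p + B *v z)) = trace (jacobian v' z)"
    "det (jacobian v (p + B *v z)) = det (jacobian v' z)"
proof -
  obtain C where C: "B ** C = mat 1" "C ** B = mat 1" using B unfolding invertible_def by blast
  have "2*(jacobian v (p + B *v z) *v (B *v h))$i = 2*(B *v (jacobian v' z *v h))$i" for h i
  proof -
    have sh: "p + B *v z + B *v h = p + B *v (z + h)" "p + B *v z - B *v h = p + B *v (z - h)"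
      by (simp_all add: matrix_vector_right_distrib matrix_vector_mult_diff_distrib)
    have "2*(jacobian v (p + B *v z) *v (B *v h))$i = (B *v (vf_at v' (z + h) - vf_at v' (z - h)))$i"
      unfolding jacobian_difference[OF v] sh eq by (simp add: matrix_vector_mult_diff_distrib)
    also have "\<dots> = (B *v (2 *s (jacobian v' z *v h)))$i"
    proof -
      have "vf_at v' (z + h) - vf_at v' (z - h) = 2 *s (jacobian v' z *v h)"
        by (simp add: vec_eq_iff jacobian_difference[OF v'])
      then show ?thesis by simp
    qed
    finally show ?thesis by (simp add: matrix_vector_mult_def sum_2 algebra_simps)
  qed
  then have "jacobian v (p + B *v z) *v (B *v h) = B *v (jacobian v' z *v h)" for h
    by (simp add: vec_eq_iff)
  then have J: "jacobian v (p + B *v z) ** B = B ** jacobian v' z"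
    by (simp add: matrix_eq matrix_vector_mul_assoc[symmetric])
  have J': "jacobian v (p + B *v z) = B ** (jacobian v' z ** C)"
  proof -
    have "jacobian v (p + B *v z) = jacobian v (p + B *v z) ** (B ** C)" by (simp add: C)
    also have "\<dots> = (jacobian v (p + B *v z) ** B) ** C" by (simp add: matrix_mul_assoc)
    also have "\<dots> = B ** (jacobian v' z ** C)" unfolding J by (simp add: matrix_mul_assoc)
    finally show ?thesis .
  qed
  have "trace (jacobian v (p + B *v z)) = trace ((jacobian v' z ** C) ** B)"
    unfolding J' by (rule trace_mul_sym)
  also have "\<dots> = trace (jacobian v' z)" by (simp add: C flip: matrix_mul_assoc)
  finally show "trace (jacobian v (p + B *v z)) = trace (jacobian v' z)" .
  have "det B*det C = 1" using C(1) det_mul[of B C] by (simp add: det_I)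
  then show "det (jacobian v (p + B *v z)) = det (jacobian v' z)"
    unfolding J' det_mul by (simp add: mult_ac)
qed

lemma R_eval_hidden_relation:
  "R_eval hidden_relation t d L =
     relation_value (t$2 + t$3) (t$1 + t$3) (t$1 + t$2) (d$2 + d$3) (d$1 + d$3) (d$1 + d$2)
       (d$1*d$2 + d$1*d$3 + d$2*d$3) L"
  by (simp add: R_eval_def peval_hidden_relation elem2_def)

lemma holds_on_spectra_hidden_relation: "holds_on_spectra hidden_relation"
  unfolding holds_on_spectra_def
proof (intro ballI allI impI)
  fix v t d l assume v: "v \<in> V2" and spec: "extended_spectrum v t d l"
  have quad: "quadratic v" and card: "card (singularities v) = 4" using v by (auto simp: V2_def)
  have fin: "finite (singularities v)" using card by (metis card.infinite zero_neq_numeral)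
  obtain p :: "4 \<Rightarrow> complex ^ 2" where p: "bij_betw p UNIV (singularities v)"
    and td: "\<And>k. t$k = trace (jacobian v (p k))" "\<And>k. d$k = det (jacobian v (p k))"
    and l: "char_numbers v l"
    using spec unfolding extended_spectrum_def by blast
  have inj: "p i = p j \<longleftrightarrow> i = j" for i j
    using p by (auto simp: bij_betw_def inj_on_def)
  have sing: "{p 1, p 2, p 3, p 4} \<subseteq> singularities v" using p by (auto simp: bij_betw_def)
  have dist: "distinct [p 1, p 2, p 3, p 4]" by (simp add: inj)
  obtain B v' al be ga de m n where B: "invertible (B :: complex ^ 2 ^ 2)"
    and nf: "normal_form v' al be ga de m n" and det: "al*de - be*ga \<noteq> 0"
    and eq: "\<And>z. vf_at v (p 1 + B *v z) = B *v vf_at v' z"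
    and p23: "p 2 = p 1 + B *v vector [1, 0]" "p 3 = p 1 + B *v vector [0, 1]"
    using four_points_normal_form[OF quad fin sing dist] by metis
  have quad': "quadratic v'" using nf by (simp add: normal_form_def)
  define D where "D = al*de - be*ga"
  have pts: "trace (jacobian v (p 1)) = trace (jacobian v' 0)" "det (jacobian v (p 1)) = det (jacobian v' 0)"
    "trace (jacobian v (p 2)) = trace (jacobian v' (vector [1, 0]))" "det (jacobian v (p 2)) = det (jacobian v' (vector [1, 0]))"
    "trace (jacobian v (p 3)) = trace (jacobian v' (vector [0, 1]))" "det (jacobian v (p 3)) = det (jacobian v' (vector [0, 1]))"
    using affine_change_jacobian[OF quad quad' B eq, of 0]
      affine_change_jacobian[OF quad quad' B eq, of "vector [1, 0]"]
      affine_change_jacobian[OF quad quad' B eq, of "vector [0, 1]"]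
    unfolding p23[symmetric] by simp_all
  have t: "t$1 = al + de" "t$2 = - al - ga*m + de*(1 - n)" "t$3 = al*(1 - m) - be*n - de"
    and d: "d$1 = D" "d$2 = D*(n - 1)" "d$3 = D*(m - 1)"
    unfolding td pts normal_form_trace[OF nf] normal_form_det[OF nf] D_def by (simp_all add: algebra_simps)
  obtain c u where rep: "infinity_rep v l c u" using l unfolding char_numbers_iff[OF quad] by blast
  obtain C where C: "B ** C = mat 1" "C ** B = mat 1" using B unfolding invertible_def by blast
  have "invertible C" using C unfolding invertible_def by blast
  moreover have "quad_part v' (C *v z) = C *v quad_part v z" for z
  proof -
    have "C *v quad_part v (B *v (C *v z)) = quad_part v' (C *v z)"
      unfolding affine_change_quad_part[OF quad quad' eq] by (simp add: matrix_vector_mul_assoc C)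
    then show ?thesis by (simp add: matrix_vector_mul_assoc C)
  qed
  ultimately have "infinity_rep v' l (c / (det C)^2) (\<chi> j. C *v u$j)"
    using infinity_rep_map[OF rep] by blast
  from normal_form_relation_value[OF nf this refl det, folded D_def]
  have rv: "relation_value (- m*al - n*de - m*ga - n*be) ((2-m)*al - n*be) ((2-n)*de - m*ga)
     (D*(m+n-2)) (D*m) (D*n) (D^2*(m*n-1)) (l$1*l$2*l$3) = 0" .
  have e: "t$2 + t$3 = - m*al - n*de - m*ga - n*be" "t$1 + t$3 = (2-m)*al - n*be"
    "t$1 + t$2 = (2-n)*de - m*ga" "d$2 + d$3 = D*(m+n-2)" "d$1 + d$3 = D*m" "d$1 + d$2 = D*n"
    "d$1*d$2 + d$1*d$3 + d$2*d$3 = D^2*(m*n-1)"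
    unfolding t d by (simp_all add: power2_eq_square algebra_simps)
  have "(\<Prod>j\<in>UNIV. l$j) = l$1*l$2*l$3"
    unfolding UNIV_3 by (simp add: mult.assoc)
  then show "R_eval hidden_relation t d (\<Prod>j\<in>UNIV. l$j) = 0"
    unfolding R_eval_hidden_relation e using rv by simp
qed

section \<open>Realization of spectra\<close>

lemma quadratic_form_three_roots:
  fixes p0 p1 p2 :: complex
  assumes r: "p0*a1^2 + p1*a1*b1 + p2*b1^2 = 0" "p0*a2^2 + p1*a2*b2 + p2*b2^2 = 0" "p0*a3^2 + p1*a3*b3 + p2*b3^2 = 0"
    and w: "a1*b2-b1*a2 \<noteq> 0" "a1*b3-b1*a3 \<noteq> 0" "a2*b3-b2*a3 \<noteq> 0"
  shows "p0 = 0" "p1 = 0" "p2 = 0"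
proof -
  let ?w = "(a1*b2-b1*a2)*(a1*b3-b1*a3)*(a2*b3-b2*a3)"
  have "p0 * ?w = 0" "p1 * ?w = 0" "p2 * ?w = 0" using r by algebra+
  with w show "p0 = 0" "p1 = 0" "p2 = 0" by simp_all
qed

lemma eigen_multiple:
  fixes a b x y :: complex
  assumes "b*x - a*y = 0" "a \<noteq> 0 \<or> b \<noteq> 0"
  obtains k where "x = k*a" "y = k*b"
proof (cases "a = 0")
  case True
  with assms show ?thesis using that[of "y / b"] by auto
next
  case False
  with assms show ?thesis using that[of "x / a"] by (auto simp: field_simps)
qed

text \<open>At a zero of the cubic form the quadratic part is parallel to its argument. The three
  factors of proportionality give the characteristic numbers, and two quadratic forms that agree in
  three directions are equal.\<close>

lemma infinity_rep_of_factorization: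
  assumes P: "\<And>z. quad_part v z$1 = p0*(z$1)^2 + p1*z$1*z$2 + p2*(z$2)^2"
    and Q: "\<And>z. quad_part v z$2 = q0*(z$1)^2 + q1*z$1*z$2 + q2*(z$2)^2"
    and g: "- q0 = - c*b1*b2*b3" "p0 - q1 = c*(a1*b2*b3 + b1*a2*b3 + b1*b2*a3)"
      "p1 - q2 = - c*(b1*a2*a3 + a1*b2*a3 + a1*a2*b3)" "p2 = c*a1*a2*a3"
    and disc: "cubic_disc (- q0) (p0 - q1) (p1 - q2) p2 \<noteq> 0"
  shows "\<exists>l c u. infinity_rep v l c u"
proof -
  define w12 w13 w23 where w: "w12 = a1*b2-b1*a2" "w13 = a1*b3-b1*a3" "w23 = a2*b3-b2*a3"
  have "c^4*(w12*w13*w23)^2 \<noteq> 0"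
    using disc unfolding g cubic_disc_product w .
  then have nz: "c \<noteq> 0" "w12 \<noteq> 0" "w13 \<noteq> 0" "w23 \<noteq> 0" by auto
  have form: "b*(p0*a^2 + p1*a*b + p2*b^2) - a*(q0*a^2 + q1*a*b + q2*b^2)
      = c*(a1*b - b1*a)*(a2*b - b2*a)*(a3*b - b3*a)" for a b
    using g by algebra
  obtain k1 where k1: "p0*a1^2 + p1*a1*b1 + p2*b1^2 = k1*a1" "q0*a1^2 + q1*a1*b1 + q2*b1^2 = k1*b1"
    by (rule eigen_multiple[of b1 _ a1]) (use form[of b1 a1] nz in \<open>auto simp: w\<close>)
  obtain k2 where k2: "p0*a2^2 + p1*a2*b2 + p2*b2^2 = k2*a2" "q0*a2^2 + q1*a2*b2 + q2*b2^2 = k2*b2"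
    by (rule eigen_multiple[of b2 _ a2]) (use form[of b2 a2] nz in \<open>auto simp: w\<close>)
  obtain k3 where k3: "p0*a3^2 + p1*a3*b3 + p2*b3^2 = k3*a3" "q0*a3^2 + q1*a3*b3 + q2*b3^2 = k3*b3"
    by (rule eigen_multiple[of b3 _ a3]) (use form[of b3 a3] nz in \<open>auto simp: w\<close>)
  \<comment> \<open>Solved from the representation at \<open>u$1\<close>, \<open>u$2\<close>,
    \<open>u$3\<close>, where only one summand survives. The minus sign stems from
    \<open>wedge (u$3) (u$2) = - w23\<close>.\<close>
  define l1 l2 l3 where "l1 = k1 / (c*w12*w13)" and "l2 = - k2 / (c*w12*w23)" and "l3 = k3 / (c*w13*w23)"
  have k: "k1 = c*l1*w12*w13" "k2 = - c*l2*w12*w23" "k3 = c*l3*w13*w23"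
    using nz by (simp_all add: l1_def l2_def l3_def)
  define P0 P1 P2 where p_defs: "P0 = p0 - c*(l1*b2*b3*a1 + l2*b1*b3*a2 + l3*b1*b2*a3)"
    "P1 = p1 - - c*(l1*(a2*b3+a3*b2)*a1 + l2*(a1*b3+a3*b1)*a2 + l3*(a1*b2+a2*b1)*a3)"
    "P2 = p2 - c*(l1*a2*a3*a1 + l2*a1*a3*a2 + l3*a1*a2*a3)"
  have pr1: "P0*a1^2 + P1*a1*b1 + P2*b1^2 = 0"
    using k1(1) unfolding k w p_defs by algebra
  have pr2: "P0*a2^2 + P1*a2*b2 + P2*b2^2 = 0"
    using k2(1) unfolding k w p_defs by algebra
  have pr3: "P0*a3^2 + P1*a3*b3 + P2*b3^2 = 0"
    using k3(1) unfolding k w p_defs by algebra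
  note p = quadratic_form_three_roots[OF pr1 pr2 pr3 nz(2-4)[unfolded w], unfolded p_defs]
  define Q0 Q1 Q2 where q_defs: "Q0 = q0 - c*(l1*b2*b3*b1 + l2*b1*b3*b2 + l3*b1*b2*b3)"
    "Q1 = q1 - - c*(l1*(a2*b3+a3*b2)*b1 + l2*(a1*b3+a3*b1)*b2 + l3*(a1*b2+a2*b1)*b3)"
    "Q2 = q2 - c*(l1*a2*a3*b1 + l2*a1*a3*b2 + l3*a1*a2*b3)"
  have qr1: "Q0*a1^2 + Q1*a1*b1 + Q2*b1^2 = 0"
    using k1(2) unfolding k w q_defs by algebra
  have qr2: "Q0*a2^2 + Q1*a2*b2 + Q2*b2^2 = 0"
    using k2(2) unfolding k w q_defs by algebra
  have qr3: "Q0*a3^2 + Q1*a3*b3 + Q2*b3^2 = 0"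
    using k3(2) unfolding k w q_defs by algebra
  note q = quadratic_form_three_roots[OF qr1 qr2 qr3 nz(2-4)[unfolded w], unfolded q_defs]
  \<comment> \<open>The cubic form computed from the representation is \<open>l1 + l2 + l3\<close>
    times the given one, which has a nonzero coefficient.\<close>
  have "(l1 + l2 + l3 - 1)*(- q0) = 0" "(l1 + l2 + l3 - 1)*(p0 - q1) = 0"
    "(l1 + l2 + l3 - 1)*(p1 - q2) = 0" "(l1 + l2 + l3 - 1)*p2 = 0"
    using p q g by algebra+
  moreover have "- q0 \<noteq> 0 \<or> p0 - q1 \<noteq> 0 \<or> p1 - q2 \<noteq> 0 \<or> p2 \<noteq> 0"
    using disc by (auto simp: cubic_disc_def)
  ultimately have sum: "l1 + l2 + l3 = 1" by auto
  define L :: "complex ^ 3" where "L = vector [l1, l2, l3]"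
  define U :: "complex ^ 2 ^ 3" where "U = vector [vector [a1, b1], vector [a2, b2], vector [a3, b3]]"
  have L: "L$1 = l1" "L$2 = l2" "L$3 = l3" by (simp_all add: L_def)
  have U: "U$1$1 = a1" "U$2$1 = a2" "U$3$1 = a3" "U$1$2 = b1" "U$2$2 = b2" "U$3$2 = b3"
    by (simp_all add: U_def)
  have "quad_part v z$i = c*(L$1*wedge (U$2) z*wedge (U$3) z*U$1$i
      + L$2*wedge (U$1) z*wedge (U$3) z*U$2$i
      + L$3*wedge (U$1) z*wedge (U$2) z*U$3$i)" for z i
  proof (cases "i = 1")
    case True
    show ?thesis unfolding True P wedge_def L U using p by algebra
  next
    case False
    then have i: "i = 2" using exhaust_2[of i] by blast
    show ?thesis unfolding i Q wedge_def L U using q by algebra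
  qed
  then have "infinity_rep v L c U"
    unfolding infinity_rep_def using nz sum by (simp add: wedge_def L U w)
  then show ?thesis by blast
qed

lemma cubic_factors:
  fixes g0 g1 g2 g3 :: complex
  assumes "g3 \<noteq> 0"
  obtains W1 W2 W3 where "g2 = - g3*(W1 + W2 + W3)" "g1 = g3*(W1*W2 + W1*W3 + W2*W3)" "g0 = - g3*W1*W2*W3"
proof -
  have "\<not> constant (poly [:g0, g1, g2, g3:])" using assms by (simp add: constant_degree)
  then obtain W1 where W1: "poly [:g0, g1, g2, g3:] W1 = 0" using fundamental_theorem_of_algebra by blast
  \<comment> \<open>These are the coefficients of the quotient of the cubic by
    \<open>w - W1\<close>.\<close>
  have "\<not> constant (poly [:g1 + W1*g2 + W1^2*g3, g2 + W1*g3, g3:])" using assms by (simp add: constant_degree)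
  then obtain W2 where W2: "poly [:g1 + W1*g2 + W1^2*g3, g2 + W1*g3, g3:] W2 = 0"
    using fundamental_theorem_of_algebra by blast
  define W3 where "W3 = - g2 / g3 - W1 - W2"
  have g2: "g2 = - g3*(W1 + W2 + W3)" using assms by (simp add: W3_def field_simps)
  have g1: "g1 = g3*(W1*W2 + W1*W3 + W2*W3)" using W2 g2 by simp algebra
  have "g0 = - g3*W1*W2*W3" using W1 g1 g2 by simp algebra
  with g1 g2 show ?thesis using that by blast
qed

lemma infinity_rep_exists:
  assumes P: "\<And>z. quad_part v z$1 = p0*(z$1)^2 + p1*z$1*z$2 + p2*(z$2)^2"
    and Q: "\<And>z. quad_part v z$2 = q0*(z$1)^2 + q1*z$1*z$2 + q2*(z$2)^2"
    and disc: "cubic_disc (- q0) (p0 - q1) (p1 - q2) p2 \<noteq> 0"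
  shows "\<exists>l c u. infinity_rep v l c u"
proof (cases "p2 = 0")
  case False
  obtain W1 W2 W3 where "p1 - q2 = - p2*(W1 + W2 + W3)" "p0 - q1 = p2*(W1*W2 + W1*W3 + W2*W3)"
    "- q0 = - p2*W1*W2*W3"
    using cubic_factors[OF False, of "p1 - q2" "p0 - q1" "- q0"] by blast
  then show ?thesis
    by (intro infinity_rep_of_factorization[OF P Q _ _ _ _ disc, of p2 W1 W2 W3 1 1 1]) (simp_all add: algebra_simps)
next
  case True
  then have g2: "p1 - q2 \<noteq> 0" using disc by (auto simp: cubic_disc_def)
  obtain W2 where W2: "- q0 + (p0 - q1)*W2 + (p1 - q2)*W2^2 = 0"
    using quadratic_root_exists[OF g2] by blast
  define W3 where "W3 = - (p0 - q1) / (p1 - q2) - W2"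
  have "W2 + W3 = - (p0 - q1) / (p1 - q2)" by (simp add: W3_def)
  then have "(W2 + W3)*(p1 - q2) = - (p0 - q1)" using g2 by (simp only: nonzero_eq_divide_eq simp_thms)
  then have g1: "p0 - q1 = - (p1 - q2)*(W2 + W3)" by algebra
  have g0: "- q0 = (p1 - q2)*W2*W3" using W2 g1 by algebra
  \<comment> \<open>The vertical direction is a zero of the form, represented by
    \<open>a1 = 0\<close>, \<open>b1 = -1\<close>. It is simple, so a quadratic with nonzero leading
    coefficient \<open>p1 - q2\<close> remains.\<close>
  show ?thesis
    by (rule infinity_rep_of_factorization[OF P Q _ _ _ _ disc, of "p1 - q2" "- 1" W2 W3 0 1 1])
       (insert g0 g1 True, simp_all add: algebra_simps)
qed

lemma bij_3:
  fixes f :: "3 \<Rightarrow> 3"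
  assumes "f 1 \<noteq> f 2" "f 1 \<noteq> f 3" "f 2 \<noteq> f 3"
  shows "bij f"
proof -
  have "inj f"
  proof (rule injI)
    fix i j assume "f i = f j"
    with assms exhaust_3[of i] exhaust_3[of j] show "i = j" by auto
  qed
  then show ?thesis using finite_UNIV_inj_surj[of f] by (simp add: bij_def)
qed

text \<open>Both triples are the roots of one cubic. As roots may coincide, the bijection is built
  by splitting off one root at a time.\<close>

lemma same_symmetric_functions_permutation:
  fixes l k :: "complex ^ 3"
  assumes "l$1 + l$2 + l$3 = k$1 + k$2 + k$3"
    "l$1*l$2 + l$1*l$3 + l$2*l$3 = k$1*k$2 + k$1*k$3 + k$2*k$3"
    "l$1*l$2*l$3 = k$1*k$2*k$3"
  obtains f where "bij f" "l = (\<chi> j. k$f j)"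
proof -
  note thesisI = that
  define F :: "3 \<Rightarrow> 3 \<Rightarrow> 3 \<Rightarrow> 3 \<Rightarrow> 3" where "F a b c j = (if j = 1 then a else if j = 2 then b else c)" for a b c j
  have F: ?thesis if "l$1 = k$a" "l$2 = k$b" "l$3 = k$c" "a \<noteq> b" "a \<noteq> c" "b \<noteq> c" for a b c
  proof (rule thesisI)
    show "bij (F a b c)" using that(4-6) by (intro bij_3) (simp_all add: F_def)
    show "l = (\<chi> j. k$F a b c j)" using that(1-3) by (simp add: vec_eq_iff forall_3 F_def)
  qed
  have "(l$1 - k$1)*(l$1 - k$2)*(l$1 - k$3) = 0"
    using assms by algebra
  then consider "l$1 = k$1" | "l$1 = k$2" | "l$1 = k$3" by auto
  then show ?thesis
  proof cases
    case 1
    then have s: "l$3 = k$2 + k$3 - l$2" using assms by (simp add: algebra_simps)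
    have "(l$2 - k$2)*(l$2 - k$3) = 0" using assms(2) 1 s by algebra
    then show ?thesis using F[of 1 2 3] F[of 1 3 2] 1 s by auto
  next
    case 2
    then have s: "l$3 = k$1 + k$3 - l$2" using assms by (simp add: algebra_simps)
    have "(l$2 - k$1)*(l$2 - k$3) = 0" using assms(2) 2 s by algebra
    then show ?thesis using F[of 2 1 3] F[of 2 3 1] 2 s by auto
  next
    case 3
    then have s: "l$3 = k$1 + k$2 - l$2" using assms by (simp add: algebra_simps)
    have "(l$2 - k$1)*(l$2 - k$2) = 0" using assms(2) 3 s by algebra
    then show ?thesis using F[of 3 1 2] F[of 3 2 1] 3 s by auto
  qed
qed

text \<open>The relations solved for \<open>d$4\<close>, \<open>t$4\<close> and the second symmetric
  function of \<open>l\<close>. Given (CS), the sum over the characteristic numbers in (BB) is 7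
  plus the sum of the \<open>1 / l$j\<close>, so that the latter is \<open>9 - s\<close>, where
  \<open>s\<close> is the sum of the \<open>(t$k)^2 / d$k\<close>; the long bracket is
  \<open>e\<close> times \<open>s\<close>, with \<open>t$4\<close> and \<open>d$4\<close>
  eliminated.\<close>

lemma classical_relations_iff:
  fixes t d :: "complex ^ 4" and l :: "complex ^ 3"
  defines "e \<equiv> d$1*d$2 + d$1*d$3 + d$2*d$3"
  shows "classical_relations t d l \<longleftrightarrow>
    d$1 \<noteq> 0 \<and> d$2 \<noteq> 0 \<and> d$3 \<noteq> 0 \<and> l$1*l$2*l$3 \<noteq> 0 \<and> e \<noteq> 0 \<and>
    d$4*e = - (d$1*d$2*d$3) \<and>
    t$4*e = t$1*d$2*d$3 + t$2*d$1*d$3 + t$3*d$1*d$2 \<and>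
    l$1 + l$2 + l$3 = 1 \<and>
    e*(l$1*l$2 + l$1*l$3 + l$2*l$3) = l$1*l$2*l$3*(9*e
       - ((d$2 + d$3)*(t$1)^2 + (d$1 + d$3)*(t$2)^2 + (d$1 + d$2)*(t$3)^2
          - 2*d$3*t$1*t$2 - 2*d$2*t$1*t$3 - 2*d$1*t$2*t$3))"
    (is "_ \<longleftrightarrow> ?d \<and> ?d' \<and> ?d'' \<and> ?l \<and> e \<noteq> 0 \<and> ?ej1 \<and> ?ej2 \<and> ?cs \<and> ?bb")
proof (cases "(\<forall>k. d$k \<noteq> 0) \<and> (\<forall>j. l$j \<noteq> 0)")
  case False
  then have "\<not> classical_relations t d l" by (auto simp: classical_relations_def)
  moreover have "\<not> (?d \<and> ?d' \<and> ?d'' \<and> ?l \<and> e \<noteq> 0 \<and> ?ej1)"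
  proof
    assume *: "?d \<and> ?d' \<and> ?d'' \<and> ?l \<and> e \<noteq> 0 \<and> ?ej1"
    then have "d$4 \<noteq> 0" by auto
    with*have "d$k \<noteq> 0" for k using exhaust_4[of k] by auto
    moreover have "l$j \<noteq> 0" for j using*exhaust_3[of j] by auto
    ultimately show False using False by blast
  qed
  ultimately show ?thesis by blast
next
  case True
  then have dnz: "d$k \<noteq> 0" and lnz: "l$j \<noteq> 0" for k j by auto
  define r where "r k = 1 / d$k" for k
  define m where "m j = 1 / l$j" for j
  define s where "s = (t$1)^2*r 1 + (t$2)^2*r 2 + (t$3)^2*r 3 + (t$4)^2*r 4"
  have rd: "r k*d$k = 1" and ml: "m j*l$j = 1" for k j using dnz lnz by (simp_all add: r_def m_def)
  have nz: "d$1*d$2*d$3 \<noteq> 0" "l$1*l$2*l$3 \<noteq> 0" using dnz lnz by simp_all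
  have "d$4*e + d$1*d$2*d$3 = d$1*d$2*d$3*d$4*(r 1 + r 2 + r 3 + r 4)"
    unfolding e_def using rd[of 1] rd[of 2] rd[of 3] rd[of 4] by algebra
  then have ej1: "?ej1 \<longleftrightarrow> r 1 + r 2 + r 3 + r 4 = 0"
    using dnz by (simp add: eq_neg_iff_add_eq_0)
  have e: "e = - (d$1*d$2*d$3)*r 4" if "r 1 + r 2 + r 3 + r 4 = 0"
    unfolding e_def using that rd[of 1] rd[of 2] rd[of 3] by algebra
  have ej2: "?ej2 \<longleftrightarrow> t$1*r 1 + t$2*r 2 + t$3*r 3 + t$4*r 4 = 0" if "r 1 + r 2 + r 3 + r 4 = 0"
  proof -
    have "t$4*e - (t$1*d$2*d$3 + t$2*d$1*d$3 + t$3*d$1*d$2)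
        = - (d$1*d$2*d$3)*(t$1*r 1 + t$2*r 2 + t$3*r 3 + t$4*r 4)"
      unfolding e[OF that] using rd[of 1] rd[of 2] rd[of 3] by algebra
    then have "t$4*e - (t$1*d$2*d$3 + t$2*d$1*d$3 + t$3*d$1*d$2) = 0
        \<longleftrightarrow> t$1*r 1 + t$2*r 2 + t$3*r 3 + t$4*r 4 = 0"
      using dnz by simp
    then show ?thesis by (simp only: right_minus_eq)
  qed
  have es: "e * s = (d$2 + d$3)*(t$1)^2 + (d$1 + d$3)*(t$2)^2 + (d$1 + d$2)*(t$3)^2
          - 2*d$3*t$1*t$2 - 2*d$2*t$1*t$3 - 2*d$1*t$2*t$3"
    if "r 1 + r 2 + r 3 + r 4 = 0" "t$1*r 1 + t$2*r 2 + t$3*r 3 + t$4*r 4 = 0"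
  proof -
    have "e*((t$4)^2*r 4) = - (d$1*d$2*d$3)*(t$1*r 1 + t$2*r 2 + t$3*r 3)^2"
      unfolding e[OF that(1)] using that(2) by algebra
    then show ?thesis using rd[of 1] rd[of 2] rd[of 3] unfolding s_def e_def by algebra
  qed
  have mj: "(l$j + 1)^2 / l$j = l$j + 2 + m j" for j
  proof -
    have "(l$j + 1)^2 = l$j*(l$j + 2 + m j)" using ml[of j] by algebra
    then show ?thesis using lnz[of j] by simp
  qed
  have bb: "s + ((l$1 + 1)^2 / l$1 + (l$2 + 1)^2 / l$2 + (l$3 + 1)^2 / l$3) = 16 \<longleftrightarrow>
      l$1*l$2 + l$1*l$3 + l$2*l$3 = l$1*l$2*l$3*(9 - s)" if cs: ?cs
  proof -
    define Z where "Z = m 1 + m 2 + m 3 - (9 - s)"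
    have "s + ((l$1 + 1)^2 / l$1 + (l$2 + 1)^2 / l$2 + (l$3 + 1)^2 / l$3)
        = Z + (l$1 + l$2 + l$3) + 15"
      unfolding mj Z_def by (simp add: algebra_simps)
    then have 1: "s + ((l$1 + 1)^2 / l$1 + (l$2 + 1)^2 / l$2 + (l$3 + 1)^2 / l$3) = Z + 16"
      unfolding cs by simp
    have "l$1*l$2 + l$1*l$3 + l$2*l$3 - l$1*l$2*l$3*(9 - s) = l$1*l$2*l$3*Z"
      unfolding Z_def using ml[of 1] ml[of 2] ml[of 3] by algebra
    then have "l$1*l$2 + l$1*l$3 + l$2*l$3 - l$1*l$2*l$3*(9 - s) = 0 \<longleftrightarrow> Z = 0"
      using lnz by simp
    then show ?thesis unfolding 1 right_minus_eq by simp
  qed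
  have "classical_relations t d l \<longleftrightarrow> r 1 + r 2 + r 3 + r 4 = 0 \<and>
      t$1*r 1 + t$2*r 2 + t$3*r 3 + t$4*r 4 = 0 \<and>
      s + ((l$1 + 1)^2 / l$1 + (l$2 + 1)^2 / l$2 + (l$3 + 1)^2 / l$3) = 16 \<and> ?cs"
    unfolding classical_relations_def EJ1_def EJ2_def BB_def CS_def sum_4 sum_3
    using dnz lnz by (simp add: r_def s_def)
  also have "\<dots> \<longleftrightarrow> e \<noteq> 0 \<and> ?ej1 \<and> ?ej2 \<and> ?cs \<and> ?bb"
  proof (cases "r 1 + r 2 + r 3 + r 4 = 0 \<and> t$1*r 1 + t$2*r 2 + t$3*r 3 + t$4*r 4 = 0 \<and> ?cs")
    case True
    have "r 4 \<noteq> 0" using dnz by (simp add: r_def)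
    then have "e \<noteq> 0" using e True nz(1) by simp
    moreover have "?bb \<longleftrightarrow> e*(l$1*l$2 + l$1*l$3 + l$2*l$3) = e*(l$1*l$2*l$3*(9 - s))"
    proof -
      have es': "e * s = (d$2 + d$3)*(t$1)^2 + (d$1 + d$3)*(t$2)^2 + (d$1 + d$2)*(t$3)^2
          - 2*d$3*t$1*t$2 - 2*d$2*t$1*t$3 - 2*d$1*t$2*t$3"
        using True by (intro es) auto
      have "l$1*l$2*l$3*(9*e - e * s) = e*(l$1*l$2*l$3*(9 - s))" by algebra
      then show ?thesis unfolding es' by (simp only:)
    qed
    ultimately show ?thesis using True ej1 ej2 bb by simp
  next
    case False
    then show ?thesis using ej1 ej2 by blast
  qed
  finally show ?thesis using nz by simp
qed

lemmas classical_relationsD = classical_relations_iff[THEN iffD1, THEN conjunct2, THEN conjunct2, THEN conjunct2, THEN conjunct2]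
lemmas classical_relations_cleared = classical_relationsD[THEN conjunct1]
  classical_relationsD[THEN conjunct2, THEN conjunct1]
  classical_relationsD[THEN conjunct2, THEN conjunct2, THEN conjunct1]
  classical_relationsD[THEN conjunct2, THEN conjunct2, THEN conjunct2, THEN conjunct1]
  classical_relationsD[THEN conjunct2, THEN conjunct2, THEN conjunct2, THEN conjunct2]

text \<open>As the matrix is invertible, the singularities are the common zeros of the two conics,
  and each conic is a pair of lines.\<close>

lemma normal_form_singularities:
  assumes nf: "normal_form v al be ga de m n" and det: "al*de - be*ga \<noteq> 0"
    and mn: "m \<noteq> 1" "n \<noteq> 1" "m*n \<noteq> 1" 
    and ab: "a*(1 - m*n) = 1 - m" "b*(1 - m*n) = 1 - n"
  defines "p \<equiv> \<lambda>k::4. if k = 1 then 0 else if k = 2 then vector [1, 0] else if k = 3 then vector [0, 1] else vector [a, b]"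
  shows "bij_betw p UNIV (singularities v)"
proof -
  have lin: "a + m*b = 1" "b + n*a = 1"
  proof -
    have "(a + m*b)*(1 - m*n) = 1*(1 - m*n)" "(b + n*a)*(1 - m*n) = 1*(1 - m*n)" using ab by algebra+
    then show "a + m*b = 1" "b + n*a = 1" using mn by (simp_all only: mult_cancel_right) auto
  qed
  have ab_nz: "a \<noteq> 0" "b \<noteq> 0" using ab mn by auto
  note vf = normal_form_vf(2,3)[OF nf]
  have sing: "z \<in> singularities v \<longleftrightarrow> z$1*(1 - z$1 - m*z$2) = 0 \<and> z$2*(1 - z$2 - n*z$1) = 0" for z
  proof
    assume "z \<in> singularities v"
    then have 1: "vf_at v z$1 = 0" "vf_at v z$2 = 0" by (simp_all add: singularities_def)
    have "(al*de - be*ga)*(z$1*(1 - z$1 - m*z$2)) = 0" "(al*de - be*ga)*(z$2*(1 - z$2 - n*z$1)) = 0"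
      using 1 unfolding vf by algebra+
    with det show "z$1*(1 - z$1 - m*z$2) = 0 \<and> z$2*(1 - z$2 - n*z$1) = 0" by simp
  next
    assume "z$1*(1 - z$1 - m*z$2) = 0 \<and> z$2*(1 - z$2 - n*z$1) = 0"
    then have "vf_at v z$1 = 0" "vf_at v z$2 = 0" unfolding vf by algebra+
    then show "z \<in> singularities v" by (simp add: singularities_def vec_eq_iff forall_2)
  qed
  have "inj p"
  proof (rule injI)
    fix i j assume "p i = p j"
    then show "i = j"
      using exhaust_4[of i] exhaust_4[of j] ab_nz lin mn by (auto simp: p_def vec_eq_iff forall_2)
  qed
  moreover have "p k \<in> singularities v" for k
  proof -
    have "1 - a - m*b = 0" "1 - b - n*a = 0" using lin by algebra+
    then show ?thesis unfolding sing using exhaust_4[of k] by (auto simp: p_def)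
  qed
  moreover have "z \<in> range p" if "z \<in> singularities v" for z
  proof -
    have z: "z$1 = 0 \<or> 1 - z$1 - m*z$2 = 0" "z$2 = 0 \<or> 1 - z$2 - n*z$1 = 0"
      using that unfolding sing by auto
    have "z = p 1 \<or> z = p 2 \<or> z = p 3 \<or> z = p 4"
    proof (cases "z$1 = 0 \<or> z$2 = 0")
      case True
      with z show ?thesis by (auto simp: p_def vec_eq_iff forall_2)
    next
      case False
      with z have eq: "1 - z$1 - m*z$2 = 0" "1 - z$2 - n*z$1 = 0" by auto
      have "z$1*(1 - m*n) = a*(1 - m*n)" "z$2*(1 - m*n) = b*(1 - m*n)" using eq ab by algebra+
      with mn show ?thesis by (auto simp: p_def vec_eq_iff forall_2)
    qed
    then show ?thesis by blast
  qed
  ultimately show ?thesis by (auto simp: bij_betw_def)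
qed

lemma realize_normal_form:
  fixes t1 t2 t3 d1 d2 d3 e L :: complex
  defines "e \<equiv> d1*d2 + d1*d3 + d2*d3"
  assumes nz: "d1 \<noteq> 0" "(d2+d3)*(d1+d3)*(d1+d2) \<noteq> 0" "L \<noteq> 0" "e \<noteq> 0"
    and rv: "relation_value (t2+t3) (t1+t3) (t1+t2) (d2+d3) (d1+d3) (d1+d2) e L = 0"
  shows "\<exists>al be ga de m n. al*de - be*ga = d1 \<and> d2 = d1*(n-1) \<and> d3 = d1*(m-1) \<and>
     t1 = al + de \<and> t2 = - al - m*ga - (n-1)*de \<and> t3 = - (m-1)*al - n*be - de \<and>
     L*nf_disc al be ga de m n = e"
proof -
  define m n where "m = 1 + d3/d1" and "n = 1 + d2/d1"
  have d23: "d2 = d1*(n-1)" "d3 = d1*(m-1)" using nz by (simp_all add: m_def n_def)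
  have x: "d2+d3 = d1*(m+n-2)" "d1+d3 = d1*m" "d1+d2 = d1*n" unfolding d23 by (simp_all add: algebra_simps)
  have mn: "m+n-2 \<noteq> 0" "m \<noteq> 0" "n \<noteq> 0" using nz unfolding x by auto
  define T1 T2 T3 where "T1 = t2+t3" and "T2 = t1+t3" and "T3 = t1+t2"
  define X where "X = (d1*(m+n-2))*(d1*m)*(d1*n)"
  have X: "X \<noteq> 0" using nz mn by (simp add: X_def)
  define s p C E where "s = twin_sum T1 T2 T3 (d1*(m+n-2)) (d1*m) (d1*n)"
    and "p = twin_prod T1 T2 T3 (d1*(m+n-2)) (d1*m) (d1*n)"
    and "C = twin_diff T1 T2 T3 (d1*(m+n-2)) (d1*m) (d1*n)"
    and "E = twin_radicand T1 T2 T3 (d1*(m+n-2)) (d1*m) (d1*n)"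
  define D where "D = e / L"
  have LD: "L*D = e" and "D \<noteq> 0" using nz by (simp_all add: D_def)
  have "p*L^2 + (- 16*e * s)*L + 64*X*e^2 = 0"
    using rv unfolding x relation_value_def p_def s_def X_def T1_def T2_def T3_def by (simp add: mult.assoc)
  then have "L^2*(64*X*D^2 - 16 * s*D + p) = 0" using LD by algebra
  then have "64*X*D^2 - 16 * s*D + p = 0" using nz by simp
  moreover have "X*p = s^2 - C^2*E"
    unfolding X_def p_def s_def C_def E_def by (rule twin_prod_eq)
  \<comment> \<open>The relation after completing the square. It says that a root \<open>S\<close>
    of \<open>E\<close> with \<open>8*X*D = s - C*S\<close> exists: \<open>S\<close> is forced if
    \<open>C\<close> is nonzero, and any root will do if \<open>C = 0\<close>. The choice of
    \<open>S\<close> selects one of the twin fields.\<close>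
  ultimately have sq: "(s - 8*X*D)^2 = C^2*E" by algebra
  have "\<exists>S. S^2 = E \<and> 8*X*D = s - C*S"
  proof (cases "C = 0")
    case True
    then have "s - 8*X*D = 0" using sq by simp
    then show ?thesis using True by (intro exI[of _ "csqrt E"]) simp
  next
    case False
    then have "((s - 8*X*D) / C)^2 = E" using sq by (simp add: power_divide)
    then show ?thesis using False by (intro exI[of _ "(s - 8*X*D) / C"]) simp
  qed
  then obtain S where S: "S^2 = E" "8*X*D = s - C*S" by blast
  \<comment> \<open>The equation \<open>nf_root = S\<close> solved for \<open>al - de\<close>;
    together with the trace \<open>t1\<close> it yields the diagonal of the matrix.\<close>
  define q where "q = (S / d1 + (m+n-2)*(T2-T3) - m*T2 + n*T3) / (2*(m+n-2))"
  define al de where "al = (t1 + q) / 2" and "de = (t1 - q) / 2"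
  define be ga where "be = ((2-m)*al - T2) / n" and "ga = ((2-n)*de - T3) / m"
  have ad: "al + de = t1" "al - de = q" by (simp_all add: al_def de_def field_simps)
  have bg: "n*be = (2-m)*al - T2" "m*ga = (2-n)*de - T3" using mn by (simp_all add: be_def ga_def)
  have T2: "T2 = (2-m)*al - n*be" and T3: "T3 = (2-n)*de - m*ga" using bg by algebra+
  have "T2 + T3 - T1 = 2*(al + de)" unfolding ad T1_def T2_def T3_def by simp
  then have T1: "T1 = - m*al - n*de - m*ga - n*be" unfolding T2 T3 by algebra
  have "q*(2*(m+n-2)) = S / d1 + (m+n-2)*(T2-T3) - m*T2 + n*T3"
  proof -
    have "2*(m+n-2) \<noteq> 0" using mn(1) by (simp only: mult_eq_0_iff) simp
    then show ?thesis by (metis nonzero_eq_divide_eq q_def)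
  qed
  then have "S / d1 = 2*(m+n-2)*(al-de) - (m+n-2)*(T2-T3) + m*T2 - n*T3"
    unfolding ad by algebra
  moreover define R where "R = 2*(m+n-2)*(al-de) - (m+n-2)*(T2-T3) + m*T2 - n*T3"
  ultimately have "S / d1 = R" by simp
  then have SR: "S = d1*R" using nz(1) by (metis nonzero_divide_eq_eq mult.commute)
  \<comment> \<open>The determinant is not yet known to be \<open>d1\<close>. The square of
    \<open>R\<close> is expressed once through the actual determinant and once through
    \<open>d1\<close>, and comparison identifies the two.\<close>
  have "R^2 = heron ((m+n-2)*T1) (m*T2) (n*T3) - 8*(al*de-be*ga)*((m+n-2)*m*n)"
    unfolding R_def heron_def T1 T2 T3 by algebra
  moreover have "d1^2*R^2 = d1^2*(heron ((m+n-2)*T1) (m*T2) (n*T3) - 8*d1*((m+n-2)*m*n))"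
    using S(1) unfolding SR E_def twin_radicand_def heron_def by algebra
  then have "R^2 = heron ((m+n-2)*T1) (m*T2) (n*T3) - 8*d1*((m+n-2)*m*n)" using nz by simp
  ultimately have "(al*de-be*ga - d1)*((m+n-2)*m*n) = 0" by algebra
  then have det: "al*de - be*ga = d1" using mn by simp
  have root: "nf_root al be ga de m n = S"
    unfolding nf_root_def det SR R_def T2 T3 by simp
  have "8*X*nf_disc al be ga de m n = s - C*S"
    using nf_disc_eq(1)[where al = al and be = be and ga = ga and de = de and m = m and n = n]
    unfolding det root T1[symmetric] T2[symmetric] T3[symmetric] X_def s_def C_def .
  then have "8*X*nf_disc al be ga de m n = 8*X*D" unfolding S(2) .
  then have disc: "nf_disc al be ga de m n = D" using X by simp
  have "t1 = al + de" using ad by simp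
  moreover have "t3 = - (m-1)*al - n*be - de" using T2[unfolded T2_def] ad(1) by algebra
  moreover have "t2 = - al - m*ga - (n-1)*de" using T3[unfolded T3_def] ad(1) by algebra
  ultimately show ?thesis using det d23 disc LD by blast
qed

lemma realize:
  assumes rel: "classical_relations t d l" and H: "R_eval hidden_relation t d (\<Prod>j\<in>UNIV. l$j) = 0"
    and nz: "(d$2 + d$3)*(d$1 + d$3)*(d$1 + d$2) \<noteq> 0"
  shows "\<exists>v\<in>V2. extended_spectrum v t d l"
proof -
  define e where "e = d$1*d$2 + d$1*d$3 + d$2*d$3"
  define L where "L = l$1*l$2*l$3"
  have dnz: "d$k \<noteq> 0" and lnz: "l$j \<noteq> 0" for k j using rel by (auto simp: classical_relations_def)
  note cl = classical_relations_cleared[OF rel, folded e_def L_def]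
  have "(\<Prod>j\<in>UNIV. l$j) = L" unfolding UNIV_3 by (simp add: mult.assoc L_def)
  with H have rv: "relation_value (t$2 + t$3) (t$1 + t$3) (t$1 + t$2) (d$2 + d$3) (d$1 + d$3) (d$1 + d$2) e L = 0"
    by (simp add: R_eval_hidden_relation e_def)
  have L: "L \<noteq> 0" using lnz by (simp add: L_def)
  obtain al be ga de m n where det: "al*de - be*ga = d$1" and d23: "d$2 = d$1*(n-1)" "d$3 = d$1*(m-1)"
    and t: "t$1 = al + de" "t$2 = - al - m*ga - (n-1)*de" "t$3 = - (m-1)*al - n*be - de"
    and disc: "L*nf_disc al be ga de m n = e"
    using realize_normal_form[OF dnz nz L cl(1)[unfolded e_def] rv[unfolded e_def], folded e_def] by blast
  obtain v where nf: "normal_form v al be ga de m n" using normal_form_exists by blast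
  have quad: "quadratic v" using nf by (simp add: normal_form_def)
  have e: "e = (d$1)^2*(m*n-1)" unfolding e_def d23 by algebra
  have mn: "m \<noteq> 1" "n \<noteq> 1" "m*n \<noteq> 1" using dnz[of 2] dnz[of 3] cl(1) unfolding d23 e by auto
  have det_nz: "al*de - be*ga \<noteq> 0" using det dnz by simp
  define a b where "a = (1-m)/(1-m*n)" and "b = (1-n)/(1-m*n)"
  have ab: "a*(1-m*n) = 1-m" "b*(1-m*n) = 1-n" using mn by (simp_all add: a_def b_def)
  define p :: "4 \<Rightarrow> complex ^ 2" where
    "p = (\<lambda>k. if k = 1 then 0 else if k = 2 then vector [1, 0] else if k = 3 then vector [0, 1] else vector [a, b])"
  have bij: "bij_betw p UNIV (singularities v)"
    unfolding p_def by (rule normal_form_singularities[OF nf det_nz mn ab])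
  have lin: "a + m*b = 1" "b + n*a = 1"
  proof -
    have "(a + m*b)*(1 - m*n) = 1*(1 - m*n)" "(b + n*a)*(1 - m*n) = 1*(1 - m*n)" using ab by algebra+
    then show "a + m*b = 1" "b + n*a = 1" using mn by (simp_all only: mult_cancel_right) auto
  qed
  have mn1: "m*n - 1 \<noteq> 0" using mn by simp
  have d4: "d$4 = d$1*(a*b*(1 - m*n))"
  proof -
    have "(d$1)^2*(m*n-1)*d$4 = (d$1)^2*(m*n-1)*(d$1*(a*b*(1 - m*n)))"
      using cl(2) ab unfolding d23 e by algebra
    then show ?thesis using dnz mn1 by simp
  qed
  have t4: "t$4 = - al*a - be*n*b - ga*m*a - de*b"
  proof -
    have "(d$1)^2*(m*n-1)*t$4 = (d$1)^2*(m*n-1)*(- al*a - be*n*b - ga*m*a - de*b)"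
      using cl(3) ab unfolding t d23 e by algebra
    then show ?thesis using dnz mn1 by simp
  qed
  have tr: "t$k = trace (jacobian v (p k))" and dt: "d$k = det (jacobian v (p k))" for k
  proof -
    have A: "1 - 2*a - m*b = - a" "1 - 2*b - n*a = - b" using lin by algebra+
    show "t$k = trace (jacobian v (p k))"
      using exhaust_4[of k] unfolding normal_form_trace[OF nf]
      by (auto simp: p_def t t4 A) (simp_all add: algebra_simps)
    show "d$k = det (jacobian v (p k))"
      using exhaust_4[of k] unfolding normal_form_det[OF nf] det
      by (auto simp: p_def d23 d4 A) (simp_all add: algebra_simps)
  qed
  have ndisc: "nf_disc al be ga de m n \<noteq> 0" using disc cl(1) by auto
  have "\<exists>l' c u. infinity_rep v l' c u"
  proof (rule infinity_rep_exists[OF normal_form_quad_part[OF nf]])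
    have g: "- (- ga) = ga" "- al - (- ga*m - de*n) = m*ga + n*de - al" "- al*m - be*n - - de = de - m*al - n*be"
      by (simp_all add: algebra_simps)
    show "cubic_disc (- (- ga)) (- al - (- ga*m - de*n)) (- al*m - be*n - - de) (- be) \<noteq> 0"
      unfolding g using ndisc unfolding nf_disc_def .
  qed
  then obtain l' c u where rep: "infinity_rep v l' c u" by blast
  note inf = normal_form_infinity[OF nf rep]
  have "l'$1*l'$2*l'$3*nf_disc al be ga de m n = L*nf_disc al be ga de m n"
    unfolding inf(2) disc det e ..
  then have s3: "l'$1*l'$2*l'$3 = L" using ndisc by simp
  have s1: "l'$1 + l'$2 + l'$3 = 1" using rep by (simp add: infinity_rep_def)
  \<comment> \<open>The Baum-Bott relation for the constructed field. Compared with the one assumed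
    for \<open>l\<close>, it identifies the second symmetric functions.\<close>
  have "(l'$1*l'$2 + l'$1*l'$3 + l'$2*l'$3)*nf_disc al be ga de m n
      = 9*e - ((d$2 + d$3)*(t$1)^2 + (d$1 + d$3)*(t$2)^2 + (d$1 + d$2)*(t$3)^2
          - 2*d$3*t$1*t$2 - 2*d$2*t$1*t$3 - 2*d$1*t$2*t$3)"
    unfolding inf(3) t d23 e unfolding det[symmetric] by algebra
  then have "e*(l$1*l$2 + l$1*l$3 + l$2*l$3)
      = e*(l'$1*l'$2 + l'$1*l'$3 + l'$2*l'$3)"
    using cl(5) disc by algebra
  then have s2: "l$1*l$2 + l$1*l$3 + l$2*l$3 = l'$1*l'$2 + l'$1*l'$3 + l'$2*l'$3"
    using cl(1) by simp
  obtain f where f: "bij f" "l = (\<chi> j. l'$f j)"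
    using same_symmetric_functions_permutation[of l l'] s1 s2 s3 cl(4) L_def by metis
  have "char_numbers v l'" unfolding char_numbers_iff[OF quad] using rep by blast
  then have "char_numbers v l" unfolding f(2) by (rule char_numbers_permute[OF f(1)])
  then have "extended_spectrum v t d l"
    unfolding extended_spectrum_def using bij tr dt by blast
  moreover have "card (singularities v) = 4" using bij_betw_same_card[OF bij] by simp
  then have "v \<in> V2" unfolding V2_def using quad card_infinite_singularities_rep[OF rep] by simp
  ultimately show ?thesis by blast
qed

section \<open>Density of the spectra\<close>

text \<open>A root \<open>w\<close> with norm at least \<open>r\<close> satisfies
  \<open>norm (1 - w) <= (1 + 1/r)*norm w\<close>; the bound is the product of these over at most
  \<open>N\<close> roots.\<close>

lemma poly_bound_no_small_root:
  fixes p :: "complex poly"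
  assumes "degree p \<le> N" "r > 0" "\<And>z. norm z < r \<Longrightarrow> poly p z \<noteq> 0"
  shows "norm (poly p 1) \<le> (1 + 1 / r)^N*norm (poly p 0)"
  using assms(1,3)
proof (induction N arbitrary: p)
  case 0
  then obtain c where "p = [:c:]" by (metis degree_eq_zeroE le_zero_eq)
  then show ?case by simp
next
  case (Suc N)
  have pos: "1 + 1 / r \<ge> 1" using assms(2) by simp
  show ?case
  proof (cases "degree p = 0")
    case True
    then obtain c where "p = [:c:]" by (metis degree_eq_zeroE)
    moreover have "(1 + 1 / r)^Suc N \<ge> 1" using pos by (rule one_le_power)
    ultimately show ?thesis by (simp add: mult_le_cancel_right1 del: power_Suc)
  next
    case False
    then obtain w where "poly p w = 0"
      using fundamental_theorem_of_algebra[of p] by (auto simp: constant_degree)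
    then obtain q where p: "p = [:- w, 1:] * q" by (auto simp: poly_eq_0_iff_dvd)
    have "q \<noteq> 0" using False p by auto
    then have "degree p = Suc (degree q)" unfolding p by (subst degree_mult_eq) auto
    then have q: "norm (poly q 1) \<le> (1 + 1 / r)^N*norm (poly q 0)"
      using Suc.prems by (intro Suc.IH) (auto simp: p)
    have "norm w \<ge> r" using Suc.prems(2)[of w] p by (force simp: not_less)
    then have "1 \<le> norm w / r" using assms(2) by simp
    then have "norm (1 - w) \<le> (1 + 1 / r)*norm w"
      using norm_triangle_ineq4[of 1 w] by (simp add: distrib_right)
    then have "norm (1 - w)*norm (poly q 1) \<le> ((1 + 1 / r)*norm w)*((1 + 1 / r)^N*norm (poly q 0))"
      using q pos by (intro mult_mono) simp_all
    moreover have "norm (poly p 1) = norm (1 - w)*norm (poly q 1)" "norm (poly p 0) = norm w*norm (poly q 0)"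
      unfolding p poly_mult norm_mult by simp_all
    ultimately show ?thesis by (simp only: power_Suc mult_ac)
  qed
qed

text \<open>A prescribed small move along \<open>c\<close> is compensated by a small move along
  \<open>b\<close>. Otherwise the root-free bound would hold for all small nonzero \<open>x\<close>
  with one constant \<open>K\<close>, and the limit would give \<open>peval F\<close> at
  \<open>a + b\<close> norm at most \<open>K\<close> times its norm at \<open>a\<close>, which is
  zero.\<close>

lemma small_perturbed_root:
  fixes a b c :: "'x \<Rightarrow> complex"
  assumes zero: "peval F a = 0" and nonzero: "peval F (\<lambda>i. a i + b i) \<noteq> 0" and r: "r > 0"
  shows "\<exists>x y. 0 < norm x \<and> norm x < r \<and> norm y < r \<and> peval F (\<lambda>i. (a i + x*c i) + y*b i) = 0"
proof (rule ccontr)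
  assume none: "\<not> ?thesis"
  then have no: "peval F (\<lambda>i. (a i + x*c i) + y*b i) \<noteq> 0" if "0 < norm x" "norm x < r" "norm y < r" for x y
    using none that by blast
  obtain N where N: "\<And>a b. \<exists>p. degree p \<le> N \<and> (\<forall>s. poly p s = peval F (\<lambda>i. a i + s*b i))"
    using peval_line_poly[of F] by blast
  define K where "K = (1 + 1 / r)^N"
  have "norm (peval F (\<lambda>i. (a i + x*c i) + 1*b i)) \<le> K*norm (peval F (\<lambda>i. (a i + x*c i) + 0*b i))"
    if x: "0 < norm x" "norm x < r" for x
  proof -
    obtain p where p: "degree p \<le> N" "\<And>s. poly p s = peval F (\<lambda>i. (a i + x*c i) + s*b i)"
      using N[of "\<lambda>i. a i + x*c i" b] by blast
    show ?thesis unfolding p(2)[symmetric] K_def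
      using p(1) r by (rule poly_bound_no_small_root) (use no x p(2) in auto)
  qed
  then have ev: "eventually (\<lambda>x. norm (peval F (\<lambda>i. (a i + x*c i) + b i)) \<le> K*norm (peval F (\<lambda>i. a i + x*c i))) (at 0)"
    unfolding eventually_at using r by (intro exI[of _ r]) (auto simp: dist_norm)
  have "((\<lambda>x. norm (peval F (\<lambda>i. (a i + x*c i) + b i))) \<longlongrightarrow> norm (peval F (\<lambda>i. (a i + 0*c i) + b i))) (at 0)"
    by (intro tendsto_norm tendsto_peval tendsto_intros)
  moreover have "((\<lambda>x. K*norm (peval F (\<lambda>i. a i + x*c i))) \<longlongrightarrow> K*norm (peval F (\<lambda>i. a i + 0*c i))) (at 0)"
    by (intro tendsto_norm tendsto_peval tendsto_intros)
  ultimately have "norm (peval F (\<lambda>i. (a i + 0*c i) + b i)) \<le> K*norm (peval F (\<lambda>i. a i + 0*c i))"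
    using ev by (intro tendsto_le[of "at (0::complex)"]) simp_all
  with zero nonzero show False by simp
qed

text \<open>Only the linear coefficient of the cubic varies. For the root nearest to
  \<open>l1\<close>, the cube of the distance is at most the absolute value of the new cubic at
  \<open>l1\<close>, which tends to 0. The same argument for the remaining quadratic at
  \<open>l2\<close> gives the second root; the third one follows from the sum.\<close>

lemma cubic_roots_converge:
  fixes l1 l2 l3 L :: complex and s :: "nat \<Rightarrow> complex"
  assumes s: "s \<longlonglongrightarrow> l1*l2 + l1*l3 + l2*l3" and l: "l1 + l2 + l3 = 1" "l1*l2*l3 = L"
  obtains k1 k2 k3 where "k1 \<longlonglongrightarrow> l1" "k2 \<longlonglongrightarrow> l2" "k3 \<longlonglongrightarrow> l3"
    "\<And>n. k1 n + k2 n + k3 n = 1" "\<And>n. k1 n*k2 n + k1 n*k3 n + k2 n*k3 n = s n" "\<And>n. k1 n*k2 n*k3 n = L"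
proof -
  define q where "q w n = l2^2 - (1 - w)*l2 + s n - w*(1 - w)" for w n
  have "\<exists>w1 w2 w3. w1 + w2 + w3 = 1 \<and> w1*w2 + w1*w3 + w2*w3 = s n \<and> w1*w2*w3 = L \<and>
      norm (l1 - w1)^3 \<le> norm ((s n - (l1*l2 + l1*l3 + l2*l3))*l1) \<and> norm (l2 - w2)^2 \<le> norm (q w1 n)" for n
  proof -
    define good where "good w1 w2 w3 \<longleftrightarrow> w1 + w2 + w3 = 1 \<and> w1*w2 + w1*w3 + w2*w3 = s n \<and> w1*w2*w3 = L" for w1 w2 w3
    obtain w1 w2 w3 where w: "-1 = - 1*(w1 + w2 + w3)" "s n = 1*(w1*w2 + w1*w3 + w2*w3)" "- L = - 1*w1*w2*w3"
      using cubic_factors[of 1 "-1" "s n" "- L"] by (metis one_neq_zero)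
    have "w1 + w2 + w3 = 1" using w(1) by algebra
    moreover have "w1*w2*w3 = L" using w(3) by algebra
    ultimately have g: "good w1 w2 w3" using w(2) by (simp add: good_def)
    have "\<exists>w1 w2 w3. good w1 w2 w3 \<and> norm (l1 - w1) \<le> norm (l1 - w2) \<and> norm (l1 - w1) \<le> norm (l1 - w3)"
    proof -
      consider "norm (l1 - w1) \<le> norm (l1 - w2) \<and> norm (l1 - w1) \<le> norm (l1 - w3)"
        | "norm (l1 - w2) \<le> norm (l1 - w1) \<and> norm (l1 - w2) \<le> norm (l1 - w3)"
        | "norm (l1 - w3) \<le> norm (l1 - w1) \<and> norm (l1 - w3) \<le> norm (l1 - w2)" by linarith
      moreover have "good w2 w1 w3" "good w3 w1 w2" using g by (auto simp: good_def algebra_simps)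
      ultimately show ?thesis using g by metis
    qed
    then obtain w1 w2 w3 where g: "good w1 w2 w3"
      and le: "norm (l1 - w1) \<le> norm (l1 - w2)" "norm (l1 - w1) \<le> norm (l1 - w3)" by blast
    have "\<exists>w2' w3'. good w1 w2' w3' \<and> norm (l2 - w2') \<le> norm (l2 - w3')"
    proof (cases "norm (l2 - w2) \<le> norm (l2 - w3)")
      case True
      with g show ?thesis by blast
    next
      case False
      moreover have "good w1 w3 w2" using g by (auto simp: good_def algebra_simps)
      ultimately show ?thesis by (metis linear)
    qed
    then obtain v2 v3 where g': "good w1 v2 v3" and le': "norm (l2 - v2) \<le> norm (l2 - v3)" by blast
    have "norm (l1 - w1)^3 \<le> norm (l1 - w1)*norm (l1 - w2)*norm (l1 - w3)"
      unfolding power3_eq_cube by (intro mult_mono le) auto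
    also have "\<dots> = norm ((l1 - w1)*(l1 - w2)*(l1 - w3))" by (simp add: norm_mult)
    also have "(l1 - w1)*(l1 - w2)*(l1 - w3) = (s n - (l1*l2 + l1*l3 + l2*l3))*l1"
      using g l unfolding good_def by algebra
    finally have 1: "norm (l1 - w1)^3 \<le> norm ((s n - (l1*l2 + l1*l3 + l2*l3))*l1)" .
    have "norm (l2 - v2)^2 \<le> norm (l2 - v2)*norm (l2 - v3)"
      unfolding power2_eq_square by (intro mult_left_mono le') auto
    also have "\<dots> = norm ((l2 - v2)*(l2 - v3))" by (simp add: norm_mult)
    also have "(l2 - v2)*(l2 - v3) = q w1 n"
      using g' unfolding good_def q_def by algebra
    finally show ?thesis using 1 g' unfolding good_def by blast
  qed
  then obtain k1 k2 k3 where k: "\<And>n. k1 n + k2 n + k3 n = 1" "\<And>n. k1 n*k2 n + k1 n*k3 n + k2 n*k3 n = s n"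
    "\<And>n. k1 n*k2 n*k3 n = L"
    and b1: "\<And>n. norm (l1 - k1 n)^3 \<le> norm ((s n - (l1*l2 + l1*l3 + l2*l3))*l1)"
    and b2: "\<And>n. norm (l2 - k2 n)^2 \<le> norm (q (k1 n) n)"
    by metis
  have "(\<lambda>n. norm ((s n - (l1*l2 + l1*l3 + l2*l3))*l1)) \<longlonglongrightarrow> norm ((l1*l2 + l1*l3 + l2*l3 - (l1*l2 + l1*l3 + l2*l3))*l1)"
    by (intro tendsto_intros s)
  then have "(\<lambda>n. norm ((s n - (l1*l2 + l1*l3 + l2*l3))*l1)) \<longlonglongrightarrow> 0" by simp
  then have "(\<lambda>n. norm (l1 - k1 n)^3) \<longlonglongrightarrow> 0"
    by (rule tendsto_sandwich[OF _ _ tendsto_const, rotated 2]) (use b1 in auto)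
  then have "(\<lambda>n. norm (l1 - k1 n)) \<longlonglongrightarrow> 0" by (simp add: power_tendsto_0_iff)
  then have "(\<lambda>n. l1 - k1 n) \<longlonglongrightarrow> 0" by (rule tendsto_norm_zero_cancel)
  from tendsto_diff[OF tendsto_const[of l1] this] have 1: "k1 \<longlonglongrightarrow> l1" by simp
  have "(\<lambda>n. norm (q (k1 n) n)) \<longlonglongrightarrow> norm (l2^2 - (1 - l1)*l2 + (l1*l2 + l1*l3 + l2*l3) - l1*(1 - l1))"
    unfolding q_def by (intro tendsto_intros s 1)
  moreover have "l2^2 - (1 - l1)*l2 + (l1*l2 + l1*l3 + l2*l3) - l1*(1 - l1) = 0" using l(1) by algebra
  ultimately have "(\<lambda>n. norm (q (k1 n) n)) \<longlonglongrightarrow> 0" by simp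
  then have "(\<lambda>n. norm (l2 - k2 n)^2) \<longlonglongrightarrow> 0"
    by (rule tendsto_sandwich[OF _ _ tendsto_const, rotated 2]) (use b2 in auto)
  then have "(\<lambda>n. norm (l2 - k2 n)) \<longlonglongrightarrow> 0" by (simp add: power_tendsto_0_iff)
  then have "(\<lambda>n. l2 - k2 n) \<longlonglongrightarrow> 0" by (rule tendsto_norm_zero_cancel)
  from tendsto_diff[OF tendsto_const[of l2] this] have 2: "k2 \<longlonglongrightarrow> l2" by simp
  have "(\<lambda>n. 1 - k1 n - k2 n) \<longlonglongrightarrow> 1 - l1 - l2" by (intro tendsto_intros 1 2)
  moreover have "1 - k1 n - k2 n = k3 n" for n using k(1)[of n] by (simp add: algebra_simps)
  moreover have "1 - l1 - l2 = l3" using l(1) by (simp add: algebra_simps)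
  ultimately have 3: "k3 \<longlonglongrightarrow> l3" by simp
  show ?thesis using that[OF 1 2 3 k] .
qed

lemma td_from_sums:
  fixes T1 T2 T3 :: complex
  shows "(T1+T3-T2)/2 + (T1+T2-T3)/2 = T1" "(T2+T3-T1)/2 + (T1+T2-T3)/2 = T2" "(T2+T3-T1)/2 + (T1+T3-T2)/2 = T3"
  by (simp_all add: field_simps)

lemma spectra_dense:
  assumes rel: "classical_relations t d l" and H: "R_eval hidden_relation t d (\<Prod>j\<in>UNIV. l$j) = 0"
  obtains tn dn ln where "\<And>n :: nat. \<exists>v\<in>V2. extended_spectrum v (tn n) (dn n) (ln n)"
    "\<And>k. (\<lambda>n. tn n$k) \<longlonglongrightarrow> t$k" "\<And>k. (\<lambda>n. dn n$k) \<longlonglongrightarrow> d$k" "\<And>j. (\<lambda>n. ln n$j) \<longlonglongrightarrow> l$j"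
proof -
  define e where "e = (\<lambda>d :: complex ^ 4. d$1*d$2 + d$1*d$3 + d$2*d$3)"
  define L where "L = l$1*l$2*l$3"
  have dnz: "d$k \<noteq> 0" and lnz: "l$j \<noteq> 0" for k j using rel by (auto simp: classical_relations_def)
  note cl = classical_relations_cleared[OF rel, folded L_def]
  have prod: "(\<Prod>j\<in>UNIV. k$j) = k$1*k$2*k$3" for k :: "complex ^ 3"
    unfolding UNIV_3 by (simp add: mult.assoc)
  have L: "L \<noteq> 0" using lnz by (simp add: L_def)
  have e: "e d \<noteq> 0" using cl(1) by (simp add: e_def)
  define a where "a = case_rvar (($) t) (($) d) L"
  have a: "a (RT k) = t$k" "a (RD k) = d$k" "a RLambda = L" for k by (simp_all add: a_def)
  have Ha: "peval hidden_relation a = 0" using H by (simp add: R_eval_def a_def prod L_def)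
  have "d$2 + d$3 \<noteq> 0 \<or> d$1 + d$3 \<noteq> 0 \<or> d$1 + d$2 \<noteq> 0"
  proof (rule ccontr)
    assume "\<not> ?thesis"
    then have "2*d$1 = 0" by algebra
    with dnz[of 1] show False by simp
  qed
  then obtain T1 T2 T3 where T: "relation_value T1 T2 T3 (d$2 + d$3) (d$1 + d$3) (d$1 + d$2) (e d) L \<noteq> 0"
    using relation_value_nonzero L by blast
  \<comment> \<open>\<open>T1\<close>, \<open>T2\<close>, \<open>T3\<close> turned back into traces.
    Thus \<open>b\<close> leads to a point with the same \<open>d\<close> and \<open>L\<close> at
    which the polynomial does not vanish.\<close>
  define ts :: "4 \<Rightarrow> complex" where
    "ts k = (if k = 1 then (T2+T3-T1)/2 else if k = 2 then (T1+T3-T2)/2 else if k = 3 then (T1+T2-T3)/2 else t$k)" for k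
  define b :: "rvar \<Rightarrow> complex" where "b = case_rvar (\<lambda>k. ts k - t$k) (\<lambda>_. 0) 0"
  \<comment> \<open>The pairwise sums of these weights are nonzero, so along \<open>c\<close> all
    sums \<open>d$i + d$j\<close> become nonzero, including those that vanish at the start.\<close>
  define w :: "4 \<Rightarrow> complex" where "w k = (if k = 1 then 1 else if k = 2 then 2 else 4)" for k
  define c :: "rvar \<Rightarrow> complex" where "c = case_rvar (\<lambda>_. 0) w 0"
  have "peval hidden_relation (\<lambda>i. a i + b i) = relation_value T1 T2 T3 (d$2 + d$3) (d$1 + d$3) (d$1 + d$2) (e d) L"
    unfolding peval_hidden_relation elem2_def
    by (simp add: a b_def ts_def td_from_sums e_def)
  with T have nonzero: "peval hidden_relation (\<lambda>i. a i + b i) \<noteq> 0" by simp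
  have "\<exists>x y. 0 < norm x \<and> norm x < 1 / real (Suc n) \<and> norm y < 1 / real (Suc n) \<and>
      peval hidden_relation (\<lambda>i. (a i + x*c i) + y*b i) = 0" for n
    by (rule small_perturbed_root[OF Ha nonzero]) simp
  then obtain X Y where XY: "\<And>n. 0 < norm (X n) \<and> norm (X n) < 1 / real (Suc n) \<and> norm (Y n) < 1 / real (Suc n) \<and>
      peval hidden_relation (\<lambda>i. (a i + X n*c i) + Y n*b i) = 0"
    by metis
  have X: "X n \<noteq> 0" "norm (X n) < 1 / real (Suc n)" and Y: "norm (Y n) < 1 / real (Suc n)"
    and root: "peval hidden_relation (\<lambda>i. (a i + X n*c i) + Y n*b i) = 0" for n
    using XY[of n] by simp_all
  have inv: "(\<lambda>n. 1 / real (Suc n)) \<longlonglongrightarrow> 0" using LIMSEQ_inverse_real_of_nat by (simp add: inverse_eq_divide)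
  have X0: "X \<longlonglongrightarrow> 0" by (rule Lim_null_comparison[OF _ inv]) (use X(2) in \<open>auto intro!: always_eventually less_imp_le\<close>)
  have Y0: "Y \<longlonglongrightarrow> 0" by (rule Lim_null_comparison[OF _ inv]) (use Y in \<open>auto intro!: always_eventually less_imp_le\<close>)
  \<comment> \<open>The fourth determinant is the one forced by (EJ1), and below the fourth trace
    the one forced by (EJ2).\<close>
  define D :: "nat \<Rightarrow> complex ^ 4" where "D n = (\<chi> k. if k = 4 then
     - ((d$1 + X n*w 1)*(d$2 + X n*w 2)*(d$3 + X n*w 3)) /
       ((d$1 + X n*w 1)*(d$2 + X n*w 2) + (d$1 + X n*w 1)*(d$3 + X n*w 3) + (d$2 + X n*w 2)*(d$3 + X n*w 3))
     else d$k + X n*w k)" for n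
  have D: "D n$1 = d$1 + X n*w 1" "D n$2 = d$2 + X n*w 2" "D n$3 = d$3 + X n*w 3"
    "D n$4 = - (D n$1*D n$2*D n$3) / e (D n)" for n
    by (simp_all add: D_def e_def)
  define U :: "nat \<Rightarrow> complex ^ 4" where "U n = (\<chi> k. if k = 4 then
     ((t$1 + Y n*(ts 1 - t$1))*D n$2*D n$3 + (t$2 + Y n*(ts 2 - t$2))*D n$1*D n$3
       + (t$3 + Y n*(ts 3 - t$3))*D n$1*D n$2) / e (D n)
     else t$k + Y n*(ts k - t$k))" for n
  have U: "U n$1 = t$1 + Y n*(ts 1 - t$1)" "U n$2 = t$2 + Y n*(ts 2 - t$2)"
    "U n$3 = t$3 + Y n*(ts 3 - t$3)"
    "U n$4 = (U n$1*D n$2*D n$3 + U n$2*D n$1*D n$3 + U n$3*D n$1*D n$2) / e (D n)" for n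
    by (simp_all add: U_def)
  have D_lim': "(\<lambda>n. d$k + X n*w k) \<longlonglongrightarrow> d$k" for k
    using tendsto_add[OF tendsto_const[of "d$k"] tendsto_mult_left_zero[OF X0, of "w k"]] by simp
  have D_lim3: "(\<lambda>n. D n$1) \<longlonglongrightarrow> d$1" "(\<lambda>n. D n$2) \<longlonglongrightarrow> d$2" "(\<lambda>n. D n$3) \<longlonglongrightarrow> d$3"
    unfolding D by (rule D_lim')+
  have e_lim: "(\<lambda>n. e (D n)) \<longlonglongrightarrow> e d" unfolding e_def by (intro tendsto_intros D_lim3)
  have "(\<lambda>n. D n$4) \<longlonglongrightarrow> - (d$1*d$2*d$3) / e d"
    unfolding D(4) by (intro tendsto_intros D_lim3 e_lim e)
  also have "- (d$1*d$2*d$3) / e d = d$4"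
    using cl(2)[folded fun_cong[OF e_def, of d]] e by (simp only: nonzero_divide_eq_eq simp_thms)
  finally have D4: "(\<lambda>n. D n$4) \<longlonglongrightarrow> d$4" .
  have D_lim: "(\<lambda>n. D n$k) \<longlonglongrightarrow> d$k" for k
    using exhaust_4[of k] D_lim3 D4 by auto
  have U_lim': "(\<lambda>n. t$k + Y n*(ts k - t$k)) \<longlonglongrightarrow> t$k" for k
    using tendsto_add[OF tendsto_const[of "t$k"] tendsto_mult_left_zero[OF Y0, of "ts k - t$k"]] by simp
  have U_lim3: "(\<lambda>n. U n$1) \<longlonglongrightarrow> t$1" "(\<lambda>n. U n$2) \<longlonglongrightarrow> t$2" "(\<lambda>n. U n$3) \<longlonglongrightarrow> t$3"
    unfolding U by (rule U_lim')+
  have "(\<lambda>n. U n$4) \<longlonglongrightarrow> (t$1*d$2*d$3 + t$2*d$1*d$3 + t$3*d$1*d$2) / e d"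
    unfolding U(4) by (intro tendsto_intros D_lim3 U_lim3 e_lim e)
  also have "(t$1*d$2*d$3 + t$2*d$1*d$3 + t$3*d$1*d$2) / e d = t$4"
    using cl(3)[folded fun_cong[OF e_def, of d]] e by (simp only: nonzero_divide_eq_eq simp_thms)
  finally have U4: "(\<lambda>n. U n$4) \<longlonglongrightarrow> t$4" .
  have U_lim: "(\<lambda>n. U n$k) \<longlonglongrightarrow> t$k" for k
    using exhaust_4[of k] U_lim3 U4 by auto
  define g where "g = (\<lambda>(t :: complex ^ 4) (d :: complex ^ 4). 9*e d
       - ((d$2 + d$3)*(t$1)^2 + (d$1 + d$3)*(t$2)^2 + (d$1 + d$2)*(t$3)^2
          - 2*d$3*t$1*t$2 - 2*d$2*t$1*t$3 - 2*d$1*t$2*t$3))"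
  \<comment> \<open>The second symmetric function which (BB) prescribes at the perturbed point; the
    sum 1 and the product \<open>L\<close> are kept.\<close>
  define s where "s = (\<lambda>n. L*g (U n) (D n) / e (D n))"
  have "(\<lambda>n. g (U n) (D n)) \<longlonglongrightarrow> g t d"
    unfolding g_def by (intro tendsto_diff tendsto_add tendsto_mult tendsto_power tendsto_const e_lim D_lim3 U_lim3)
  then have "s \<longlonglongrightarrow> L*g t d / e d"
    unfolding s_def by (intro tendsto_divide tendsto_mult tendsto_const e_lim e)
  also have "L*g t d / e d = l$1*l$2 + l$1*l$3 + l$2*l$3"
  proof -
    have "e d*(l$1*l$2 + l$1*l$3 + l$2*l$3) = L*g t d"
      using cl(5) unfolding g_def e_def .
    with e show ?thesis by (metis nonzero_mult_div_cancel_left)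
  qed
  finally have s: "s \<longlonglongrightarrow> l$1*l$2 + l$1*l$3 + l$2*l$3" .
  obtain k1 k2 k3 where k: "k1 \<longlonglongrightarrow> l$1" "k2 \<longlonglongrightarrow> l$2" "k3 \<longlonglongrightarrow> l$3"
    and k_sum: "\<And>n. k1 n + k2 n + k3 n = 1" "\<And>n. k1 n*k2 n + k1 n*k3 n + k2 n*k3 n = s n"
      "\<And>n. k1 n*k2 n*k3 n = L"
    using cubic_roots_converge[OF s cl(4) L_def[symmetric]] by blast
  define M :: "nat \<Rightarrow> complex ^ 3" where "M n = vector [k1 n, k2 n, k3 n]" for n
  have M: "M n$1 = k1 n" "M n$2 = k2 n" "M n$3 = k3 n" for n by (simp_all add: M_def)
  have M_lim: "(\<lambda>n. M n$j) \<longlonglongrightarrow> l$j" for j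
    using exhaust_3[of j] k by (auto simp: M)
  have "eventually (\<lambda>n. D n$1 \<noteq> 0) sequentially" "eventually (\<lambda>n. D n$2 \<noteq> 0) sequentially"
    "eventually (\<lambda>n. D n$3 \<noteq> 0) sequentially" "eventually (\<lambda>n. e (D n) \<noteq> 0) sequentially"
    using tendsto_imp_eventually_ne[OF D_lim] tendsto_imp_eventually_ne[OF e_lim e] dnz by auto
  moreover have sum_ev: "eventually (\<lambda>n. (d$i + X n*w i) + (d$j + X n*w j) \<noteq> 0) sequentially"
    if "w i + w j \<noteq> 0" for i j
  proof (cases "d$i + d$j = 0")
    case True
    have "(d$i + X n*w i) + (d$j + X n*w j) = (d$i + d$j) + X n*(w i + w j)" for n
      by (simp add: algebra_simps)
    with True that X(1) show ?thesis by simp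
  next
    case False
    have "(\<lambda>n. (d$i + X n*w i) + (d$j + X n*w j)) \<longlonglongrightarrow> d$i + d$j"
      by (intro tendsto_add D_lim')
    then show ?thesis using False by (rule tendsto_imp_eventually_ne)
  qed
  have "eventually (\<lambda>n. D n$2 + D n$3 \<noteq> 0) sequentially" "eventually (\<lambda>n. D n$1 + D n$3 \<noteq> 0) sequentially"
    "eventually (\<lambda>n. D n$1 + D n$2 \<noteq> 0) sequentially"
    unfolding D by (rule sum_ev, simp add: w_def)+
  ultimately have "eventually (\<lambda>n. \<exists>v\<in>V2. extended_spectrum v (U n) (D n) (M n)) sequentially"
  proof (eventually_elim)
    case (elim n)
    have 1: "classical_relations (U n) (D n) (M n)"
    proof (unfold classical_relations_iff, intro conjI; (unfold fun_cong[OF e_def, symmetric] M k_sum)?)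
      show "D n$4*e (D n) = - (D n$1*D n$2*D n$3)" using elim by (simp add: D(4))
      show "U n$4*e (D n) = U n$1*D n$2*D n$3 + U n$2*D n$1*D n$3 + U n$3*D n$1*D n$2"
        using elim by (simp add: U(4))
      have "e (D n) * s n = L*g (U n) (D n)" using elim by (simp add: s_def)
      then show "e (D n) * s n = L*(9*e (D n)
       - ((D n$2 + D n$3)*(U n$1)^2 + (D n$1 + D n$3)*(U n$2)^2 + (D n$1 + D n$2)*(U n$3)^2
          - 2*D n$3*U n$1*U n$2 - 2*D n$2*U n$1*U n$3 - 2*D n$1*U n$2*U n$3))"
        unfolding g_def .
    qed (use elim L in auto)
    have "R_eval hidden_relation (U n) (D n) (\<Prod>j\<in>UNIV. M n$j)
        = peval hidden_relation (\<lambda>i. (a i + X n*c i) + Y n*b i)"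
      unfolding R_eval_hidden_relation peval_hidden_relation prod M k_sum elem2_def U D
      by (simp add: a b_def c_def)
    then have 2: "R_eval hidden_relation (U n) (D n) (\<Prod>j\<in>UNIV. M n$j) = 0" unfolding root .
    show ?case by (rule realize[OF 1 2]) (use elim in simp)
  qed
  then obtain n0 where "\<And>n. n \<ge> n0 \<Longrightarrow> \<exists>v\<in>V2. extended_spectrum v (U n) (D n) (M n)"
    unfolding eventually_sequentially by blast
  then have spec: "\<exists>v\<in>V2. extended_spectrum v (U (n + n0)) (D (n + n0)) (M (n + n0))" for n by simp
  show ?thesis
    by (rule that[of "\<lambda>n. U (n + n0)" "\<lambda>n. D (n + n0)" "\<lambda>n. M (n + n0)"])
       (rule spec LIMSEQ_ignore_initial_segment U_lim D_lim M_lim)+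
qed

section \<open>Independence, and the passage to the limit\<close>

lemma independent_hidden_relation: "independent_of_classical hidden_relation"
proof -
  \<comment> \<open>For \<open>t = 0\<close>, (BB) says that the second symmetric function of
    \<open>l\<close> is 9 times the product. Taking \<open>- 1\<close> as one characteristic number
    forces the product \<open>- 1/5\<close>, and the other two are \<open>1 + s\<close> and
    \<open>1 - s\<close>. For these \<open>t\<close> and \<open>d\<close> the polynomial is
    \<open>8*(648*L - 24)^2\<close>, with the only root \<open>L = 1/27\<close>.\<close>
  define s where "s = csqrt (4/5)"
  have s: "s * s = 4/5" using power2_csqrt[of "4/5"] by (simp add: s_def power2_eq_square)
  define t d :: "complex ^ 4" where "t = 0" and "d = (\<chi> k. if k = 4 then - 1/3 else 1)"
  define l :: "complex ^ 3" where "l = vector [- 1, 1 + s, 1 - s]"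
  have d: "d$1 = 1" "d$2 = 1" "d$3 = 1" "d$4 = - 1/3" by (simp_all add: d_def)
  have l: "l$1 = - 1" "l$2 = 1 + s" "l$3 = 1 - s" by (simp_all add: l_def)
  have L: "l$1*l$2*l$3 = - 1/5" unfolding l using s by (simp add: algebra_simps)
  have s2: "l$1*l$2 + l$1*l$3 + l$2*l$3 = - 9/5" unfolding l using s by (simp add: algebra_simps)
  have "classical_relations t d l"
  proof (unfold classical_relations_iff, intro conjI)
    show "l$1 + l$2 + l$3 = 1" by (simp add: l)
  qed (simp_all add: L s2 d t_def)
  moreover have "R_eval hidden_relation t d (\<Prod>j\<in>UNIV. l$j) \<noteq> 0"
  proof -
    have "(\<Prod>j\<in>UNIV. l$j) = - 1/5" using L unfolding UNIV_3 by (simp add: mult.assoc)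
    then show ?thesis
      unfolding R_eval_hidden_relation
      by (simp add: d t_def relation_value_def twin_prod_def twin_sum_def twin_prod_lead_def Let_def
          twin_sum_lead_def twin_sum_rest_def twin_diff_def power2_eq_square)
  qed
  ultimately show ?thesis unfolding independent_of_classical_def by blast
qed

lemma implies_all_relations_hidden_relation: "implies_all_relations hidden_relation"
  unfolding implies_all_relations_def
proof (intro allI impI, elim conjE)
  fix F t d l
  assume F: "\<forall>v\<in>V2. \<forall>t d l. extended_spectrum v t d l \<longrightarrow> spectra_eval F t d l = 0"
    and rel: "classical_relations t d l" and H: "R_eval hidden_relation t d (\<Prod>j\<in>UNIV. l$j) = 0"
  obtain tn dn ln where spec: "\<And>n :: nat. \<exists>v\<in>V2. extended_spectrum v (tn n) (dn n) (ln n)"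
    and lim: "\<And>k. (\<lambda>n. tn n$k) \<longlonglongrightarrow> t$k" "\<And>k. (\<lambda>n. dn n$k) \<longlonglongrightarrow> d$k" "\<And>j. (\<lambda>n. ln n$j) \<longlonglongrightarrow> l$j"
    using spectra_dense[OF rel H] by blast
  have "(\<lambda>n. spectra_eval F (tn n) (dn n) (ln n)) \<longlonglongrightarrow> spectra_eval F t d l"
    unfolding spectra_eval_def
  proof (rule tendsto_peval)
    fix i
    show "(\<lambda>n. case_svar (($) (tn n)) (($) (dn n)) (($) (ln n)) i) \<longlonglongrightarrow> case_svar (($) t) (($) d) (($) l) i"
      by (cases i) (simp_all add: lim)
  qed
  moreover have "spectra_eval F (tn n) (dn n) (ln n) = 0" for n using spec F by blast
  ultimately have "(\<lambda>n. 0) \<longlonglongrightarrow> spectra_eval F t d l" by simp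
  then show "spectra_eval F t d l = 0" by (simp add: LIMSEQ_const_iff)
qed

section \<open>Uniqueness\<close>

lemma poly_model_no_zero_divisors:
  fixes h :: "'b::idom \<Rightarrow> 'x mpoly" and F G :: "'x mpoly"
  assumes h: "poly_model h UNIV" and "F*G = 0"
  shows "F = 0 \<or> G = 0"
proof -
  obtain a where a: "h a = F" using poly_model_onto[OF h] .
  obtain b where b: "h b = G" using poly_model_onto[OF h] .
  have "h (a*b) = h 0" using assms(2) unfolding poly_modelD(2)[OF h] a b poly_modelD(7)[OF h] .
  then have "a*b = 0" by (simp only: poly_modelD(10)[OF h])
  then have "a = 0 \<or> b = 0" by simp
  then show ?thesis using a b poly_modelD(7)[OF h] by auto
qed

lemma unit_is_Const:
  fixes K :: "rvar mpoly"
  assumes "K dvd 1"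
  obtains c where "c \<noteq> 0" "K = Const c"
proof -
  obtain K' where K': "1 = K*K'" using assms by blast
  have nz: "peval K a \<noteq> 0" for a
  proof
    assume "peval K a = 0"
    then have "peval (K*K') a = 0" by simp
    then show False unfolding K'[symmetric] by simp
  qed
  have "peval K a = peval K (\<lambda>_. 0)" for a by (rule peval_const_on_line) (rule nz)
  then have "K - Const (peval K (\<lambda>_. 0)) = 0"
    by (intro peval_eq_zeroD[OF td_model_adjoin]) simp
  then show ?thesis using that nz by auto
qed

text \<open>Two distinct roots determine a quadratic up to a factor. Only nonzero roots are tested,
  because products of characteristic numbers are nonzero. The cross-multiplied form of the
  conclusion can be read as an identity of polynomials.\<close>

lemma quadratics_with_common_roots:
  fixes h0 h1 h2 k0 k1 k2 :: complex
  assumes "h0 \<noteq> 0" "h2 \<noteq> 0" "h1^2 - 4*h0*h2 \<noteq> 0"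
    and common: "\<And>x. x \<noteq> 0 \<Longrightarrow> h2*x^2 + h1*x + h0 = 0 \<Longrightarrow> k2*x^2 + k1*x + k0 = 0"
  shows "h0*(k2*x^2 + k1*x + k0) = k0*(h2*x^2 + h1*x + h0)"
proof -
  define r where "r = csqrt (h1^2 - 4*h0*h2)"
  have r2: "r^2 = h1^2 - 4*h0*h2" by (simp add: r_def)
  have "r \<noteq> 0" using assms(3) r2 by auto
  define y z where "y = (- h1 + r) / (2*h2)" and "z = (- h1 - r) / (2*h2)"
  have y: "2*h2*y = - h1 + r" and z: "2*h2*z = - h1 - r"
    using assms(2) by (simp_all add: y_def z_def)
  have "4*h2*(h2*y^2 + h1*y + h0) = 0" "4*h2*(h2*z^2 + h1*z + h0) = 0"
    using y z r2 by algebra+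
  then have ry: "h2*y^2 + h1*y + h0 = 0" and rz: "h2*z^2 + h1*z + h0 = 0"
    using assms(2) by simp_all
  have "y \<noteq> 0" "z \<noteq> 0" using ry rz assms(1) by auto
  then have ky: "k2*y^2 + k1*y + k0 = 0" and kz: "k2*z^2 + k1*z + k0 = 0"
    using common ry rz by blast+
  have "2*h2*(y - z) = 2*r" using y z by algebra
  then have "y - z \<noteq> 0" using \<open>r \<noteq> 0\<close> by auto
  moreover have "(y - z)*(h2*k1 - k2*h1) = 0" using ry rz ky kz by algebra
  ultimately have e1: "h2*k1 = k2*h1" by simp
  have e0: "h2*k0 = k2*h0" using ry ky e1 by algebra
  have "h2*(h0*(k2*x^2 + k1*x + k0)) = h2*(k0*(h2*x^2 + h1*x + h0))"
    using e0 e1 by algebra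
  with assms(2) show ?thesis by simp
qed

text \<open>(EJ1) and (EJ2) give the fourth entries. The characteristic numbers are the roots of a
  cubic with sum 1, product \<open>L\<close> and the linear coefficient prescribed by (BB).\<close>

lemma classical_completion:
  fixes t1 t2 t3 d1 d2 d3 L :: complex
  assumes nz: "d1 \<noteq> 0" "d2 \<noteq> 0" "d3 \<noteq> 0" "d1*d2 + d1*d3 + d2*d3 \<noteq> 0" "L \<noteq> 0"
  obtains t d l where "classical_relations t d l" "t$1 = t1" "t$2 = t2" "t$3 = t3"
    "d$1 = d1" "d$2 = d2" "d$3 = d3" "(\<Prod>j\<in>UNIV. l$j) = L"
proof -
  define e where "e = d1*d2 + d1*d3 + d2*d3"
  define d :: "complex ^ 4" where "d = (\<chi> k. if k = 1 then d1 else if k = 2 then d2 else if k = 3 then d3 else - (d1*d2*d3) / e)"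
  define t :: "complex ^ 4" where
    "t = (\<chi> k. if k = 1 then t1 else if k = 2 then t2 else if k = 3 then t3 else (t1*d2*d3 + t2*d1*d3 + t3*d1*d2) / e)"
  have d: "d$1 = d1" "d$2 = d2" "d$3 = d3" "d$4 = - (d1*d2*d3) / e" by (simp_all add: d_def)
  have t: "t$1 = t1" "t$2 = t2" "t$3 = t3" "t$4 = (t1*d2*d3 + t2*d1*d3 + t3*d1*d2) / e" by (simp_all add: t_def)
  have e: "e \<noteq> 0" using nz by (simp add: e_def)
  define g where "g = 9*e - ((d2 + d3)*t1^2 + (d1 + d3)*t2^2 + (d1 + d2)*t3^2
          - 2*d3*t1*t2 - 2*d2*t1*t3 - 2*d1*t2*t3)"
  obtain k1 k2 k3 where k: "-1 = - 1*(k1 + k2 + k3)" "L*g / e = 1*(k1*k2 + k1*k3 + k2*k3)" "- L = - 1*k1*k2*k3"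
    using cubic_factors[of 1 "-1" "L*g / e" "- L"] by (metis one_neq_zero)
  define l :: "complex ^ 3" where "l = vector [k1, k2, k3]"
  have l: "l$1 = k1" "l$2 = k2" "l$3 = k3" by (simp_all add: l_def)
  have L: "k1*k2*k3 = L" using k(3) by algebra
  have sum: "k1 + k2 + k3 = 1" using k(1) by algebra
  have "classical_relations t d l"
  proof (unfold classical_relations_iff d(1-3) t(1-3) l e_def[symmetric], intro conjI)
    show "d$4*e = - (d1*d2*d3)" "t$4*e = t1*d2*d3 + t2*d1*d3 + t3*d1*d2"
      using e by (simp_all add: d(4) t(4))
    have "e*(k1*k2 + k1*k3 + k2*k3) = L*g" using k(2) e by (simp add: nonzero_divide_eq_eq mult.commute)
    then show "e*(k1*k2 + k1*k3 + k2*k3) = k1*k2*k3*(9*e - ((d2 + d3)*t1^2 + (d1 + d3)*t2^2 + (d1 + d2)*t3^2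
          - 2*d3*t1*t2 - 2*d2*t1*t3 - 2*d1*t2*t3))"
      unfolding L g_def .
  qed (use nz e L sum in auto)
  moreover have "(\<Prod>j\<in>UNIV. l$j) = L" unfolding UNIV_3 using L by (simp add: l mult.assoc)
  ultimately show ?thesis using that d t by blast
qed

text \<open>\<open>coeff0\<close> does not involve \<open>RLambda\<close>, while over a generic
  value of the other indeterminates some value of \<open>RLambda\<close> is a zero of the
  relation.\<close>

lemma hidden_relation_not_dvd_coeff0: "\<not> hidden_relation dvd coeff0"
proof
  assume "hidden_relation dvd coeff0"
  then obtain K where K: "coeff0 = hidden_relation*K" by blast
  have "coeff0*coeff2 \<noteq> 0"
    using poly_model_no_zero_divisors[OF td_model_adjoin] coeff0_nonzero coeff2_nonzero by blast
  then obtain a where "peval (coeff0*coeff2) a \<noteq> 0"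
    using peval_eq_zeroD[OF td_model_adjoin] by blast
  then have a: "peval coeff0 a \<noteq> 0" "peval coeff2 a \<noteq> 0" by auto
  obtain y where y: "peval coeff0 a + peval coeff1 a*y + peval coeff2 a*y^2 = 0"
    using quadratic_root_exists[OF a(2)] by blast
  define b where "b = a(RLambda := y)"
  have b: "peval coeff0 b = peval coeff0 a" "peval coeff1 b = peval coeff1 a" "peval coeff2 b = peval coeff2 a"
    by (simp_all add: peval_coeff elem2_def b_def)
  have "peval hidden_relation b = 0"
    unfolding hidden_relation_def using y by (simp add: b) (simp add: b_def algebra_simps)
  then have "peval coeff0 b = 0" unfolding K by simp
  with a b show False by simp
qed

lemma holds_on_spectra_proportional:
  assumes "holds_on_spectra H'" and H': "H' = K2*Var RLambda ^ 2 + K1*Var RLambda + K0"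
    and K: "K0 \<in> subring_S" "K1 \<in> subring_S" "K2 \<in> subring_S"
  shows "coeff0*H' = K0*hidden_relation"
proof -
  \<comment> \<open>\<open>G\<close> collects the genericity conditions: nonzero determinants,
    solvability for the field, which is contained in \<open>coeff0\<close>, and two distinct nonzero
    roots in \<open>RLambda\<close>. The identity times \<open>G\<close> holds at every point, and
    \<open>G\<close> is cancelled at the end.\<close>
  define G where "G = Var (RD 1)*Var (RD 2)*Var (RD 3)*coeff0*coeff2*(coeff1^2 - 4*coeff0*coeff2)"
  have "peval (G*(coeff0*H' - K0*hidden_relation)) a = 0" for a
  proof (cases "peval G a = 0")
    case False
    then have nz: "a (RD 1) \<noteq> 0" "a (RD 2) \<noteq> 0" "a (RD 3) \<noteq> 0" "peval coeff0 a \<noteq> 0" "peval coeff2 a \<noteq> 0"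
      "(peval coeff1 a)^2 - 4*peval coeff0 a*peval coeff2 a \<noteq> 0"
      by (auto simp: G_def)
    from nz(4) have e: "elem2 a \<noteq> 0" and x: "(a (RD 2) + a (RD 3))*(a (RD 1) + a (RD 3))*(a (RD 1) + a (RD 2)) \<noteq> 0"
      unfolding peval_coeff(1) mult_eq_0_iff de_Morgan_disj by auto
    have "peval K2 a*L^2 + peval K1 a*L + peval K0 a = 0"
      if L: "L \<noteq> 0" "peval coeff2 a*L^2 + peval coeff1 a*L + peval coeff0 a = 0" for L
    proof -
      obtain t d l where rel: "classical_relations t d l" and t: "t$1 = a (RT 1)" "t$2 = a (RT 2)" "t$3 = a (RT 3)"
        and d: "d$1 = a (RD 1)" "d$2 = a (RD 2)" "d$3 = a (RD 3)" and l: "(\<Prod>j\<in>UNIV. l$j) = L"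
        using classical_completion[OF nz(1-3) e[unfolded elem2_def] L(1)] by metis
      have "R_eval hidden_relation t d L = 0"
        using L(2) unfolding R_eval_hidden_relation t d peval_coeff relation_value_def elem2_def by simp
      then obtain v where "v \<in> V2" "extended_spectrum v t d l"
        using realize[OF rel] x unfolding l d by blast
      then have "R_eval H' t d L = 0" using assms(1) l unfolding holds_on_spectra_def by blast
      moreover define b where "b = case_rvar (($) t) (($) d) L"
      ultimately have 0: "peval H' b = 0" by (simp add: R_eval_def)
      have "peval F b = peval F a" if "F \<in> subring_S" for F
        using that unfolding subring_S_eq by (rule peval_cong_over) (auto simp: b_def t d)
      with 0 K show ?thesis unfolding H' by (simp add: b_def)
    qed
    from quadratics_with_common_roots[OF nz(4-6) this]
    have "peval (coeff0*H') a = peval (K0*hidden_relation) a"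
      unfolding H' hidden_relation_def by simp
    then show ?thesis by simp
  qed simp
  then have "G*(coeff0*H' - K0*hidden_relation) = 0"
    by (rule peval_eq_zeroD[OF td_model_adjoin])
  note zd = poly_model_no_zero_divisors[OF td_model_adjoin]
  have "coeff1^2 - 4*coeff0*coeff2 \<noteq> 0"
  proof
    assume "coeff1^2 - 4*coeff0*coeff2 = 0"
    then have "peval (coeff1^2 - 4*coeff0*coeff2) a = 0" for a by simp
    then show False using discriminant_not_square[of 0] by simp
  qed
  moreover have "Var i \<noteq> (0 :: rvar mpoly)" for i
  proof
    assume "Var i = (0 :: rvar mpoly)"
    then have "peval (Var i) (\<lambda>_. 1 :: complex) = 0" by simp
    then show False by simp
  qed
  ultimately have "G \<noteq> 0" using zd coeff0_nonzero coeff2_nonzero unfolding G_def by metis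
  with zd[OF \<open>G*(coeff0*H' - K0*hidden_relation) = 0\<close>] show ?thesis by simp
qed

lemma missing_relation_hidden_relation: "missing_relation hidden_relation"
  unfolding missing_relation_def
  using spectral_form_hidden_relation irreducible_hidden_relation holds_on_spectra_hidden_relation
    independent_hidden_relation implies_all_relations_hidden_relation by blast

lemma missing_relation_unique:
  assumes "missing_relation H'"
  shows "\<exists>c. c \<noteq> 0 \<and> H' = Const c*hidden_relation"
proof -
  obtain K0 K1 K2 where K: "K0 \<in> subring_S" "K1 \<in> subring_S" "K2 \<in> subring_S"
    and H': "H' = K2*Var RLambda ^ 2 + K1*Var RLambda + K0"
    using assms unfolding missing_relation_def spectral_form_def by blast
  have irr: "irreducible H'" and holds: "holds_on_spectra H'"
    using assms by (auto simp: missing_relation_def)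
  have "coeff0*H' = K0*hidden_relation"
    by (rule holds_on_spectra_proportional[OF holds H' K])
  \<comment> \<open>A prime element that does not divide \<open>coeff0\<close> must divide
    \<open>H'\<close>; as \<open>H'\<close> is irreducible, the cofactor is a unit.\<close>
  then have "hidden_relation dvd coeff0*H'" by simp
  then have "hidden_relation dvd H'"
    using irreducible_dvd_multD[OF td_model_adjoin irreducible_hidden_relation] hidden_relation_not_dvd_coeff0
    by blast
  then obtain K where K: "H' = hidden_relation*K" by blast
  then have "K dvd 1"
    using irreducibleD[OF irr K] irreducible_hidden_relation by (auto simp: irreducible_def)
  then obtain c where "c \<noteq> 0" "K = Const c" by (rule unit_is_Const)
  then show ?thesis using K by (auto simp: mult.commute)
qed

theorem theorem1p2:
  shows "\<exists>H. missing_relation H \<and>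
           (\<forall>H'. missing_relation H' \<longrightarrow> (\<exists>c. c \<noteq> 0 \<and> H' = Const c*H))"
  using missing_relation_hidden_relation missing_relation_unique by blast

end
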